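(* Let $E$ and $F$ be complex Banach spaces, $U$ an open subset of $E$, and $1\leq p\leq\infty$. Then $\mathcal{D}_p^{\mathcal{H}^\infty}(U,F^* )$ (with the norm $d_p^{\mathcal{H}^\infty}$) is isometrically isomorphic to $(\mathcal{G}^\infty(U)\widehat{\otimes}_{g_p}F)^*$, via the mapping $\Lambda\colon\mathcal{D}_p^{\mathcal{H}^\infty}(U,F^* )\to(\mathcal{G}^\infty(U)\widehat{\otimes}_{g_p}F)^*$ defined by $$\Lambda(f)(u)=\sum_{i=1}^n\lambda_i\langle f(x_i),y_i\rangle$$ for $f\in\mathcal{D}_p^{\mathcal{H}^\infty}(U,F^* )$ and $u=\sum_{i=1}^n\lambda_i\delta(x_i)\otimes y_i\in\Delta(U)\otimes F$. Furthermore, its inverse is given by $$\langle\Lambda^{-1}(\varphi)(x),y\rangle=\langle\varphi,\delta(x)\otimes y\rangle$$ for $\varphi\in(\mathcal{G}^\infty(U)\widehat{\otimes}_{g_p}F)^*$, $x\in U$ and $y\in F$.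
   Context: $\mathcal{H}^\infty(U,F)$ is the Banach space of bounded holomorphic mappings $U\to F$ with the supremum norm, $\mathcal{H}^\infty(U)=\mathcal{H}^\infty(U,\mathbb{C})$. For $x\in U$, $\delta(x)\in\mathcal{H}^\infty(U)^*$ is evaluation at $x$; $\Delta(U)$ is the linear span of $\{\delta(x):x\in U\}$, and $\mathcal{G}^\infty(U)$ is its norm closure in $\mathcal{H}^\infty(U)^*$. $B_X$ is the closed unit ball of $X$; $p^*$ is the conjugate index of $p$ ($1^*=\infty$, $\infty^*=1$). For vectors in a normed space $X$ and $1\le q\le\infty$: $\|(x_i)_{i=1}^n\|_{\ell_q^n(X)}=(\sum_i\|x_i\|^q)^{1/q}$ ($\max_i\|x_i\|$ if $q=\infty$), and $\|(x_i)_{i=1}^n\|_{\ell_q^{n,w}(X)}=\sup_{x^*\in B_{X^*}}(\sum_i|x^*(x_i)|^q)^{1/q}$ ($\sup_{x^*}\max_i|x^*(x_i)|$ if $q=\infty$); $\ell_q^n=\ell_q^n(\mathbb{C})$. The Chevet–Saphar norm $g_p$ on the algebraic tensor product $X\otimes Y$ of normed spaces is $g_p(u)=\inf\|(x_i)\|_{\ell_p^n(X)}\|(y_i)\|_{\ell_{p^*}^{n,w}(Y)}$, the infimum over all representations $u=\sum_{i=1}^nx_i\otimes y_i$; $X\widehat\otimes_{g_p}Y$ is the completion of $(X\otimes Y,g_p)$. The space $\Delta(U)\otimes F$ is a dense subspace of $\mathcal{G}^\infty(U)\widehat\otimes_{g_p}F$, and $\Lambda(f)$ denotes the continuous linear functional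 on $\mathcal{G}^\infty(U)\widehat\otimes_{g_p}F$ determined by the displayed values on $\Delta(U)\otimes F$. For a complex Banach space $G$, a holomorphic $f\colon U\to G$ is Cohen strongly $p$-summing if there is $C\geq0$ such that for all $n\in\mathbb{N}$, $\lambda_i\in\mathbb{C}$, $x_i\in U$, $z_i^*\in G^*$ ($1\le i\le n$), $\sum_{i=1}^n|\lambda_i||\langle z_i^*,f(x_i)\rangle|\leq C\|(\lambda_i)\|_{\ell_p^n}\|(z_i^* )\|_{\ell_{p^*}^{n,w}(G^* )}$. $d_p^{\mathcal{H}^\infty}(f)$ is the infimum of such $C$, and $\mathcal{D}_p^{\mathcal{H}^\infty}(U,G)$ is the space of all such $f$ with norm $d_p^{\mathcal{H}^\infty}$. *)

theory Defs
  imports "HOL-Analysis.Analysis" "HOL-Library.Function_Algebras"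
begin

subsection \<open>Complex vector spaces and complex Banach spaces\<close>

class scaleC =
  fixes scaleC :: "complex \<Rightarrow> 'a \<Rightarrow> 'a" (infixr \<open>*\<^sub>C\<close> 75)

class complex_vector = ab_group_add + scaleC +
  assumes scaleC_add_right: "a *\<^sub>C (x + y) = a *\<^sub>C x + a *\<^sub>C y"
    and scaleC_add_left: "(a + b) *\<^sub>C x = a *\<^sub>C x + b *\<^sub>C x"
    and scaleC_scaleC: "a *\<^sub>C (b *\<^sub>C x) = (a * b) *\<^sub>C x"
    and scaleC_one: "1 *\<^sub>C x = x"

interpretation complex_vector: vector_space "scaleC :: complex \<Rightarrow> 'a \<Rightarrow> 'a::complex_vector"
  by unfold_locales (simp_all add: scaleC_add_right scaleC_add_left scaleC_scaleC scaleC_one)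

class complex_normed_vector = complex_vector + real_normed_vector +
  assumes scaleR_scaleC: "r *\<^sub>R x = complex_of_real r *\<^sub>C x"
    and norm_scaleC: "norm (a *\<^sub>C x) = cmod a * norm x"

class complex_banach = complex_normed_vector + banach

instantiation complex :: complex_banach
begin
definition scaleC_complex :: "complex \<Rightarrow> complex \<Rightarrow> complex"
  where "scaleC_complex a x = a * x"
instance
  by intro_classes (simp_all add: scaleC_complex_def algebra_simps norm_mult scaleR_conv_of_real)
end

text \<open>Addition on function types is pointwise (from the theory \<open>Function_Algebras\<close>);
  so is multiplication by complex scalars.\<close>

instantiation "fun" :: (type, complex_vector) complex_vector
begin
definition scaleC_fun :: "complex \<Rightarrow> ('a \<Rightarrow> 'b) \<Rightarrow> 'a \<Rightarrow> 'b"
  where "scaleC_fun c f = (\<lambda>x. c *\<^sub>C f x)"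
instance
  by intro_classes
    (simp_all add: scaleC_fun_def fun_eq_iff scaleC_add_right scaleC_add_left scaleC_scaleC scaleC_one)
end

subsection \<open>Normed spaces carried by a subspace of a type\<close>

text \<open>Spaces such as \<open>\<G>\<^sup>\<infinity>(U)\<close> depend on the term \<open>U\<close>, so they cannot be types.
  A normed space is therefore a linear subspace of an ambient type together with a norm on it;
  the norm is meaningful on \<open>points\<close> only.\<close>

record 'a nspace =
  points :: "'a set"
  nrm :: "'a \<Rightarrow> real"

definition whole :: "'a::complex_normed_vector nspace" where
  "whole = \<lparr>points = UNIV, nrm = norm\<rparr>"

definition normed_space :: "'a::complex_vector nspace \<Rightarrow> bool" where
  "normed_space X \<longleftrightarrow> complex_vector.subspace (points X) \<and>
     (\<forall>x\<in>points X. 0 \<le> nrm X x \<and> (nrm X x = 0 \<longleftrightarrow> x = 0)) \<and>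
     (\<forall>x\<in>points X. \<forall>y\<in>points X. nrm X (x + y) \<le> nrm X x + nrm X y) \<and>
     (\<forall>c. \<forall>x\<in>points X. nrm X (c *\<^sub>C x) = cmod c * nrm X x)"

definition cauchy_in :: "'a::complex_vector nspace \<Rightarrow> (nat \<Rightarrow> 'a) \<Rightarrow> bool" where
  "cauchy_in X s \<longleftrightarrow> range s \<subseteq> points X \<and>
     (\<forall>e>0. \<exists>N. \<forall>m\<ge>N. \<forall>n\<ge>N. nrm X (s m - s n) < e)"

definition complete_space_in :: "'a::complex_vector nspace \<Rightarrow> bool" where
  "complete_space_in X \<longleftrightarrow>
     (\<forall>s. cauchy_in X s \<longrightarrow> (\<exists>l\<in>points X. (\<lambda>n. nrm X (s n - l)) \<longlonglongrightarrow> 0))"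

definition linear_between :: "'a::complex_vector nspace \<Rightarrow> 'b::complex_vector nspace \<Rightarrow> ('a \<Rightarrow> 'b) \<Rightarrow> bool" where
  "linear_between X Y T \<longleftrightarrow> T ` points X \<subseteq> points Y \<and>
     (\<forall>x\<in>points X. \<forall>y\<in>points X. T (x + y) = T x + T y) \<and>
     (\<forall>c. \<forall>x\<in>points X. T (c *\<^sub>C x) = c *\<^sub>C T x)"

definition isometric_isomorphism ::
    "'a::complex_vector nspace \<Rightarrow> 'b::complex_vector nspace \<Rightarrow> ('a \<Rightarrow> 'b) \<Rightarrow> bool" where
  "isometric_isomorphism X Y T \<longleftrightarrow> normed_space X \<and> normed_space Y \<and>
     linear_between X Y T \<and> bij_betw T (points X) (points Y) \<and>
     (\<forall>x\<in>points X. nrm Y (T x) = nrm X x)"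

text \<open>\<open>Z\<close> together with the embedding \<open>j\<close> is a completion of \<open>X\<close>. This determines \<open>(Z, j)\<close> up to
  a unique isometric isomorphism; lemma \<open>completion_exists\<close> below gives existence.\<close>

definition is_completion ::
    "'a::complex_vector nspace \<Rightarrow> 'b::complex_vector nspace \<Rightarrow> ('a \<Rightarrow> 'b) \<Rightarrow> bool" where
  "is_completion X Z j \<longleftrightarrow> normed_space Z \<and> complete_space_in Z \<and> linear_between X Z j \<and>
     (\<forall>x\<in>points X. nrm Z (j x) = nrm X x) \<and>
     (\<forall>z\<in>points Z. \<forall>e>0. \<exists>x\<in>points X. nrm Z (z - j x) < e)"

lemma completion_exists:
  fixes X :: "'a::complex_vector nspace"
  assumes X: "normed_space X"
  obtains Z :: "(nat \<Rightarrow> 'a) nspace" and j where "is_completion X Z j"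
proof -
  let ?S = "points X" and ?n = "nrm X"
  have S: "complex_vector.subspace ?S"
    and n0: "\<And>x. x \<in> ?S \<Longrightarrow> 0 \<le> ?n x" and nz: "\<And>x. x \<in> ?S \<Longrightarrow> ?n x = 0 \<longleftrightarrow> x = 0"
    and tri: "\<And>x y. x \<in> ?S \<Longrightarrow> y \<in> ?S \<Longrightarrow> ?n (x + y) \<le> ?n x + ?n y"
    and hom: "\<And>c x. x \<in> ?S \<Longrightarrow> ?n (c *\<^sub>C x) = cmod c * ?n x"
    using X by (auto simp: normed_space_def)
  note sub = complex_vector.subspace_0[OF S] complex_vector.subspace_add[OF S]
    complex_vector.subspace_scale[OF S] complex_vector.subspace_diff[OF S]
  have sym: "?n (x - y) = ?n (y - x)" if "x \<in> ?S" "y \<in> ?S" for x y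
    using hom[of "y - x" "-1"] that sub by (simp add: complex_vector.scale_minus_left)
  have tri3: "?n (x - z) \<le> ?n (x - y) + ?n (y - z)" if "x \<in> ?S" "y \<in> ?S" "z \<in> ?S" for x y z
    using tri[of "x - y" "y - z"] that sub by simp
  have rev: "\<bar>?n x - ?n y\<bar> \<le> ?n (x - y)" if "x \<in> ?S" "y \<in> ?S" for x y
    using tri[of "x - y" y] tri[of "y - x" x] sym[OF that] that sub by simp
  define C where "C = {s. cauchy_in X s}"
  define N where "N = {s. range s \<subseteq> ?S \<and> (\<lambda>k. ?n (s k)) \<longlonglongrightarrow> 0}"
  define L where "L s = lim (\<lambda>k. ?n (s k))" for s
  have CS: "s k \<in> ?S" if "s \<in> C" for s k
    using that by (auto simp: C_def cauchy_in_def)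
  have CE: "\<exists>M. \<forall>k\<ge>M. \<forall>m\<ge>M. ?n (s k - s m) < e" if "s \<in> C" "e > 0" for s e
    using that unfolding C_def cauchy_in_def by blast
  have Csub: "complex_vector.subspace C"
  proof (rule complex_vector.subspaceI)
    show "0 \<in> C" using sub nz[of 0] by (auto simp: C_def cauchy_in_def)
  next
    fix s t assume s: "s \<in> C" and t: "t \<in> C"
    have "\<exists>M. \<forall>k\<ge>M. \<forall>m\<ge>M. ?n ((s + t) k - (s + t) m) < e" if "e > 0" for e
    proof -
      obtain M1 where M1: "\<And>k m. k \<ge> M1 \<Longrightarrow> m \<ge> M1 \<Longrightarrow> ?n (s k - s m) < e / 2"
        using CE[of s "e / 2"] s \<open>e > 0\<close> by auto
      obtain M2 where M2: "\<And>k m. k \<ge> M2 \<Longrightarrow> m \<ge> M2 \<Longrightarrow> ?n (t k - t m) < e / 2"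
        using CE[of t "e / 2"] t \<open>e > 0\<close> by auto
      have "?n ((s + t) k - (s + t) m) < e" if "k \<ge> max M1 M2" "m \<ge> max M1 M2" for k m
        using M1[of k m] M2[of k m] tri[of "s k - s m" "t k - t m"] that CS[OF s] CS[OF t] sub
        by (simp add: algebra_simps)
      then show ?thesis by blast
    qed
    then show "s + t \<in> C" using CS[OF s] CS[OF t] sub by (auto simp: C_def cauchy_in_def)
  next
    fix c and s assume s: "s \<in> C"
    have "\<exists>M. \<forall>k\<ge>M. \<forall>m\<ge>M. ?n ((c *\<^sub>C s) k - (c *\<^sub>C s) m) < e" if "e > 0" for e
    proof -
      have "e / (cmod c + 1) > 0" using \<open>e > 0\<close> by (simp add: add_nonneg_pos)
      then obtain M where M: "\<And>k m. k \<ge> M \<Longrightarrow> m \<ge> M \<Longrightarrow> ?n (s k - s m) < e / (cmod c + 1)"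
        using CE[OF s] by blast
      have "?n ((c *\<^sub>C s) k - (c *\<^sub>C s) m) < e" if "k \<ge> M" "m \<ge> M" for k m
      proof -
        have "?n ((c *\<^sub>C s) k - (c *\<^sub>C s) m) = cmod c * ?n (s k - s m)"
          using hom[of "s k - s m" c] CS[OF s] sub
          by (simp add: scaleC_fun_def complex_vector.scale_right_diff_distrib)
        also have "\<dots> \<le> (cmod c + 1) * ?n (s k - s m)"
          using n0 CS[OF s] sub by (intro mult_right_mono) auto
        also have "\<dots> < e"
          using M[OF that] by (simp add: pos_less_divide_eq add_nonneg_pos mult.commute)
        finally show ?thesis .
      qed
      then show ?thesis by blast
    qed
    then show "c *\<^sub>C s \<in> C" using CS[OF s] sub by (auto simp: C_def cauchy_in_def scaleC_fun_def)
  qed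
  have LC: "(\<lambda>k. ?n (s k)) \<longlonglongrightarrow> L s" if "s \<in> C" for s
  proof -
    have "Cauchy (\<lambda>k. ?n (s k))"
      unfolding Cauchy_def dist_real_def
    proof (intro allI impI)
      fix e :: real assume "e > 0"
      then obtain M where M: "\<And>k m. k \<ge> M \<Longrightarrow> m \<ge> M \<Longrightarrow> ?n (s k - s m) < e"
        using CE[OF \<open>s \<in> C\<close>] by blast
      then show "\<exists>M. \<forall>k\<ge>M. \<forall>m\<ge>M. \<bar>?n (s k) - ?n (s m)\<bar> < e"
        using le_less_trans[OF rev[OF CS[OF \<open>s \<in> C\<close>] CS[OF \<open>s \<in> C\<close>]] M] by blast
    qed
    then show ?thesis unfolding L_def by (simp add: Cauchy_convergent convergent_LIMSEQ_iff[symmetric])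
  qed
  have NC: "N \<subseteq> C"
  proof
    fix s assume s: "s \<in> N"
    then have sS: "s k \<in> ?S" for k by (auto simp: N_def)
    have "\<exists>M. \<forall>k\<ge>M. \<forall>m\<ge>M. ?n (s k - s m) < e" if "e > 0" for e
    proof -
      have "\<forall>\<^sub>F k in sequentially. ?n (s k) < e / 2"
        using s order_tendstoD(2)[of "\<lambda>k. ?n (s k)" 0 sequentially "e / 2"] \<open>e > 0\<close> by (auto simp: N_def)
      then obtain M where M: "\<And>k. k \<ge> M \<Longrightarrow> ?n (s k) < e / 2" by (auto simp: eventually_sequentially)
      have "?n (s k - s m) < e" if "k \<ge> M" "m \<ge> M" for k m
        using M[OF that(1)] M[OF that(2)] tri3[of "s k" 0 "s m"] sym[of 0 "s m"] sS[of k] sS[of m] sub(1)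
        by simp
      then show ?thesis by blast
    qed
    then show "s \<in> C" using s by (auto simp: N_def C_def cauchy_in_def)
  qed
  have NL: "s \<in> N \<longleftrightarrow> L s = 0" if "s \<in> C" for s
    using LC[OF that] CS[OF that] LIMSEQ_unique by (auto simp: N_def)
  have L0: "0 \<le> L s" if "s \<in> C" for s
    by (rule LIMSEQ_le_const[OF LC[OF that]]) (use n0 CS[OF that] in auto)
  have Ltri: "L (s + t) \<le> L s + L t" if s: "s \<in> C" and t: "t \<in> C" for s t
    by (rule LIMSEQ_le[OF LC[OF complex_vector.subspace_add[OF Csub s t]] tendsto_add[OF LC[OF s] LC[OF t]]])
       (use tri CS[OF s] CS[OF t] in auto)
  have Lhom: "L (c *\<^sub>C s) = cmod c * L s" if s: "s \<in> C" for c s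
    using LIMSEQ_unique[OF LC[OF complex_vector.subspace_scale[OF Csub s, of c]]] tendsto_mult_left[OF LC[OF s], of "cmod c"]
      hom CS[OF s] by (simp add: scaleC_fun_def)
  have Nsub: "complex_vector.subspace N"
  proof (rule complex_vector.subspaceI)
    have "0 \<in> C" by (rule complex_vector.subspace_0[OF Csub])
    then show "0 \<in> N" using sub nz[of 0] by (auto simp: N_def)
  next
    fix s t assume "s \<in> N" "t \<in> N"
    then show "s + t \<in> N"
      using NC NL[of s] NL[of t] NL[of "s + t"] Ltri[of s t] L0[of "s + t"] complex_vector.subspace_add[OF Csub, of s t]
      by (auto simp: subset_iff)
  next
    fix c s assume "s \<in> N"
    then show "c *\<^sub>C s \<in> N"
      using NC NL[of s] NL[of "c *\<^sub>C s"] Lhom[of s c] complex_vector.subspace_scale[OF Csub, of s c]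
      by (auto simp: subset_iff)
  qed
  interpret pr: vector_space_pair "scaleC :: complex \<Rightarrow> (nat \<Rightarrow> 'a) \<Rightarrow> _" "scaleC :: complex \<Rightarrow> (nat \<Rightarrow> 'a) \<Rightarrow> _" ..
  obtain g :: "(nat \<Rightarrow> 'a) \<Rightarrow> (nat \<Rightarrow> 'a)" where gN: "range g \<subseteq> N" and glin: "Vector_Spaces.linear scaleC scaleC g" and gid: "\<forall>v\<in>N. g v = v"
    using pr.linear_exists_left_inverse_on[OF complex_vector.linear_id Nsub] by auto
  interpret g: Vector_Spaces.linear scaleC scaleC g by (rule glin)
  define P where "P s = s - g s" for s
  have Padd: "P (s + t) = P s + P t" for s t by (simp add: P_def g.add)
  have Pscale: "P (c *\<^sub>C s) = c *\<^sub>C P s" for c s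
    by (simp add: P_def g.scale complex_vector.scale_right_diff_distrib)
  have Pdiff: "P (s - t) = P s - P t" for s t by (simp add: P_def g.diff)
  have gC: "g s \<in> C" for s using gN NC by auto
  have PC: "P s \<in> C" if "s \<in> C" for s
    unfolding P_def using complex_vector.subspace_diff[OF Csub that gC] .
  have LP: "L (P s) = L s" if s: "s \<in> C" for s
  proof -
    have "L (g s) = 0" using NL[OF gC, of s] gN by auto
    moreover have "L (- g s) = 0" using Lhom[OF gC, of "-1" s] calculation by (simp add: complex_vector.scale_minus_left)
    moreover have "- g s \<in> C" using complex_vector.subspace_neg[OF Csub gC] .
    ultimately show ?thesis
      using Ltri[OF PC[OF s] gC, of s] Ltri[OF s, of "- g s"] by (simp add: P_def)
  qed
  define Z where "Z = \<lparr>points = P ` C, nrm = L\<rparr>"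
  define j where "j x = P (\<lambda>_. x)" for x
  have constC: "(\<lambda>_. x) \<in> C" if "x \<in> ?S" for x
    using that nz[of 0] sub by (auto simp: C_def cauchy_in_def)
  have Lconst: "L (\<lambda>_. x) = ?n x" for x by (simp add: L_def)
  have "normed_space Z"
    unfolding normed_space_def
  proof (intro conjI ballI allI)
    show "complex_vector.subspace (points Z)"
      unfolding Z_def
    proof (simp, rule complex_vector.subspaceI)
      show "0 \<in> P ` C" using imageI[OF complex_vector.subspace_0[OF Csub], of P] by (simp add: P_def)
    next
      fix x y assume "x \<in> P ` C" "y \<in> P ` C"
      then obtain s t where "s \<in> C" "t \<in> C" "x = P s" "y = P t" by blast
      then show "x + y \<in> P ` C"
        using imageI[OF complex_vector.subspace_add[OF Csub], of s t P] by (simp only: Padd)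
    next
      fix c x assume "x \<in> P ` C"
      then obtain s where "s \<in> C" "x = P s" by blast
      then show "c *\<^sub>C x \<in> P ` C"
        using imageI[OF complex_vector.subspace_scale[OF Csub], of s P c] by (simp only: Pscale)
    qed
  next
    fix x assume x: "x \<in> points Z"
    then show "0 \<le> nrm Z x" using L0 PC by (auto simp: Z_def)
    show "nrm Z x = 0 \<longleftrightarrow> x = 0"
    proof
      assume "nrm Z x = 0"
      moreover obtain s where s: "s \<in> C" "x = P s" using x by (auto simp: Z_def)
      ultimately have "s \<in> N" using NL LP by (simp add: Z_def)
      then show "x = 0" using s gid by (simp add: P_def)
    next
      assume "x = 0" then show "nrm Z x = 0" using Lconst[of 0] nz[of 0] sub by (simp add: Z_def zero_fun_def)
    qed
  next
    fix x y assume "x \<in> points Z" "y \<in> points Z"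
    then show "nrm Z (x + y) \<le> nrm Z x + nrm Z y" using Ltri PC by (auto simp: Z_def)
  next
    fix c x assume "x \<in> points Z"
    then show "nrm Z (c *\<^sub>C x) = cmod c * nrm Z x" using Lhom PC by (auto simp: Z_def)
  qed
  moreover have "linear_between X Z j"
    unfolding linear_between_def
  proof (intro conjI ballI allI)
    show "j ` ?S \<subseteq> points Z" using constC by (auto simp: Z_def j_def)
    show "j (x + y) = j x + j y" for x y using Padd[of "\<lambda>_. x" "\<lambda>_. y"] by (simp add: j_def plus_fun_def)
    show "j (c *\<^sub>C x) = c *\<^sub>C j x" for c x
    proof -
      have "c *\<^sub>C (\<lambda>_. x) = (\<lambda>_::nat. c *\<^sub>C x)" by (simp add: scaleC_fun_def)
      then show ?thesis using Pscale[of c "\<lambda>_. x"] by (simp add: j_def)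
    qed
  qed
  moreover have "\<forall>x\<in>?S. nrm Z (j x) = ?n x"
    using LP constC Lconst by (auto simp: Z_def j_def)
  moreover have approx: "L (P s - j (s k)) \<le> e"
    if s: "s \<in> C" and e: "\<And>m. m \<ge> k \<Longrightarrow> ?n (s m - s k) \<le> e" for s k e
  proof -
    have c: "s - (\<lambda>_. s k) \<in> C" using complex_vector.subspace_diff[OF Csub s constC[OF CS[OF s]]] .
    have "L (P s - j (s k)) = L (s - (\<lambda>_. s k))" using LP[OF c] by (simp add: j_def Pdiff)
    also have "\<dots> \<le> e" by (rule LIMSEQ_le_const2[OF LC[OF c]]) (use e in auto)
    finally show ?thesis .
  qed
  have dense: "\<exists>x\<in>?S. nrm Z (z - j x) < e" if z: "z \<in> points Z" and e: "e > 0" for z e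
  proof -
    obtain s where s: "s \<in> C" "z = P s" using z by (auto simp: Z_def)
    obtain M where M: "\<And>k m. k \<ge> M \<Longrightarrow> m \<ge> M \<Longrightarrow> ?n (s k - s m) < e / 2"
      using CE[of s "e / 2"] s e by auto
    have "L (P s - j (s M)) \<le> e / 2" by (rule approx[OF s(1)]) (use M in force)
    then show ?thesis using s CS[OF s(1)] e by (intro bexI[of _ "s M"]) (auto simp: Z_def)
  qed
  moreover have "complete_space_in Z"
    unfolding complete_space_in_def
  proof (intro allI impI)
    fix z assume z: "cauchy_in Z z"
    note zp = \<open>normed_space Z\<close>[unfolded normed_space_def, THEN conjunct1]
    have zZ: "z k \<in> points Z" for k using z by (auto simp: cauchy_in_def)
    have Ztri: "L (x - w) \<le> L (x - y) + L (y - w)" if "x \<in> points Z" "y \<in> points Z" "w \<in> points Z" for x y w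
      using Ltri[of "x - y" "y - w"] that PC complex_vector.subspace_diff[OF Csub] by (auto simp: Z_def)
    have Zsym: "L (x - y) = L (y - x)" if "x \<in> points Z" "y \<in> points Z" for x y
    proof -
      have "y - x \<in> C" using that PC complex_vector.subspace_diff[OF Csub] by (auto simp: Z_def)
      from Lhom[OF this, of "-1"] show ?thesis by (simp add: complex_vector.scale_minus_left)
    qed
    have "\<forall>k. \<exists>x\<in>?S. L (z k - j x) < inverse (real (Suc k))"
      using dense[OF zZ] by (simp add: Z_def)
    then obtain s where sS: "\<And>k. s k \<in> ?S" and sL: "\<And>k. L (z k - j (s k)) < inverse (real (Suc k))"
      by metis
    have jZ: "j x \<in> points Z" if "x \<in> ?S" for x using constC[OF that] by (auto simp: Z_def j_def)
    have jdist: "L (j x - j y) = ?n (x - y)" if "x \<in> ?S" "y \<in> ?S" for x y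
      using LP[OF constC[of "x - y"]] Lconst[of "x - y"] that sub Pdiff[of "\<lambda>_. x" "\<lambda>_. y"]
      by (simp add: j_def fun_diff_def[of "\<lambda>_. x" "\<lambda>_. y"])
    have inv0: "(\<lambda>k. inverse (real (Suc k))) \<longlonglongrightarrow> 0" by (rule LIMSEQ_inverse_real_of_nat)
    have sC: "s \<in> C"
    proof -
      have "\<exists>M. \<forall>k\<ge>M. \<forall>m\<ge>M. ?n (s k - s m) < e" if e: "e > 0" for e
      proof -
        obtain M1 where M1: "\<And>k m. k \<ge> M1 \<Longrightarrow> m \<ge> M1 \<Longrightarrow> L (z k - z m) < e / 3"
          using z e unfolding cauchy_in_def Z_def by (force dest: spec[of _ "e / 3"])
        obtain M2 where M2: "\<And>k. k \<ge> M2 \<Longrightarrow> inverse (real (Suc k)) < e / 3"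
          using order_tendstoD(2)[OF inv0, of "e / 3"] e by (auto simp: eventually_sequentially)
        have "?n (s k - s m) < e" if k: "k \<ge> max M1 M2" and m: "m \<ge> max M1 M2" for k m
        proof -
          have "?n (s k - s m) = L (j (s k) - j (s m))" using jdist sS by simp
          also have "\<dots> \<le> L (j (s k) - z k) + (L (z k - z m) + L (z m - j (s m)))"
            using Ztri[OF jZ[OF sS[of k]] zZ[of k] jZ[OF sS[of m]]] Ztri[OF zZ[of k] zZ[of m] jZ[OF sS[of m]]] by simp
          also have "\<dots> < e"
            using Zsym[OF jZ[OF sS[of k]] zZ[of k]] sL[of k] sL[of m] M1[of k m] M2[of k] M2[of m] k m by simp
          finally show ?thesis .
        qed
        then show ?thesis by blast
      qed
      then show ?thesis using sS by (auto simp: C_def cauchy_in_def)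
    qed
    have "(\<lambda>k. L (z k - P s)) \<longlonglongrightarrow> 0"
    proof (rule LIMSEQ_I)
      fix e :: real assume e: "e > 0"
      obtain M1 where M1: "\<And>k m. k \<ge> M1 \<Longrightarrow> m \<ge> M1 \<Longrightarrow> ?n (s k - s m) < e / 2"
        using CE[of s "e / 2"] sC e by auto
      obtain M2 where M2: "\<And>k. k \<ge> M2 \<Longrightarrow> inverse (real (Suc k)) < e / 2"
        using order_tendstoD(2)[OF inv0, of "e / 2"] e by (auto simp: eventually_sequentially)
      have PZ: "P s \<in> points Z" using sC by (simp add: Z_def)
      have "norm (L (z k - P s) - 0) < e" if k: "k \<ge> max M1 M2" for k
      proof -
        have "L (P s - j (s k)) \<le> e / 2" by (rule approx[OF sC]) (use M1[of _ k] k in \<open>auto intro!: less_imp_le\<close>)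
        moreover have "L (z k - P s) \<le> L (z k - j (s k)) + L (j (s k) - P s)"
          using Ztri[OF zZ[of k] jZ[OF sS[of k]] PZ] .
        moreover have "0 \<le> L (z k - P s)"
          using L0 zZ[of k] PZ PC complex_vector.subspace_diff[OF Csub] by (auto simp: Z_def)
        ultimately show ?thesis
          using Zsym[OF jZ[OF sS[of k]] PZ] sL[of k] M2[of k] k by simp
      qed
      then show "\<exists>M. \<forall>k\<ge>M. norm (L (z k - P s) - 0) < e" by blast
    qed
    then show "\<exists>l\<in>points Z. (\<lambda>k. nrm Z (z k - l)) \<longlonglongrightarrow> 0"
      using sC by (auto simp: Z_def)
  qed
  ultimately have "is_completion X Z j" by (simp add: is_completion_def)
  then show ?thesis by (rule that)
qed

text \<open>A functional on \<open>X\<close> is extended by zero outside \<open>points X\<close>, so that distinct elements of the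
  dual are distinct functions.\<close>

definition dual :: "'a::complex_vector nspace \<Rightarrow> ('a \<Rightarrow> complex) nspace" where
  "dual X = \<lparr>points = {\<phi>. linear_between X whole \<phi> \<and>
               (\<exists>C. \<forall>x\<in>points X. cmod (\<phi> x) \<le> C * nrm X x) \<and>
               (\<forall>x. x \<notin> points X \<longrightarrow> \<phi> x = 0)},
             nrm = (\<lambda>\<phi>. SUP x\<in>{x \<in> points X. nrm X x \<le> 1}. cmod (\<phi> x))\<rparr>"

subsection \<open>Strong and weak \<open>\<ell>\<^sub>q\<close> norms\<close>

definition conj_index :: "ereal \<Rightarrow> ereal" where
  "conj_index p = (if p = 1 then \<infinity> else if p = \<infinity> then 1 else p / (p - 1))"

text \<open>For nonnegative \<open>a 0, \<dots>, a (n - 1)\<close>; inserting \<open>0\<close> only matters for \<open>n = 0\<close>.\<close>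

definition lq_norm :: "ereal \<Rightarrow> nat \<Rightarrow> (nat \<Rightarrow> real) \<Rightarrow> real" where
  "lq_norm q n a =
     (if q = \<infinity> then Max (insert 0 (a ` {..<n}))
      else (\<Sum>i<n. a i powr real_of_ereal q) powr (1 / real_of_ereal q))"

definition strong_norm :: "ereal \<Rightarrow> 'a nspace \<Rightarrow> nat \<Rightarrow> (nat \<Rightarrow> 'a) \<Rightarrow> real" where
  "strong_norm q X n x = lq_norm q n (\<lambda>i. nrm X (x i))"

definition weak_norm :: "ereal \<Rightarrow> 'a::complex_vector nspace \<Rightarrow> nat \<Rightarrow> (nat \<Rightarrow> 'a) \<Rightarrow> real" where
  "weak_norm q X n x =
     (SUP \<phi>\<in>{\<phi> \<in> points (dual X). nrm (dual X) \<phi> \<le> 1}. lq_norm q n (\<lambda>i. cmod (\<phi> (x i))))"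

subsection \<open>The tensor product and the Chevet--Saphar norm\<close>

definition bilinear_form ::
    "'a::complex_vector nspace \<Rightarrow> 'b::complex_vector nspace \<Rightarrow> ('a \<Rightarrow> 'b \<Rightarrow> complex) \<Rightarrow> bool" where
  "bilinear_form X Y A \<longleftrightarrow> (\<forall>x\<in>points X. linear_between Y whole (\<lambda>y. A x y)) \<and>
     (\<forall>y\<in>points Y. linear_between X whole (\<lambda>x. A x y))"

text \<open>The algebraic tensor product is realized, as usual, in the algebraic dual of the space of all
  (not necessarily bounded) bilinear forms: \<open>x \<otimes> y\<close> is the evaluation \<open>A \<mapsto> A x y\<close>.\<close>

definition tensor ::
    "'a::complex_vector nspace \<Rightarrow> 'b::complex_vector nspace \<Rightarrow> 'a \<Rightarrow> 'b \<Rightarrow> ('a \<Rightarrow> 'b \<Rightarrow> complex) \<Rightarrow> complex" where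
  "tensor X Y x y = (\<lambda>A. if bilinear_form X Y A then A x y else 0)"

definition chevet_saphar_norm ::
    "ereal \<Rightarrow> 'a::complex_vector nspace \<Rightarrow> 'b::complex_vector nspace
      \<Rightarrow> (('a \<Rightarrow> 'b \<Rightarrow> complex) \<Rightarrow> complex) \<Rightarrow> real" where
  "chevet_saphar_norm p X Y u =
     Inf {strong_norm p X n x * weak_norm (conj_index p) Y n y | n x y.
            (\<forall>i<n. x i \<in> points X \<and> y i \<in> points Y) \<and> u = (\<Sum>i<n. tensor X Y (x i) (y i))}"

definition chevet_saphar_tensor ::
    "ereal \<Rightarrow> 'a::complex_vector nspace \<Rightarrow> 'b::complex_vector nspace
      \<Rightarrow> (('a \<Rightarrow> 'b \<Rightarrow> complex) \<Rightarrow> complex) nspace" where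
  "chevet_saphar_tensor p X Y =
     \<lparr>points = complex_vector.span {tensor X Y x y | x y. x \<in> points X \<and> y \<in> points Y},
      nrm = chevet_saphar_norm p X Y\<rparr>"

subsection \<open>Bounded holomorphic functions and \<open>\<G>\<^sup>\<infinity>(U)\<close>\<close>

text \<open>Holomorphy is Frechet differentiability with a bounded complex-linear derivative.\<close>

definition holomorphic_into ::
    "'e::complex_normed_vector set \<Rightarrow> 'g::complex_vector nspace \<Rightarrow> ('e \<Rightarrow> 'g) \<Rightarrow> bool" where
  "holomorphic_into U G f \<longleftrightarrow> f ` U \<subseteq> points G \<and>
     (\<forall>a\<in>U. \<exists>L. linear_between whole G L \<and> (\<exists>K. \<forall>h. nrm G (L h) \<le> K * norm h) \<and>
        ((\<lambda>x. nrm G (f x - f a - L (x - a)) / norm (x - a)) \<longlongrightarrow> 0) (at a within U))"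

text \<open>Functions on \<open>U\<close> are extended by zero outside \<open>U\<close>. Inserting \<open>0\<close> into the supremum only
  matters for empty \<open>U\<close>.\<close>

definition Hinf :: "'e::complex_normed_vector set \<Rightarrow> ('e \<Rightarrow> complex) nspace" where
  "Hinf U = \<lparr>points = {h. holomorphic_into U whole h \<and> bounded (h ` U) \<and> (\<forall>x. x \<notin> U \<longrightarrow> h x = 0)},
             nrm = (\<lambda>h. Sup (insert 0 ((\<lambda>x. cmod (h x)) ` U)))\<rparr>"

definition eval_at :: "'e::complex_normed_vector set \<Rightarrow> 'e \<Rightarrow> ('e \<Rightarrow> complex) \<Rightarrow> complex" where
  "eval_at U x = (\<lambda>h. if h \<in> points (Hinf U) then h x else 0)"

definition Delta :: "'e::complex_normed_vector set \<Rightarrow> (('e \<Rightarrow> complex) \<Rightarrow> complex) set" where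
  "Delta U = complex_vector.span (eval_at U ` U)"

definition Ginf :: "'e::complex_normed_vector set \<Rightarrow> (('e \<Rightarrow> complex) \<Rightarrow> complex) nspace" where
  "Ginf U = \<lparr>points = {\<gamma> \<in> points (dual (Hinf U)).
               \<forall>e>0. \<exists>\<beta>\<in>Delta U. nrm (dual (Hinf U)) (\<gamma> - \<beta>) < e},
             nrm = nrm (dual (Hinf U))\<rparr>"

subsection \<open>Cohen strongly \<open>p\<close>-summing holomorphic mappings\<close>

definition cohen_bound ::
    "ereal \<Rightarrow> 'e set \<Rightarrow> 'g::complex_vector nspace \<Rightarrow> ('e \<Rightarrow> 'g) \<Rightarrow> real \<Rightarrow> bool" where
  "cohen_bound p U G f C \<longleftrightarrow> 0 \<le> C \<and>
     (\<forall>n (l :: nat \<Rightarrow> complex) x z. (\<forall>i<n. x i \<in> U \<and> z i \<in> points (dual G)) \<longrightarrow>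
        (\<Sum>i<n. cmod (l i) * cmod (z i (f (x i))))
          \<le> C * strong_norm p whole n l * weak_norm (conj_index p) (dual G) n z)"

definition cohen_space ::
    "ereal \<Rightarrow> 'e::complex_normed_vector set \<Rightarrow> 'g::complex_vector nspace \<Rightarrow> ('e \<Rightarrow> 'g) nspace" where
  "cohen_space p U G =
     \<lparr>points = {f. holomorphic_into U G f \<and> (\<exists>C. cohen_bound p U G f C) \<and> (\<forall>x. x \<notin> U \<longrightarrow> f x = 0)},
      nrm = (\<lambda>f. Inf {C. cohen_bound p U G f C})\<rparr>"

subsection \<open>The mapping \<open>\<Lambda>\<close>\<close>

text \<open>\<open>delta_tensor U n l x y\<close> is \<open>\<Sum>i<n. l i \<delta>(x i) \<otimes> y i\<close> in \<open>\<Delta>(U) \<otimes> F \<subseteq> \<G>\<^sup>\<infinity>(U) \<otimes> F\<close>.\<close>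

definition delta_tensor ::
    "'e::complex_normed_vector set \<Rightarrow> nat \<Rightarrow> (nat \<Rightarrow> complex) \<Rightarrow> (nat \<Rightarrow> 'e) \<Rightarrow> (nat \<Rightarrow> 'f::complex_normed_vector)
      \<Rightarrow> ((('e \<Rightarrow> complex) \<Rightarrow> complex) \<Rightarrow> 'f \<Rightarrow> complex) \<Rightarrow> complex" where
  "delta_tensor U n l x y = (\<Sum>i<n. l i *\<^sub>C tensor (Ginf U) whole (eval_at U (x i)) (y i))"

text \<open>Here \<open>Z\<close> is the completed tensor product \<open>\<G>\<^sup>\<infinity>(U) \<otimes> F\<close> and \<open>j\<close> is the inclusion of the
  algebraic tensor product.\<close>

definition Lambda ::
    "'e::complex_normed_vector set \<Rightarrow> 'z::complex_vector nspace
      \<Rightarrow> ((((('e \<Rightarrow> complex) \<Rightarrow> complex) \<Rightarrow> 'f::complex_normed_vector \<Rightarrow> complex) \<Rightarrow> complex) \<Rightarrow> 'z)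
      \<Rightarrow> ('e \<Rightarrow> 'f \<Rightarrow> complex) \<Rightarrow> 'z \<Rightarrow> complex" where
  "Lambda U Z j f = (THE \<phi>. \<phi> \<in> points (dual Z) \<and>
     (\<forall>n l x y. (\<forall>i<n. x i \<in> U) \<longrightarrow> \<phi> (j (delta_tensor U n l x y)) = (\<Sum>i<n. l i * f (x i) (y i))))"

end

theory Submission
  imports Defs "HOL-Complex_Analysis.Cauchy_Integral_Formula"
begin

text \<open>The map \<open>\<Lambda>\<close> is best understood through its inverse. A functional \<open>\<phi>\<close> on the completed tensor
product is turned into the map \<open>f\<close> with \<open>f x y = \<phi> (\<delta>(x) \<otimes> y)\<close>; this is \<open>kernel_map\<close> below. The
theorem says that \<open>kernel_map\<close> is a linear isometry of \<open>dual Z\<close> onto the Cohen strongly \<open>p\<close>-summing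
maps, and four facts carry the proof.

\<^item> \<open>f\<close> is holomorphic (\<open>kernel_map_holomorphic\<close>). Cauchy estimates on complex lines bound, uniformly
for \<open>h\<close> in the unit ball of \<open>\<H>\<^sup>\<infinity>(U)\<close>, the remainder of the first-order expansion of \<open>h\<close> at a
point by a multiple of \<open>\<parallel>v\<parallel>\<^sup>2\<close>. So \<open>x \<mapsto> \<delta>(x)\<close> is differentiable in norm, its derivative stays in
\<open>\<G>\<^sup>\<infinity>(U)\<close> as a limit of difference quotients, and \<open>f\<close> inherits this from \<open>\<delta>\<close>.

\<^item> \<open>d\<^sub>p(f) \<le> \<parallel>\<phi>\<parallel>\<close> (\<open>kernel_map_cohen_bound\<close>). Applying \<open>\<phi>\<close> to \<open>\<Sum> \<lambda>\<^sub>i \<delta>(x\<^sub>i) \<otimes> y\<^sub>i\<close> gives the summing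
inequality for functionals on \<open>F\<^sup>*\<close> that are evaluations at points \<open>y\<^sub>i\<close> of \<open>F\<close>, but the definition
quantifies over all of \<open>F\<^sup>*\<^sup>*\<close>. The passage is a form of the principle of local reflexivity
(\<open>weak_norm_local_reflexivity\<close>): an inequality \<open>|\<Sum> g\<^sub>i(y\<^sub>i)| \<le> M \<parallel>(y\<^sub>i)\<parallel>\<close> with the weak norm of \<open>F\<^sup>n\<close>
on the right extends to the bidual. The weak norm is, up to a factor close to \<open>1\<close>, the maximum of
\<open>\<parallel>\<Sum> a\<^sub>i y\<^sub>i\<parallel>\<close> over finitely many \<open>a\<close> in the unit ball of \<open>\<ell>\<^sub>p\<^sup>n\<close>. This embeds \<open>F\<^sup>n\<close> into a finite
\<open>\<ell>\<^sub>\<infinity>\<close>-sum of copies of \<open>F\<close>, and Hahn--Banach there writes \<open>g\<^sub>i = \<Sum>\<^sub>a a\<^sub>i \<phi>\<^sub>a\<close> with \<open>\<Sum> \<parallel>\<phi>\<^sub>a\<parallel>\<close> nearly at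
most \<open>M\<close>, a form to which elements of \<open>F\<^sup>*\<^sup>*\<close> can be applied.

\<^item> Every \<open>f\<close> arises, from some \<open>\<phi>\<close> with \<open>\<parallel>\<phi>\<parallel> \<le> C\<close> for any summing constant \<open>C\<close> of \<open>f\<close>
(\<open>kernel_map_surj\<close>). Put \<open>h\<^sub>y = f(\<cdot>)(y) \<in> \<H>\<^sup>\<infinity>(U)\<close>; the bilinear form \<open>(\<gamma>, y) \<mapsto> \<gamma>(h\<^sub>y)\<close> defines a
functional on the whole algebraic tensor product \<open>\<G>\<^sup>\<infinity>(U) \<otimes> F\<close>. It is bounded by \<open>C g\<^sub>p\<close>, because
\<open>|\<Sum> \<gamma>\<^sub>i(h\<^sub>y\<^sub>i)| \<le> \<Sum> \<parallel>\<gamma>\<^sub>i\<parallel> \<parallel>h\<^sub>y\<^sub>i\<parallel>\<close> and the points at which the \<open>h\<^sub>y\<^sub>i\<close> nearly attain their norms can be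
chosen independently of each other in the summing inequality with \<open>\<lambda>\<^sub>i = \<parallel>\<gamma>\<^sub>i\<parallel>\<close>. Hahn--Banach
extends the functional to the completion.

\<^item> \<open>\<phi>\<close> is determined by \<open>f\<close> (\<open>kernel_map_inj\<close>), by density of \<open>\<Delta>(U)\<close> in \<open>\<G>\<^sup>\<infinity>(U)\<close> and of the
algebraic tensor product in \<open>Z\<close>.

Together these give \<open>\<parallel>\<phi>\<parallel> = d\<^sub>p(f)\<close>. The vector space and norm axioms for the Cohen strongly summing
maps are transported from \<open>dual Z\<close> along this bijection.\<close>

section \<open>The Hahn--Banach theorem for factorizations\<close>

definition sublinear :: "('a::complex_vector \<Rightarrow> real) \<Rightarrow> bool" where
  "sublinear q \<longleftrightarrow> (\<forall>x y. q (x + y) \<le> q x + q y) \<and>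
     (\<forall>t\<ge>0. \<forall>x. q (complex_of_real t *\<^sub>C x) = t * q x)"

lemma sublinearI:
  assumes add: "\<And>x y. q (x + y) \<le> q x + q y" and zero: "q 0 = 0"
    and scale: "\<And>t x. 0 < t \<Longrightarrow> q (complex_of_real t *\<^sub>C x) \<le> t * q x"
  shows "sublinear q"
  unfolding sublinear_def
proof (intro conjI allI impI)
  fix t :: real and x assume "0 \<le> t"
  show "q (complex_of_real t *\<^sub>C x) = t * q x"
  proof (cases "t = 0")
    case True
    then show ?thesis by (simp add: zero)
  next
    case False
    with \<open>0 \<le> t\<close> have t: "0 < t" by simp
    have "q (complex_of_real (1 / t) *\<^sub>C (complex_of_real t *\<^sub>C x))
        \<le> (1 / t) * q (complex_of_real t *\<^sub>C x)"
      using t by (intro scale) simp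
    then have "t * q x \<le> q (complex_of_real t *\<^sub>C x)"
      using t by (simp add: field_simps flip: of_real_mult)
    with scale[OF t, of x] show ?thesis by simp
  qed
qed (rule add)

lemma sublinear_add: "sublinear q \<Longrightarrow> q (x + y) \<le> q x + q y"
  by (simp add: sublinear_def)

lemma sublinear_scale: "sublinear q \<Longrightarrow> 0 \<le> t \<Longrightarrow> q (complex_of_real t *\<^sub>C x) = t * q x"
  by (simp add: sublinear_def)

lemma sublinear_0: "sublinear q \<Longrightarrow> q 0 = 0"
  using sublinear_scale[of q 0 0] by simp

lemma sublinear_ge: "sublinear q \<Longrightarrow> - q (- x) \<le> q x"
  using sublinear_add[of q x "- x"] by (simp add: sublinear_0)

text \<open>For fixed \<open>x\<close> the functional \<open>v \<mapsto> inf {q (v + t x) - t q x | t \<ge> 0}\<close> is again sublinear and below \<open>q\<close>,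
hence equal to \<open>q\<close> by minimality; the choice \<open>t = 1\<close> yields \<open>q w + q x \<le> q (w + x)\<close>.\<close>

lemma sublinear_minimal_additive:
  assumes q: "sublinear q"
    and minimal: "\<And>r. sublinear r \<Longrightarrow> (\<And>x. r x \<le> q x) \<Longrightarrow> r = q"
  shows "q (w + x) = q w + q x"
proof -
  define g where "g v t = q (v + complex_of_real t *\<^sub>C x) - t * q x" for v t
  define r where "r v = (INF t\<in>{0..}. g v t)" for v
  have g_ge: "- q (- v) \<le> g v t" if "0 \<le> t" for v t
    using sublinear_add[OF q, of "v + complex_of_real t *\<^sub>C x" "- v"] sublinear_scale[OF q that, of x]
    by (simp add: g_def)
  have r_le: "r v \<le> g v t" if "0 \<le> t" for v t
    unfolding r_def using that g_ge by (intro cINF_lower bdd_belowI2[where m = "- q (- v)"]) auto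
  have le_r: "c \<le> r v" if "\<And>t. 0 \<le> t \<Longrightarrow> c \<le> g v t" for c v
    unfolding r_def using that by (intro cINF_greatest) auto
  have "sublinear r"
  proof (rule sublinearI)
    fix v v'
    have "r (v + v') \<le> g v t + g v' t'" if "0 \<le> t" "0 \<le> t'" for t t'
    proof -
      have "r (v + v') \<le> g (v + v') (t + t')" using that by (intro r_le) simp
      also have "\<dots> \<le> g v t + g v' t'"
        using sublinear_add[OF q, of "v + complex_of_real t *\<^sub>C x" "v' + complex_of_real t' *\<^sub>C x"]
        by (simp add: g_def scaleC_add_left algebra_simps)
      finally show ?thesis .
    qed
    then have "r (v + v') - g v t \<le> r v'" if "0 \<le> t" for t
      using that by (intro le_r) (simp add: algebra_simps)
    then have "r (v + v') - r v' \<le> r v" by (intro le_r) (simp add: algebra_simps)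
    then show "r (v + v') \<le> r v + r v'" by simp
  next
    have "g 0 t = 0" if "0 \<le> t" for t
      using that by (simp add: g_def sublinear_scale[OF q])
    then show "r 0 = 0" using r_le[of 0 0] le_r[of 0 0] by force
  next
    fix s :: real and v assume s: "0 < s"
    have "r (complex_of_real s *\<^sub>C v) / s \<le> g v t" if "0 \<le> t" for t
    proof -
      have "r (complex_of_real s *\<^sub>C v) \<le> g (complex_of_real s *\<^sub>C v) (s * t)"
        using s that by (intro r_le) simp
      also have "\<dots> = s * g v t"
        using sublinear_scale[OF q, of s "v + complex_of_real t *\<^sub>C x"] s
        by (simp add: g_def scaleC_add_right scaleC_scaleC algebra_simps)
      finally show ?thesis using s by (simp add: field_simps)
    qed
    then have "r (complex_of_real s *\<^sub>C v) / s \<le> r v" by (rule le_r)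
    then show "r (complex_of_real s *\<^sub>C v) \<le> s * r v" using s by (simp add: field_simps)
  qed
  moreover have "r v \<le> q v" for v using r_le[of 0 v] by (simp add: g_def)
  ultimately have "r = q" by (rule minimal)
  then have "q w \<le> q (w + x) - q x" using r_le[of 1 w] by (simp add: g_def scaleC_one)
  then show ?thesis using sublinear_add[OF q, of w x] by simp
qed

text \<open>By Zorn's lemma there is a minimal sublinear functional below \<open>q\<close>: the pointwise infimum of a chain is
sublinear, being bounded below by \<open>- q (- x)\<close>.\<close>

lemma sublinear_additive_minorant:
  assumes q: "sublinear q"
  obtains r where "sublinear r" "\<And>x. r x \<le> q x" "\<And>x y. r (x + y) = r x + r y"
proof -
  let ?A = "{r. sublinear r \<and> (\<forall>x. r x \<le> q x)}"
  let ?R = "\<lambda>r s :: 'a \<Rightarrow> real. \<forall>x. s x \<le> r x"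
  have po: "partial_order_on ?A (relation_of ?R ?A)"
    by (rule partial_order_on_relation_ofI) (auto simp: fun_eq_iff intro: order_trans order_antisym)
  have "\<exists>m\<in>?A. \<forall>a\<in>?A. ?R m a \<longrightarrow> a = m"
  proof (rule predicate_Zorn[OF po])
    fix C assume C: "C \<in> Chains (relation_of ?R ?A)"
    have CA: "sublinear r" "r x \<le> q x" if "r \<in> C" for r x
      using C that by (auto simp: Chains_def relation_of_def)
    have total: "(\<forall>x. r x \<le> s x) \<or> (\<forall>x. s x \<le> r x)" if "r \<in> C" "s \<in> C" for r s
      using C that by (auto simp: Chains_def relation_of_def)
    show "\<exists>u\<in>?A. \<forall>a\<in>C. ?R a u"
    proof (cases "C = {}")
      case True
      then show ?thesis using q by auto
    next
      case False
      define u where "u x = (INF r\<in>C. r x)" for x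
      have u_le: "u x \<le> r x" if "r \<in> C" for r x
        unfolding u_def
      proof (rule cINF_lower[OF _ that])
        have "- q (- x) \<le> s x" if "s \<in> C" for s
          using CA(2)[OF that, of "- x"] sublinear_add[OF q, of x "- x"]
            sublinear_ge[OF CA(1)[OF that], of x] by simp
        then show "bdd_below ((\<lambda>r. r x) ` C)" by (intro bdd_belowI2)
      qed
      have le_u: "c \<le> u x" if "\<And>r. r \<in> C \<Longrightarrow> c \<le> r x" for c x
        unfolding u_def using False that by (intro cINF_greatest) auto
      have "sublinear u"
      proof (rule sublinearI)
        fix x y
        have le: "u (x + y) \<le> r x + s y" if rs: "r \<in> C" "s \<in> C" for r s
        proof -
          obtain k where k: "k \<in> C" "k x \<le> r x" "k y \<le> s y"
            using total[OF rs] rs by auto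
          then show ?thesis
            using u_le[OF k(1), of "x + y"] sublinear_add[OF CA(1)[OF k(1)], of x y] by simp
        qed
        have "u (x + y) - r x \<le> u y" if "r \<in> C" for r
          using le[OF that] by (intro le_u) (simp add: diff_le_eq add.commute)
        then have "u (x + y) - u y \<le> u x" by (intro le_u) (simp add: algebra_simps)
        then show "u (x + y) \<le> u x + u y" by simp
      next
        obtain r where "r \<in> C" using False by blast
        then show "u 0 = 0"
          using u_le[of r 0] le_u[of 0 0] sublinear_0[OF CA(1)] by force
      next
        fix t :: real and x assume t: "0 < t"
        have "u (complex_of_real t *\<^sub>C x) / t \<le> r x" if "r \<in> C" for r
          using u_le[OF that, of "complex_of_real t *\<^sub>C x"] sublinear_scale[OF CA(1)[OF that], of t x] t
          by (simp add: field_simps)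
        then have "u (complex_of_real t *\<^sub>C x) / t \<le> u x" by (rule le_u)
        then show "u (complex_of_real t *\<^sub>C x) \<le> t * u x" using t by (simp add: field_simps)
      qed
      moreover have "u x \<le> q x" for x
        using False u_le CA(2) by (meson all_not_in_conv order_trans)
      ultimately show ?thesis using u_le by auto
    qed
  qed
  then obtain m where m: "sublinear m" "\<And>x. m x \<le> q x"
    and min: "\<And>a. sublinear a \<Longrightarrow> (\<And>x. a x \<le> q x) \<Longrightarrow> (\<And>x. a x \<le> m x) \<Longrightarrow> a = m"
    by blast
  have "m (x + y) = m x + m y" for x y
    by (rule sublinear_minimal_additive[OF m(1)]) (meson min m(2) order_trans)
  with m show ?thesis using that by blast
qed

text \<open>Hahn--Banach, stated for a map \<open>T\<close> instead of the inclusion of a subspace: a functional \<open>G\<close> dominated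
by a seminorm of \<open>T v\<close> factors through \<open>T\<close>. Both the extension to a completion and the
representation of functionals on \<open>F\<^sup>n\<close> have this form.
The factor is found below the sublinear functional \<open>w \<mapsto> inf {P (w - T v) + Re (G v) | v \<in> V}\<close>, which is
at most \<open>P\<close> (take \<open>v = 0\<close>) and at most \<open>Re (G v)\<close> at \<open>T v\<close>.\<close>

lemma hahn_banach_factor:
  fixes T :: "'a::complex_vector \<Rightarrow> 'b::complex_vector" and G :: "'a \<Rightarrow> complex"
  assumes V: "complex_vector.subspace V"
    and T_add: "\<And>u v. u \<in> V \<Longrightarrow> v \<in> V \<Longrightarrow> T (u + v) = T u + T v"
    and T_scale: "\<And>c v. v \<in> V \<Longrightarrow> T (c *\<^sub>C v) = c *\<^sub>C T v"
    and G_add: "\<And>u v. u \<in> V \<Longrightarrow> v \<in> V \<Longrightarrow> G (u + v) = G u + G v"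
    and G_scale: "\<And>c v. v \<in> V \<Longrightarrow> G (c *\<^sub>C v) = c * G v"
    and P_add: "\<And>x y. P (x + y) \<le> P x + P y"
    and P_scale: "\<And>c x. P (c *\<^sub>C x) = cmod c * P x"
    and bound: "\<And>v. v \<in> V \<Longrightarrow> cmod (G v) \<le> P (T v)"
  obtains H where "\<And>x y. H (x + y) = H x + H y" "\<And>c x. H (c *\<^sub>C x) = c * H x"
    "\<And>x. cmod (H x) \<le> P x" "\<And>v. v \<in> V \<Longrightarrow> H (T v) = G v"
proof -
  note sub = complex_vector.subspace_0[OF V] complex_vector.subspace_add[OF V]
    complex_vector.subspace_scale[OF V]
  have P_neg: "P (- x) = P x" for x using P_scale[of "-1" x] by (simp add: complex_vector.scale_minus_left scaleC_one)
  have T0: "T 0 = 0" and G0: "G 0 = 0" and P0: "P 0 = 0"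
    using T_scale[OF sub(1), of 0] G_scale[OF sub(1), of 0] P_scale[of 0 0] by auto
  define g where "g w v = P (w - T v) + Re (G v)" for w v
  define s where "s w = (INF v\<in>V. g w v)" for w
  have g_ge: "- P w \<le> g w v" if "v \<in> V" for w v
  proof -
    have "P (T v) \<le> P w + P (w - T v)"
      using P_add[of w "T v - w"] P_neg[of "w - T v"] by simp
    moreover have "\<bar>Re (G v)\<bar> \<le> P (T v)" using abs_Re_le_cmod bound[OF that] order_trans by blast
    ultimately show ?thesis by (simp add: g_def)
  qed
  have s_le: "s w \<le> g w v" if "v \<in> V" for w v
    unfolding s_def using g_ge that by (intro cINF_lower bdd_belowI2[where m = "- P w"]) auto
  have le_s: "c \<le> s w" if "\<And>v. v \<in> V \<Longrightarrow> c \<le> g w v" for c w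
    unfolding s_def using that sub(1) by (intro cINF_greatest) auto
  have "sublinear s"
  proof (rule sublinearI)
    fix x y
    have "s (x + y) \<le> g x v + g y v'" if "v \<in> V" "v' \<in> V" for v v'
    proof -
      have "s (x + y) \<le> g (x + y) (v + v')" using that by (intro s_le sub)
      also have "\<dots> \<le> g x v + g y v'"
        using P_add[of "x - T v" "y - T v'"] that by (simp add: g_def T_add G_add algebra_simps)
      finally show ?thesis .
    qed
    then have "s (x + y) - g x v \<le> s y" if "v \<in> V" for v
      using that by (intro le_s) (simp add: algebra_simps)
    then have "s (x + y) - s y \<le> s x" by (intro le_s) (simp add: algebra_simps)
    then show "s (x + y) \<le> s x + s y" by simp
  next
    have "0 \<le> s 0" using g_ge[of _ 0] by (intro le_s) (simp add: P0)
    then show "s 0 = 0" using s_le[OF sub(1), of 0] by (simp add: g_def T0 G0 P0)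
  next
    fix t :: real and x assume t: "0 < t"
    have "s (complex_of_real t *\<^sub>C x) / t \<le> g x v" if "v \<in> V" for v
    proof -
      have "s (complex_of_real t *\<^sub>C x) \<le> g (complex_of_real t *\<^sub>C x) (complex_of_real t *\<^sub>C v)"
        using that by (intro s_le sub)
      also have "\<dots> = t * g x v"
        using P_scale[of "complex_of_real t" "x - T v"] t that
        by (simp add: g_def T_scale G_scale complex_vector.scale_right_diff_distrib algebra_simps)
      finally show ?thesis using t by (simp add: field_simps)
    qed
    then have "s (complex_of_real t *\<^sub>C x) / t \<le> s x" by (rule le_s)
    then show "s (complex_of_real t *\<^sub>C x) \<le> t * s x" using t by (simp add: field_simps)
  qed
  then obtain r where r: "sublinear r" and rs: "\<And>x. r x \<le> s x"
    and r_add: "\<And>x y. r (x + y) = r x + r y"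
    using sublinear_additive_minorant by blast
  have r_neg: "r (- x) = - r x" for x using r_add[of x "- x"] sublinear_0[OF r] by simp
  have r_scale: "r (complex_of_real t *\<^sub>C x) = t * r x" for t x
  proof (cases "0 \<le> t")
    case False
    have "r (complex_of_real t *\<^sub>C x) = - r (complex_of_real (- t) *\<^sub>C x)"
      by (simp add: complex_vector.scale_minus_left r_neg)
    then show ?thesis using sublinear_scale[OF r, of "- t" x] False by simp
  qed (rule sublinear_scale[OF r])
  have r_le: "r x \<le> P x" for x
    using order_trans[OF rs s_le[OF sub(1)], of x] by (simp add: g_def T0 G0)
  \<comment> \<open>The inequality for \<open>v\<close> and for \<open>- v\<close> together give equality.\<close>
  have r_T: "r (T v) = Re (G v)" if v: "v \<in> V" for v
  proof -
    have le: "r (T u) \<le> Re (G u)" if "u \<in> V" for u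
      using order_trans[OF rs s_le[OF that], of "T u"] by (simp add: g_def P0)
    have "- v \<in> V" "T (- v) = - T v" "G (- v) = - G v"
      using sub(3)[OF v, of "-1"] T_scale[OF v, of "-1"] G_scale[OF v, of "-1"]
      by (simp_all add: complex_vector.scale_minus_left scaleC_one)
    then show ?thesis using le[OF v] le[of "- v"] by (simp add: r_neg)
  qed
  \<comment> \<open>The complex linear functional with real part \<open>r\<close>.\<close>
  define H where "H x = complex_of_real (r x) - \<i> * complex_of_real (r (\<i> *\<^sub>C x))" for x
  have H_add: "H (x + y) = H x + H y" for x y
    by (simp add: H_def r_add scaleC_add_right algebra_simps)
  have H_real: "H (complex_of_real t *\<^sub>C x) = complex_of_real t * H x" for t x
    using r_scale[of t "\<i> *\<^sub>C x"]
    by (simp add: H_def r_scale scaleC_scaleC mult.commute algebra_simps)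
  have H_i: "H (\<i> *\<^sub>C x) = \<i> * H x" for x
    by (simp add: H_def scaleC_scaleC complex_vector.scale_minus_left scaleC_one r_neg algebra_simps)
  have H_scale: "H (c *\<^sub>C x) = c * H x" for c x
  proof -
    have c: "c = complex_of_real (Re c) + complex_of_real (Im c) * \<i>"
      using complex_eq[of c] by (simp add: mult.commute)
    have "c *\<^sub>C x = complex_of_real (Re c) *\<^sub>C x + complex_of_real (Im c) *\<^sub>C (\<i> *\<^sub>C x)"
      by (subst c) (simp only: scaleC_add_left scaleC_scaleC)
    then have "H (c *\<^sub>C x) = (complex_of_real (Re c) + complex_of_real (Im c) * \<i>) * H x"
      by (simp only: H_add H_real H_i) (simp add: algebra_simps)
    then show ?thesis using c by simp
  qed
  have "cmod (H x) \<le> P x" for x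
  proof (cases "H x = 0")
    case True
    have "0 \<le> P x" using P_add[of x "- x"] P_neg[of x] by (simp add: P0)
    with True show ?thesis by simp
  next
    case False
    \<comment> \<open>Rotating the value onto the positive real axis reduces the bound for \<open>|H|\<close> to that for \<open>r\<close>.\<close>
    define c where "c = cnj (sgn (H x))"
    have c: "cmod c = 1" using False by (simp add: c_def norm_sgn)
    have "c * H x = complex_of_real (cmod (H x))"
      using False complex_norm_square[of "H x"]
      by (simp add: c_def sgn_eq power2_eq_square field_simps)
    then have "cmod (H x) = Re (H (c *\<^sub>C x))" by (simp add: H_scale)
    also have "\<dots> = r (c *\<^sub>C x)" by (simp add: H_def)
    also have "\<dots> \<le> P x" using r_le[of "c *\<^sub>C x"] by (simp add: P_scale c)
    finally show ?thesis .
  qed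
  moreover have "H (T v) = G v" if v: "v \<in> V" for v
  proof -
    have "r (\<i> *\<^sub>C T v) = Re (G (\<i> *\<^sub>C v))"
      using r_T[OF sub(3)[OF v, of \<i>]] T_scale[OF v, of \<i>] by simp
    then show ?thesis using v by (simp add: H_def r_T G_scale complex_eq_iff)
  qed
  ultimately show ?thesis using that H_add H_scale by blast
qed

section \<open>Hoelder duality for finite sequences\<close>

lemma conj_index_cases:
  assumes "1 \<le> p"
  obtains "p = 1" "conj_index p = \<infinity>" | "p = \<infinity>" "conj_index p = 1"
  | r s where "p = ereal r" "conj_index p = ereal s" "1 < r" "1 < s" "1 / r + 1 / s = 1"
proof (cases p)
  case (real r)
  show ?thesis
  proof (cases "r = 1")
    case True
    with real that(1) show ?thesis by (simp add: conj_index_def one_ereal_def)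
  next
    case False
    with assms real have r: "1 < r" by (simp add: one_ereal_def)
    have "conj_index p = ereal (r / (r - 1))"
      using real r by (simp add: conj_index_def one_ereal_def)
    moreover have "1 < r / (r - 1)" "1 / r + 1 / (r / (r - 1)) = 1"
      using r by (auto simp: field_simps)
    ultimately show ?thesis using that(3)[OF real] r by blast
  qed
qed (use assms that(2) in \<open>auto simp: conj_index_def one_ereal_def\<close>)

lemma conj_index_ge_1:
  assumes "1 \<le> p"
  shows "1 \<le> conj_index p"
  using assms by (cases rule: conj_index_cases[of p]) (auto simp: one_ereal_def)

lemma lq_norm_infinity: "lq_norm \<infinity> n a = Max (insert 0 (a ` {..<n}))"
  by (simp add: lq_norm_def)

lemma lq_norm_ereal: "lq_norm (ereal r) n a = (\<Sum>i<n. a i powr r) powr (1 / r)"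
  by (simp add: lq_norm_def)

lemma lq_norm_one: "(\<And>i. i < n \<Longrightarrow> 0 \<le> a i) \<Longrightarrow> lq_norm 1 n a = (\<Sum>i<n. a i)"
  using sum_nonneg[of "{..<n}" a] by (simp add: one_ereal_def lq_norm_ereal)

lemma lq_norm_nonneg: "0 \<le> lq_norm q n a"
  by (simp add: lq_norm_def)

lemma lq_norm_cong:
  assumes "\<And>i. i < n \<Longrightarrow> a i = b i"
  shows "lq_norm q n a = lq_norm q n b"
proof -
  have "a ` {..<n} = b ` {..<n}" "(\<Sum>i<n. a i powr r) = (\<Sum>i<n. b i powr r)" for r
    using assms by (auto intro!: image_cong sum.cong)
  then show ?thesis by (simp add: lq_norm_def)
qed

lemma lq_norm_mono:
  assumes q: "1 \<le> q" and ab: "\<And>i. i < n \<Longrightarrow> 0 \<le> a i \<and> a i \<le> b i"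
  shows "lq_norm q n a \<le> lq_norm q n b"
proof (cases q)
  case (real r)
  with q have "1 \<le> r" by (simp add: one_ereal_def)
  moreover have "(\<Sum>i<n. a i powr r) \<le> (\<Sum>i<n. b i powr r)"
    using ab \<open>1 \<le> r\<close> by (intro sum_mono) (simp add: powr_mono2)
  ultimately show ?thesis
    unfolding real lq_norm_ereal using powr_mono2[of "1 / r"] by (simp add: sum_nonneg)
next
  case PInf
  have "a i \<le> Max (insert 0 (b ` {..<n}))" if "i < n" for i
  proof -
    have "b i \<le> Max (insert 0 (b ` {..<n}))" using that by (intro Max_ge) auto
    with ab[OF that] show ?thesis by simp
  qed
  then show ?thesis unfolding PInf lq_norm_infinity by (auto simp: Max_le_iff)
qed (use q in auto)

lemma lq_norm_scale:
  assumes q: "1 \<le> q" and c: "0 \<le> c" and a: "\<And>i. i < n \<Longrightarrow> 0 \<le> a i"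
  shows "lq_norm q n (\<lambda>i. c * a i) = c * lq_norm q n a"
proof (cases q)
  case (real r)
  with q have r: "1 \<le> r" by (simp add: one_ereal_def)
  have "(\<Sum>i<n. (c * a i) powr r) = c powr r * (\<Sum>i<n. a i powr r)"
    unfolding sum_distrib_left using a c by (intro sum.cong) (auto simp: powr_mult)
  then show ?thesis
    unfolding real lq_norm_ereal using r c a by (simp add: powr_mult powr_powr sum_nonneg)
next
  case PInf
  have "Max (insert 0 ((\<lambda>i. c * a i) ` {..<n})) = Max ((*) c ` insert 0 (a ` {..<n}))"
    by (simp add: image_image)
  also have "\<dots> = c * Max (insert 0 (a ` {..<n}))"
    using c by (intro mono_Max_commute[symmetric]) (auto intro: monoI mult_left_mono)
  finally show ?thesis unfolding PInf lq_norm_infinity .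
qed (use q in auto)

lemma lq_norm_ge_coordinate:
  assumes q: "1 \<le> q" and a: "\<And>i. i < n \<Longrightarrow> 0 \<le> a i" and k: "k < n"
  shows "a k \<le> lq_norm q n a"
proof (cases q)
  case (real r)
  with q have r: "1 \<le> r" by (simp add: one_ereal_def)
  have "a k powr r \<le> (\<Sum>i<n. a i powr r)"
    using k by (intro member_le_sum) auto
  then have "(a k powr r) powr (1 / r) \<le> (\<Sum>i<n. a i powr r) powr (1 / r)"
    using r by (intro powr_mono2) auto
  then show ?thesis
    unfolding real lq_norm_ereal using r a[OF k] by (simp add: powr_powr)
next
  case PInf
  then show ?thesis unfolding PInf lq_norm_infinity using k by (intro Max_ge) auto
qed (use q in auto)

lemma lq_norm_single:
  assumes "1 \<le> q" "0 \<le> a 0"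
  shows "lq_norm q (Suc 0) a = a 0"
proof (cases q)
  case (real r)
  with assms show ?thesis by (simp add: lq_norm_ereal powr_powr one_ereal_def)
next
  case PInf
  with assms show ?thesis by (simp add: lq_norm_infinity lessThan_Suc)
qed (use assms in auto)

lemma lq_norm_axis_le:
  assumes q: "1 \<le> q"
  shows "lq_norm q n (\<lambda>i. if i = k then 1 else 0) \<le> 1"
proof (cases q)
  case (real r)
  with q have r: "1 \<le> r" by (simp add: one_ereal_def)
  have "(\<Sum>i<n. (if i = k then 1 else 0) powr r) = (\<Sum>i<n. if i = k then 1 else 0)"
    by (intro sum.cong) auto
  then show ?thesis
    unfolding real lq_norm_ereal using r by (simp add: sum.delta)
next
  case PInf
  then show ?thesis by (auto simp: lq_norm_infinity Max_le_iff)
qed (use q in auto)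

lemma lq_norm_powr:
  assumes "1 \<le> r"
  shows "lq_norm (ereal r) n a powr r = (\<Sum>i<n. a i powr r)"
  using assms by (simp add: lq_norm_ereal powr_powr sum_nonneg)

lemma lq_norm_Holder:
  assumes p: "1 \<le> p" and a: "\<And>i. i < n \<Longrightarrow> 0 \<le> a i" and b: "\<And>i. i < n \<Longrightarrow> 0 \<le> b i"
  shows "(\<Sum>i<n. a i * b i) \<le> lq_norm p n a * lq_norm (conj_index p) n b"
  using p
proof (cases rule: conj_index_cases)
  case 1
  have "(\<Sum>i<n. a i * b i) \<le> (\<Sum>i<n. a i * lq_norm \<infinity> n b)"
    using a b by (intro sum_mono mult_left_mono lq_norm_ge_coordinate) auto
  with 1 show ?thesis using a by (simp add: lq_norm_one sum_distrib_right)
next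
  case 2
  have "(\<Sum>i<n. a i * b i) \<le> (\<Sum>i<n. lq_norm \<infinity> n a * b i)"
    using a b by (intro sum_mono mult_right_mono lq_norm_ge_coordinate) auto
  with 2 show ?thesis using b by (simp add: lq_norm_one sum_distrib_left)
next
  case (3 r s)
  let ?A = "lq_norm (ereal r) n a" and ?B = "lq_norm (ereal s) n b"
  show ?thesis
  proof (cases "?A = 0 \<or> ?B = 0")
    case True
    have "a i * b i = 0" if "i < n" for i
    proof -
      have "0 \<le> a i" "a i \<le> ?A" "0 \<le> b i" "b i \<le> ?B"
        using 3 a b that by (auto intro!: lq_norm_ge_coordinate simp: one_ereal_def)
      with True show ?thesis by auto
    qed
    then have "(\<Sum>i<n. a i * b i) = 0" by (intro sum.neutral) auto
    then show ?thesis by (simp add: lq_norm_nonneg)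
  next
    case False
    then have A: "0 < ?A" and B: "0 < ?B"
      using lq_norm_nonneg[of "ereal r" n a] lq_norm_nonneg[of "ereal s" n b] by auto
    have "(\<Sum>i<n. a i * b i) / (?A * ?B) = (\<Sum>i<n. (a i / ?A) * (b i / ?B))"
      by (simp add: sum_divide_distrib)
    also have "\<dots> \<le> (\<Sum>i<n. (a i / ?A) powr r / r + (b i / ?B) powr s / s)"
      using a b A B 3 by (intro sum_mono Youngs_inequality) auto
    also have "\<dots> = (\<Sum>i<n. a i powr r) / ?A powr r / r + (\<Sum>i<n. b i powr s) / ?B powr s / s"
      unfolding sum.distrib sum_divide_distrib using a b A B
      by (intro arg_cong2[where f = "(+)"] sum.cong) (auto simp: powr_divide)
    also have "\<dots> = 1 / r + 1 / s"
      using 3 A B by (simp flip: lq_norm_powr)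
    also have "\<dots> = 1" by (rule 3)
    finally show ?thesis using A B 3 by (simp add: divide_le_eq)
  qed
qed

text \<open>For \<open>b \<noteq> 0\<close> the extremal sequence is an axis vector at the maximum if \<open>p = 1\<close>, the constant \<open>1\<close> if \<open>p = \<infinity>\<close>, and
\<open>(b i / \<parallel>b\<parallel>\<^sub>s)\<close> to the power \<open>s - 1\<close> otherwise, where \<open>s\<close> is the conjugate index.\<close>

lemma lq_norm_Holder_extremal_real:
  assumes p: "1 \<le> p" and b: "\<And>i. i < n \<Longrightarrow> 0 \<le> b i"
  obtains a where "\<And>i. 0 \<le> a i" "lq_norm p n a \<le> 1"
    "(\<Sum>i<n. a i * b i) = lq_norm (conj_index p) n b"
  using p
proof (cases rule: conj_index_cases)
  case 1
  have "Max (insert 0 (b ` {..<n})) \<in> insert 0 (b ` {..<n})" by (intro Max_in) auto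
  then consider "lq_norm \<infinity> n b = 0" | k where "k < n" "lq_norm \<infinity> n b = b k"
    unfolding lq_norm_infinity by auto
  then show ?thesis
  proof cases
    case 1
    have "lq_norm p n (\<lambda>_. 0) = 0" using lq_norm_scale[OF p, of 0 n "\<lambda>_. 0"] by simp
    with 1 \<open>conj_index p = \<infinity>\<close> that[of "\<lambda>_. 0"] show ?thesis by simp
  next
    case 2
    have "(\<Sum>i<n. (if i = k then 1 else 0) * b i) = (\<Sum>i<n. if i = k then b i else 0)"
      by (intro sum.cong) auto
    also have "\<dots> = b k" using 2 by (simp add: sum.delta)
    finally show ?thesis
      using that[of "\<lambda>i. if i = k then 1 else 0"] lq_norm_axis_le[OF p] 2 1 by simp
  qed
next
  case 2
  have "lq_norm \<infinity> n (\<lambda>_. 1) \<le> 1" by (auto simp: lq_norm_infinity Max_le_iff)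
  with 2 that[of "\<lambda>_. 1"] b show ?thesis by (simp add: lq_norm_one)
next
  case (3 r s)
  let ?B = "lq_norm (ereal s) n b"
  show ?thesis
  proof (cases "?B = 0")
    case True
    have "lq_norm p n (\<lambda>_. 0) = 0" using lq_norm_scale[OF p, of 0 n "\<lambda>_. 0"] by simp
    with True 3 that[of "\<lambda>_. 0"] show ?thesis by simp
  next
    case False
    then have B: "0 < ?B" using lq_norm_nonneg[of "ereal s" n b] by auto
    have rs: "(s - 1) * r = s" using 3 by (simp add: field_simps)
    define a where "a i = (b i / ?B) powr (s - 1)" for i
    have "a i powr r = b i powr s / ?B powr s" if "i < n" for i
      using b[OF that] B by (simp add: a_def powr_powr rs powr_divide)
    then have "(\<Sum>i<n. a i powr r) = (\<Sum>i<n. b i powr s) / ?B powr s"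
      by (simp add: sum_divide_distrib)
    also have "\<dots> = 1" using 3 B by (simp flip: lq_norm_powr)
    finally have 1: "lq_norm p n a \<le> 1" by (simp add: 3 lq_norm_ereal)
    have "a i * b i = b i powr s / ?B powr (s - 1)" if "i < n" for i
    proof (cases "b i = 0")
      case False
      with b[OF that] have "0 < b i" by simp
      then have "b i powr s = b i powr (s - 1) * b i"
        using powr_add[of "b i" "s - 1" 1] by simp
      then show ?thesis using \<open>0 < b i\<close> B by (simp add: a_def powr_divide)
    qed simp
    then have "(\<Sum>i<n. a i * b i) = (\<Sum>i<n. b i powr s) / ?B powr (s - 1)"
      by (simp add: sum_divide_distrib)
    also have "\<dots> = ?B powr s / ?B powr (s - 1)" using 3 by (simp add: lq_norm_powr)
    also have "\<dots> = ?B" using B by (simp flip: powr_diff)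
    finally show ?thesis using that[of a] 1 3 by (simp add: a_def)
  qed
qed

lemma lq_norm_Holder_extremal:
  fixes b :: "nat \<Rightarrow> complex"
  assumes p: "1 \<le> p"
  obtains a :: "nat \<Rightarrow> complex" where "lq_norm p n (\<lambda>i. cmod (a i)) \<le> 1"
    "(\<Sum>i<n. a i * b i) = complex_of_real (lq_norm (conj_index p) n (\<lambda>i. cmod (b i)))"
proof -
  obtain c where c: "\<And>i. 0 \<le> c i" "lq_norm p n c \<le> 1"
    "(\<Sum>i<n. c i * cmod (b i)) = lq_norm (conj_index p) n (\<lambda>i. cmod (b i))"
    using lq_norm_Holder_extremal_real[OF p, of n "\<lambda>i. cmod (b i)"] by auto
  define a where "a i = complex_of_real (c i) * cnj (sgn (b i))" for i
  have "a i * b i = complex_of_real (c i * cmod (b i))" for i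
    using complex_norm_square[of "b i"]
    by (cases "b i = 0") (simp_all add: a_def sgn_eq power2_eq_square field_simps)
  then have "(\<Sum>i<n. a i * b i) = complex_of_real (\<Sum>i<n. c i * cmod (b i))" by simp
  moreover have "cmod (a i) \<le> c i" for i using c(1) by (simp add: a_def norm_mult norm_sgn)
  then have "lq_norm p n (\<lambda>i. cmod (a i)) \<le> lq_norm p n c"
    using p by (intro lq_norm_mono) auto
  ultimately show ?thesis using that[of a] c by simp
qed

section \<open>Normed spaces, duals and weak norms\<close>

lemma whole_simps [simp]: "points whole = UNIV" "nrm whole = norm"
  by (simp_all add: whole_def)

lemma normed_space_whole: "normed_space whole"
  by (simp add: normed_space_def norm_triangle_ineq norm_scaleC)

lemma nspace_subspace: "normed_space X \<Longrightarrow> complex_vector.subspace (points X)"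
  and nspace_nonneg: "normed_space X \<Longrightarrow> x \<in> points X \<Longrightarrow> 0 \<le> nrm X x"
  and nspace_eq_0: "normed_space X \<Longrightarrow> x \<in> points X \<Longrightarrow> nrm X x = 0 \<longleftrightarrow> x = 0"
  and nspace_triangle: "normed_space X \<Longrightarrow> x \<in> points X \<Longrightarrow> y \<in> points X \<Longrightarrow> nrm X (x + y) \<le> nrm X x + nrm X y"
  and nspace_scale: "normed_space X \<Longrightarrow> x \<in> points X \<Longrightarrow> nrm X (c *\<^sub>C x) = cmod c * nrm X x"
  by (simp_all add: normed_space_def)

lemma nspace_closed:
  assumes "normed_space X"
  shows "0 \<in> points X"
    and "x \<in> points X \<Longrightarrow> y \<in> points X \<Longrightarrow> x + y \<in> points X"
    and "x \<in> points X \<Longrightarrow> y \<in> points X \<Longrightarrow> x - y \<in> points X"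
    and "x \<in> points X \<Longrightarrow> c *\<^sub>C x \<in> points X"
  using nspace_subspace[OF assms] complex_vector.subspace_0 complex_vector.subspace_add
    complex_vector.subspace_diff complex_vector.subspace_scale by blast+

lemma nspace_nrm_0: "normed_space X \<Longrightarrow> nrm X 0 = 0"
  using nspace_eq_0[of X 0] nspace_closed(1) by blast

lemma normed_spaceI:
  assumes S: "complex_vector.subspace (points X)"
    and nonneg: "\<And>x. x \<in> points X \<Longrightarrow> 0 \<le> nrm X x"
    and def: "\<And>x. x \<in> points X \<Longrightarrow> nrm X x = 0 \<Longrightarrow> x = 0"
    and tri: "\<And>x y. x \<in> points X \<Longrightarrow> y \<in> points X \<Longrightarrow> nrm X (x + y) \<le> nrm X x + nrm X y"
    and hom: "\<And>c x. x \<in> points X \<Longrightarrow> nrm X (c *\<^sub>C x) \<le> cmod c * nrm X x"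
  shows "normed_space X"
proof -
  note scale = complex_vector.subspace_scale[OF S]
  have "cmod c * nrm X x \<le> nrm X (c *\<^sub>C x)" if x: "x \<in> points X" for c x
  proof (cases "c = 0")
    case True
    then show ?thesis using nonneg[OF scale[OF x, of c]] by simp
  next
    case False
    have "nrm X (inverse c *\<^sub>C (c *\<^sub>C x)) \<le> cmod (inverse c) * nrm X (c *\<^sub>C x)"
      by (rule hom[OF scale[OF x]])
    then have "nrm X x \<le> nrm X (c *\<^sub>C x) / cmod c"
      using False by (simp add: scaleC_scaleC scaleC_one norm_inverse divide_inverse mult.commute)
    then show ?thesis using False by (simp add: field_simps)
  qed
  then have eq: "nrm X (c *\<^sub>C x) = cmod c * nrm X x" if "x \<in> points X" for c x
    using hom that antisym by blast
  moreover have "nrm X 0 = 0" using eq[OF complex_vector.subspace_0[OF S], of 0] by simp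
  ultimately show ?thesis using assms unfolding normed_space_def by blast
qed

lemma linear_betweenD:
  assumes "linear_between X Y T"
  shows "x \<in> points X \<Longrightarrow> T x \<in> points Y"
    and "x \<in> points X \<Longrightarrow> y \<in> points X \<Longrightarrow> T (x + y) = T x + T y"
    and "x \<in> points X \<Longrightarrow> T (c *\<^sub>C x) = c *\<^sub>C T x"
  using assms by (auto simp: linear_between_def)

lemma linear_between_diff:
  assumes T: "linear_between X Y T" and V: "complex_vector.subspace (points X)"
    and x: "x \<in> points X" and y: "y \<in> points X"
  shows "T (x - y) = T x - T y"
proof -
  have "T (x - y) = T (x + (-1) *\<^sub>C y)"
    by (simp add: complex_vector.scale_minus_left scaleC_one)
  also have "\<dots> = T x + T ((-1) *\<^sub>C y)"
    using V x y by (intro linear_betweenD(2)[OF T] complex_vector.subspace_scale)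
  also have "\<dots> = T x - T y"
    unfolding linear_betweenD(3)[OF T y] by (simp add: complex_vector.scale_minus_left scaleC_one)
  finally show ?thesis .
qed

lemma linear_between_0:
  assumes T: "linear_between X Y T" and V: "complex_vector.subspace (points X)"
  shows "T 0 = 0"
  using linear_between_diff[OF T V, of 0 0] complex_vector.subspace_0[OF V] by simp

lemma linear_between_sum:
  assumes T: "linear_between X Y T" and V: "complex_vector.subspace (points X)"
    and x: "\<And>i. i \<in> I \<Longrightarrow> x i \<in> points X"
  shows "T (\<Sum>i\<in>I. c i *\<^sub>C x i) = (\<Sum>i\<in>I. c i *\<^sub>C T (x i))"
  using x
proof (induction I rule: infinite_finite_induct)
  case (insert a I)
  have "T (c a *\<^sub>C x a + (\<Sum>i\<in>I. c i *\<^sub>C x i)) = T (c a *\<^sub>C x a) + T (\<Sum>i\<in>I. c i *\<^sub>C x i)"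
    using insert.prems
    by (intro linear_betweenD(2)[OF T] complex_vector.subspace_scale[OF V]
        complex_vector.subspace_sum[OF V]) auto
  then show ?case using insert linear_betweenD(3)[OF T] by simp
qed (simp_all add: linear_between_0[OF T V])

text \<open>The axioms of a normed space are transported from \<open>Y\<close> to \<open>X\<close> along the norm preserving surjection
\<open>S\<close>. For the Cohen strongly summing maps this replaces a direct verification for \<open>d\<^sub>p\<close>.\<close>

lemma isometric_isomorphism_inverse:
  assumes Y: "normed_space Y" and lin: "linear_between Y X S" and image: "S ` points Y = points X"
    and nrm: "\<And>y. y \<in> points Y \<Longrightarrow> nrm X (S y) = nrm Y y"
    and inv: "\<And>y. y \<in> points Y \<Longrightarrow> T (S y) = y"
  shows "isometric_isomorphism X Y T"
proof -
  note Yc = nspace_closed[OF Y] and S = linear_betweenD[OF lin]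
  have X: "normed_space X"
  proof (rule normed_spaceI)
    show "complex_vector.subspace (points X)"
    proof (rule complex_vector.subspaceI)
      show "0 \<in> points X"
        using imageI[OF Yc(1), of S] linear_between_0[OF lin nspace_subspace[OF Y]] image by simp
      fix x assume "x \<in> points X"
      then obtain y where y: "y \<in> points Y" "x = S y" unfolding image[symmetric] by blast
      show "c *\<^sub>C x \<in> points X" for c
        using imageI[OF Yc(4)[OF y(1)], of S c] S(3)[OF y(1)] y(2) image by simp
      fix x' assume "x' \<in> points X"
      then obtain y' where y': "y' \<in> points Y" "x' = S y'" unfolding image[symmetric] by blast
      show "x + x' \<in> points X"
        using imageI[OF Yc(2)[OF y(1) y'(1)], of S] S(2)[OF y(1) y'(1)] y(2) y'(2) image by simp
    qed
    fix x assume "x \<in> points X"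
    then obtain y where y: "y \<in> points Y" "x = S y" unfolding image[symmetric] by blast
    show "0 \<le> nrm X x" using y nrm nspace_nonneg[OF Y] by simp
    show "x = 0" if "nrm X x = 0"
      using that y nrm nspace_eq_0[OF Y y(1)] linear_between_0[OF lin nspace_subspace[OF Y]] by simp
    show "nrm X (c *\<^sub>C x) \<le> cmod c * nrm X x" for c
      using S(3)[OF y(1), of c] nrm[OF Yc(4)[OF y(1)], of c] nrm[OF y(1)] nspace_scale[OF Y y(1), of c] y(2) by simp
    show "nrm X (x + x') \<le> nrm X x + nrm X x'" if x': "x' \<in> points X" for x'
    proof -
      obtain y' where y': "y' \<in> points Y" "x' = S y'" using x' unfolding image[symmetric] by blast
      then show ?thesis
        using S(2)[OF y(1) y'(1)] nrm[OF Yc(2)[OF y(1) y'(1)]] nrm[OF y(1)] nrm[OF y'(1)]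
          nspace_triangle[OF Y y(1) y'(1)] y(2) by simp
    qed
  qed
  have ST: "S (T x) = x" "T x \<in> points Y" if "x \<in> points X" for x
    using that inv unfolding image[symmetric] by auto
  have "T (x + x') = T x + T x'" if "x \<in> points X" "x' \<in> points X" for x x'
    using inv[OF Yc(2)[OF ST(2)[OF that(1)] ST(2)[OF that(2)]]] S(2)[OF ST(2)[OF that(1)] ST(2)[OF that(2)]]
      ST(1) that by simp
  moreover have "T (c *\<^sub>C x) = c *\<^sub>C T x" if "x \<in> points X" for c x
    using inv[OF Yc(4)[OF ST(2)[OF that]], of c] S(3)[OF ST(2)[OF that], of c] ST(1)[OF that] by simp
  ultimately have "linear_between X Y T" using ST(2) by (auto simp: linear_between_def)
  moreover have "bij_betw T (points X) (points Y)"
    using ST inv image by (intro bij_betw_byWitness[where f' = S]) auto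
  moreover have "nrm Y (T x) = nrm X x" if "x \<in> points X" for x
    using nrm[OF ST(2)[OF that]] ST(1)[OF that] by simp
  ultimately show ?thesis using X Y by (simp add: isometric_isomorphism_def)
qed

text \<open>Suprema taken independently in each summand: if the \<open>K i\<close> can be approached by values \<open>F i v\<close> and the
bound \<open>M\<close> holds for every simultaneous choice of the points, it also holds for the \<open>K i\<close>.\<close>

lemma sum_weighted_approx_le:
  fixes c :: "'i \<Rightarrow> real"
  assumes c: "\<And>i. i \<in> I \<Longrightarrow> 0 \<le> c i"
    and approx: "\<And>i e. i \<in> I \<Longrightarrow> 0 < e \<Longrightarrow> \<exists>v\<in>S i. K i \<le> F i v + e"
    and le: "\<And>v. (\<And>i. i \<in> I \<Longrightarrow> v i \<in> S i) \<Longrightarrow> (\<Sum>i\<in>I. c i * F i (v i)) \<le> M"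
  shows "(\<Sum>i\<in>I. c i * K i) \<le> M"
proof (rule field_le_epsilon)
  fix e :: real assume e: "0 < e"
  let ?s = "\<Sum>i\<in>I. c i"
  have s: "0 \<le> ?s" by (intro sum_nonneg c)
  then have e': "0 < e / (?s + 1)" using e by simp
  from approx[OF _ e'] obtain v where v: "\<And>i. i \<in> I \<Longrightarrow> v i \<in> S i"
    "\<And>i. i \<in> I \<Longrightarrow> K i \<le> F i (v i) + e / (?s + 1)" by metis
  have "(\<Sum>i\<in>I. c i * K i) \<le> (\<Sum>i\<in>I. c i * F i (v i) + c i * (e / (?s + 1)))"
    using mult_left_mono[OF v(2) c] by (intro sum_mono) (simp add: distrib_left)
  also have "\<dots> = (\<Sum>i\<in>I. c i * F i (v i)) + ?s * (e / (?s + 1))"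
    by (simp only: sum.distrib sum_distrib_right)
  also have "\<dots> \<le> M + e"
    using le[OF v(1)] s e by (intro add_mono) (auto simp: field_simps)
  finally show "(\<Sum>i\<in>I. c i * K i) \<le> M + e" .
qed

lemma dualI:
  assumes "\<And>x y. x \<in> points X \<Longrightarrow> y \<in> points X \<Longrightarrow> \<phi> (x + y) = \<phi> x + \<phi> y"
    and "\<And>c x. x \<in> points X \<Longrightarrow> \<phi> (c *\<^sub>C x) = c * \<phi> x"
    and "\<And>x. x \<in> points X \<Longrightarrow> cmod (\<phi> x) \<le> C * nrm X x"
    and "\<And>x. x \<notin> points X \<Longrightarrow> \<phi> x = 0"
  shows "\<phi> \<in> points (dual X)"
  using assms unfolding dual_def linear_between_def
  by (auto simp: scaleC_complex_def intro!: exI[of _ C])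

lemma dual_linear: "\<phi> \<in> points (dual X) \<Longrightarrow> linear_between X whole \<phi>"
  and dual_outside: "\<phi> \<in> points (dual X) \<Longrightarrow> x \<notin> points X \<Longrightarrow> \<phi> x = 0"
  by (simp_all add: dual_def)

lemma dual_add: "\<phi> \<in> points (dual X) \<Longrightarrow> x \<in> points X \<Longrightarrow> y \<in> points X \<Longrightarrow> \<phi> (x + y) = \<phi> x + \<phi> y"
  and dual_scale: "\<phi> \<in> points (dual X) \<Longrightarrow> x \<in> points X \<Longrightarrow> \<phi> (c *\<^sub>C x) = c * \<phi> x"
  using linear_betweenD[OF dual_linear] by (auto simp: scaleC_complex_def)

lemma dual_sum:
  assumes "normed_space X" "\<phi> \<in> points (dual X)" "\<And>i. i \<in> I \<Longrightarrow> x i \<in> points X"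
  shows "\<phi> (\<Sum>i\<in>I. c i *\<^sub>C x i) = (\<Sum>i\<in>I. c i * \<phi> (x i))"
  using linear_between_sum[OF dual_linear[OF assms(2)] nspace_subspace[OF assms(1)] assms(3)]
  by (simp add: scaleC_complex_def)

lemma dual_0: "normed_space X \<Longrightarrow> \<phi> \<in> points (dual X) \<Longrightarrow> \<phi> 0 = 0"
  by (rule linear_between_0[OF dual_linear nspace_subspace])

lemma dual_diff:
  "normed_space X \<Longrightarrow> \<phi> \<in> points (dual X) \<Longrightarrow> x \<in> points X \<Longrightarrow> y \<in> points X \<Longrightarrow> \<phi> (x - y) = \<phi> x - \<phi> y"
  by (rule linear_between_diff[OF dual_linear nspace_subspace])

lemma nrm_dual: "nrm (dual X) \<phi> = (SUP x\<in>{x \<in> points X. nrm X x \<le> 1}. cmod (\<phi> x))"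
  by (simp add: dual_def)

lemma bdd_above_dual_ball:
  assumes "\<phi> \<in> points (dual X)" and X: "normed_space X"
  shows "bdd_above ((\<lambda>x. cmod (\<phi> x)) ` {x \<in> points X. nrm X x \<le> 1})"
proof -
  obtain C where C: "\<And>x. x \<in> points X \<Longrightarrow> cmod (\<phi> x) \<le> C * nrm X x"
    using assms(1) by (auto simp: dual_def)
  have "cmod (\<phi> x) \<le> max C 0" if "x \<in> points X" "nrm X x \<le> 1" for x
  proof -
    have "cmod (\<phi> x) \<le> max C 0 * nrm X x"
      using C[OF that(1)] nspace_nonneg[OF X that(1)] mult_right_mono[of C "max C 0" "nrm X x"] by simp
    also have "\<dots> \<le> max C 0" using that(2) by (simp add: mult_left_le)
    finally show ?thesis .
  qed
  then show ?thesis by (intro bdd_aboveI2) auto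
qed

lemma dual_bound:
  assumes X: "normed_space X" and \<phi>: "\<phi> \<in> points (dual X)" and x: "x \<in> points X"
  shows "cmod (\<phi> x) \<le> nrm (dual X) \<phi> * nrm X x"
proof (cases "x = 0")
  case True
  then show ?thesis using dual_0[OF X \<phi>] nspace_nrm_0[OF X] by simp
next
  case False
  then have pos: "0 < nrm X x" using nspace_nonneg[OF X x] nspace_eq_0[OF X x] by auto
  let ?c = "complex_of_real (1 / nrm X x)"
  have "cmod (\<phi> (?c *\<^sub>C x)) \<le> nrm (dual X) \<phi>"
    unfolding nrm_dual using pos x nspace_scale[OF X x] nspace_closed(4)[OF X x]
    by (intro cSUP_upper bdd_above_dual_ball \<phi> X) (auto simp: norm_divide)
  then show ?thesis
    using pos by (simp add: dual_scale[OF \<phi> x] norm_mult norm_divide field_simps)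
qed

lemma dual_nrm_le:
  assumes X: "normed_space X" and C: "0 \<le> C"
    and le: "\<And>x. x \<in> points X \<Longrightarrow> cmod (\<phi> x) \<le> C * nrm X x"
  shows "nrm (dual X) \<phi> \<le> C"
  unfolding nrm_dual
proof (rule cSUP_least)
  show "{x \<in> points X. nrm X x \<le> 1} \<noteq> {}"
    using nspace_closed(1)[OF X] nspace_nrm_0[OF X] by auto
  fix x assume "x \<in> {x \<in> points X. nrm X x \<le> 1}"
  then show "cmod (\<phi> x) \<le> C" using le[of x] C mult_left_le[of "nrm X x" C] by auto
qed

lemma dual_nrm_nonneg:
  assumes X: "normed_space X" and \<phi>: "\<phi> \<in> points (dual X)"
  shows "0 \<le> nrm (dual X) \<phi>"
proof -
  have "cmod (\<phi> 0) \<le> nrm (dual X) \<phi>"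
    unfolding nrm_dual using nspace_closed(1)[OF X] nspace_nrm_0[OF X]
    by (intro cSUP_upper bdd_above_dual_ball \<phi> X) auto
  then show ?thesis using dual_0[OF X \<phi>] by simp
qed

lemma dual_nrm_approx:
  assumes X: "normed_space X" and \<phi>: "\<phi> \<in> points (dual X)" and e: "0 < e"
  shows "\<exists>x\<in>{x \<in> points X. nrm X x \<le> 1}. nrm (dual X) \<phi> \<le> cmod (\<phi> x) + e"
proof -
  have "{x \<in> points X. nrm X x \<le> 1} \<noteq> {}"
    using nspace_closed(1)[OF X] nspace_nrm_0[OF X] by auto
  moreover have "nrm (dual X) \<phi> - e < (SUP x\<in>{x \<in> points X. nrm X x \<le> 1}. cmod (\<phi> x))"
    using e by (simp add: nrm_dual)
  ultimately obtain x where "x \<in> {x \<in> points X. nrm X x \<le> 1}" "nrm (dual X) \<phi> - e < cmod (\<phi> x)"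
    using less_cSUP_iff[OF _ bdd_above_dual_ball[OF \<phi> X]] by auto
  then show ?thesis by (intro bexI[of _ x]) auto
qed

lemma normed_space_dual:
  assumes X: "normed_space X"
  shows "normed_space (dual X)"
proof -
  have add: "\<phi> + \<psi> \<in> points (dual X)" and tri: "nrm (dual X) (\<phi> + \<psi>) \<le> nrm (dual X) \<phi> + nrm (dual X) \<psi>"
    if "\<phi> \<in> points (dual X)" "\<psi> \<in> points (dual X)" for \<phi> \<psi>
  proof -
    have le: "cmod ((\<phi> + \<psi>) x) \<le> (nrm (dual X) \<phi> + nrm (dual X) \<psi>) * nrm X x" if "x \<in> points X" for x
      using dual_bound[OF X \<open>\<phi> \<in> _\<close> that] dual_bound[OF X \<open>\<psi> \<in> _\<close> that]
        norm_triangle_ineq[of "\<phi> x" "\<psi> x"] by (simp add: algebra_simps)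
    show "\<phi> + \<psi> \<in> points (dual X)"
      using that by (intro dualI[OF _ _ le]) (auto simp: dual_add dual_scale dual_outside algebra_simps)
    show "nrm (dual X) (\<phi> + \<psi>) \<le> nrm (dual X) \<phi> + nrm (dual X) \<psi>"
      using that by (intro dual_nrm_le[OF X _ le] add_nonneg_nonneg dual_nrm_nonneg[OF X])
  qed
  have scale: "c *\<^sub>C \<phi> \<in> points (dual X)" and hom_le: "nrm (dual X) (c *\<^sub>C \<phi>) \<le> cmod c * nrm (dual X) \<phi>"
    if "\<phi> \<in> points (dual X)" for c \<phi>
  proof -
    have le: "cmod ((c *\<^sub>C \<phi>) x) \<le> (cmod c * nrm (dual X) \<phi>) * nrm X x" if "x \<in> points X" for x
      using dual_bound[OF X \<open>\<phi> \<in> _\<close> that]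
      by (simp add: scaleC_fun_def scaleC_complex_def norm_mult mult_left_mono mult.assoc)
    show "c *\<^sub>C \<phi> \<in> points (dual X)"
      using that by (intro dualI[OF _ _ le])
        (auto simp: scaleC_fun_def scaleC_complex_def dual_add dual_scale dual_outside algebra_simps)
    show "nrm (dual X) (c *\<^sub>C \<phi>) \<le> cmod c * nrm (dual X) \<phi>"
      using that by (intro dual_nrm_le[OF X _ le] mult_nonneg_nonneg dual_nrm_nonneg[OF X]) auto
  qed
  have zero: "(0 :: 'a \<Rightarrow> complex) \<in> points (dual X)"
    by (rule dualI[where C = 0]) auto
  show ?thesis
  proof (rule normed_spaceI)
    show "complex_vector.subspace (points (dual X))"
      by (rule complex_vector.subspaceI) (simp_all add: zero add scale)
    fix \<phi> assume \<phi>: "\<phi> \<in> points (dual X)"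
    show "\<phi> = 0" if 0: "nrm (dual X) \<phi> = 0"
    proof
      fix x show "\<phi> x = 0 x"
        using dual_bound[OF X \<phi>, of x] dual_outside[OF \<phi>, of x] 0 by (cases "x \<in> points X") auto
    qed
  qed (simp_all add: dual_nrm_nonneg[OF X] tri hom_le)
qed

text \<open>The canonical map into the bidual; it vanishes outside \<open>dual X\<close>, as elements of
\<open>dual (dual X)\<close> have to.\<close>

definition bidual_eval :: "'a::complex_vector nspace \<Rightarrow> 'a \<Rightarrow> ('a \<Rightarrow> complex) \<Rightarrow> complex" where
  "bidual_eval X x = (\<lambda>\<phi>. if \<phi> \<in> points (dual X) then \<phi> x else 0)"

lemma bidual_eval:
  assumes X: "normed_space X" and x: "x \<in> points X"
  shows bidual_eval_in: "bidual_eval X x \<in> points (dual (dual X))"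
    and nrm_bidual_eval_le: "nrm (dual (dual X)) (bidual_eval X x) \<le> nrm X x"
proof -
  note dX = normed_space_dual[OF X]
  have le: "cmod (bidual_eval X x \<phi>) \<le> nrm X x * nrm (dual X) \<phi>" if "\<phi> \<in> points (dual X)" for \<phi>
    using dual_bound[OF X that x] that by (simp add: bidual_eval_def mult.commute)
  show "bidual_eval X x \<in> points (dual (dual X))"
    using nspace_closed[OF dX] by (intro dualI[OF _ _ le]) (auto simp: bidual_eval_def scaleC_fun_def scaleC_complex_def)
  show "nrm (dual (dual X)) (bidual_eval X x) \<le> nrm X x"
    by (rule dual_nrm_le[OF dX nspace_nonneg[OF X x] le])
qed

lemma weak_norm_upper:
  assumes Y: "normed_space Y" and q: "1 \<le> q" and y: "\<And>i. i < n \<Longrightarrow> y i \<in> points Y"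
    and \<phi>: "\<phi> \<in> points (dual Y)" "nrm (dual Y) \<phi> \<le> 1"
  shows "lq_norm q n (\<lambda>i. cmod (\<phi> (y i))) \<le> weak_norm q Y n y"
  unfolding weak_norm_def
proof (rule cSUP_upper)
  have "lq_norm q n (\<lambda>i. cmod (\<psi> (y i))) \<le> lq_norm q n (\<lambda>i. nrm Y (y i))"
    if "\<psi> \<in> points (dual Y)" "nrm (dual Y) \<psi> \<le> 1" for \<psi>
  proof (rule lq_norm_mono[OF q])
    fix i assume i: "i < n"
    have "cmod (\<psi> (y i)) \<le> nrm (dual Y) \<psi> * nrm Y (y i)" by (rule dual_bound[OF Y that(1) y[OF i]])
    also have "\<dots> \<le> 1 * nrm Y (y i)"
      using that(2) nspace_nonneg[OF Y y[OF i]] by (rule mult_right_mono)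
    finally show "0 \<le> cmod (\<psi> (y i)) \<and> cmod (\<psi> (y i)) \<le> nrm Y (y i)" by simp
  qed
  then show "bdd_above ((\<lambda>\<phi>. lq_norm q n (\<lambda>i. cmod (\<phi> (y i)))) ` {\<phi> \<in> points (dual Y). nrm (dual Y) \<phi> \<le> 1})"
    by (intro bdd_aboveI2) auto
qed (use \<phi> in auto)

lemma weak_norm_le:
  assumes Y: "normed_space Y"
    and "\<And>\<phi>. \<phi> \<in> points (dual Y) \<Longrightarrow> nrm (dual Y) \<phi> \<le> 1 \<Longrightarrow> lq_norm q n (\<lambda>i. cmod (\<phi> (y i))) \<le> C"
  shows "weak_norm q Y n y \<le> C"
  unfolding weak_norm_def
proof (rule cSUP_least)
  show "{\<phi> \<in> points (dual Y). nrm (dual Y) \<phi> \<le> 1} \<noteq> {}"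
    using nspace_closed(1)[OF normed_space_dual[OF Y]] nspace_nrm_0[OF normed_space_dual[OF Y]]
    by (auto intro!: exI[of _ 0])
qed (use assms(2) in auto)

lemma weak_norm_nonneg:
  assumes Y: "normed_space Y" and q: "1 \<le> q" and y: "\<And>i. i < n \<Longrightarrow> y i \<in> points Y"
  shows "0 \<le> weak_norm q Y n y"
  using order_trans[OF lq_norm_nonneg weak_norm_upper[OF Y q y nspace_closed(1)[OF normed_space_dual[OF Y]]]]
    nspace_nrm_0[OF normed_space_dual[OF Y]] by simp

lemma weak_norm_dual_bound:
  assumes Y: "normed_space Y" and q: "1 \<le> q" and y: "\<And>i. i < n \<Longrightarrow> y i \<in> points Y"
    and \<phi>: "\<phi> \<in> points (dual Y)"
  shows "lq_norm q n (\<lambda>i. cmod (\<phi> (y i))) \<le> nrm (dual Y) \<phi> * weak_norm q Y n y"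
proof (cases "\<phi> = 0")
  case True
  then show ?thesis
    using lq_norm_scale[OF q, of 0 n "\<lambda>_. 0"] nspace_nrm_0[OF normed_space_dual[OF Y]] by simp
next
  case False
  note dY = normed_space_dual[OF Y]
  have pos: "0 < nrm (dual Y) \<phi>" using False nspace_eq_0[OF dY \<phi>] nspace_nonneg[OF dY \<phi>] by auto
  let ?c = "complex_of_real (1 / nrm (dual Y) \<phi>)"
  have "lq_norm q n (\<lambda>i. cmod ((?c *\<^sub>C \<phi>) (y i))) \<le> weak_norm q Y n y"
    using pos nspace_scale[OF dY \<phi>, of ?c] nspace_closed(4)[OF dY \<phi>]
    by (intro weak_norm_upper[OF Y q y]) (auto simp: norm_divide)
  moreover have "lq_norm q n (\<lambda>i. cmod ((?c *\<^sub>C \<phi>) (y i))) = 1 / nrm (dual Y) \<phi> * lq_norm q n (\<lambda>i. cmod (\<phi> (y i)))"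
    using lq_norm_scale[OF q, of "1 / nrm (dual Y) \<phi>" n "\<lambda>i. cmod (\<phi> (y i))"] pos
    by (simp add: scaleC_fun_def scaleC_complex_def norm_mult norm_divide)
  ultimately have "1 / nrm (dual Y) \<phi> * lq_norm q n (\<lambda>i. cmod (\<phi> (y i))) \<le> weak_norm q Y n y"
    by (simp only:)
  then show ?thesis using pos by (simp add: field_simps)
qed

lemma weak_norm_single_le:
  assumes Y: "normed_space Y" and q: "1 \<le> q" and y: "y 0 \<in> points Y"
  shows "weak_norm q Y (Suc 0) y \<le> nrm Y (y 0)"
proof (rule weak_norm_le[OF Y])
  fix \<phi> assume "\<phi> \<in> points (dual Y)" "nrm (dual Y) \<phi> \<le> 1"
  then have "cmod (\<phi> (y 0)) \<le> 1 * nrm Y (y 0)"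
    using dual_bound[OF Y _ y, of \<phi>] mult_right_mono[of "nrm (dual Y) \<phi>" 1 "nrm Y (y 0)"]
      nspace_nonneg[OF Y y] by simp
  then show "lq_norm q (Suc 0) (\<lambda>i. cmod (\<phi> (y i))) \<le> nrm Y (y 0)"
    using lq_norm_single[OF q, of "\<lambda>i. cmod (\<phi> (y i))"] by simp
qed

text \<open>A functional in the unit ball of the third dual restricts, along the canonical embedding, to one in
the unit ball of \<open>dual Y\<close>.\<close>

lemma weak_norm_bidual_eval_le:
  assumes Y: "normed_space Y" and q: "1 \<le> q" and y: "\<And>i. i < n \<Longrightarrow> y i \<in> points Y"
  shows "weak_norm q (dual (dual Y)) n (\<lambda>i. bidual_eval Y (y i)) \<le> weak_norm q Y n y"
proof (rule weak_norm_le[OF normed_space_dual[OF normed_space_dual[OF Y]]])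
  note dY = normed_space_dual[OF Y] and ddY = normed_space_dual[OF normed_space_dual[OF Y]]
  fix \<Phi> assume \<Phi>: "\<Phi> \<in> points (dual (dual (dual Y)))" "nrm (dual (dual (dual Y))) \<Phi> \<le> 1"
  define \<phi> where "\<phi> x = (if x \<in> points Y then \<Phi> (bidual_eval Y x) else 0)" for x
  have le: "cmod (\<phi> x) \<le> 1 * nrm Y x" if x: "x \<in> points Y" for x
  proof -
    have "cmod (\<Phi> (bidual_eval Y x)) \<le> nrm (dual (dual (dual Y))) \<Phi> * nrm (dual (dual Y)) (bidual_eval Y x)"
      by (rule dual_bound[OF ddY \<Phi>(1) bidual_eval_in[OF Y x]])
    also have "\<dots> \<le> 1 * nrm Y x"
      using \<Phi>(2) nrm_bidual_eval_le[OF Y x] dual_nrm_nonneg[OF dY bidual_eval_in[OF Y x]]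
      by (intro mult_mono) auto
    finally show ?thesis using x by (simp add: \<phi>_def)
  qed
  have "\<phi> \<in> points (dual Y)"
  proof (rule dualI[OF _ _ le])
    fix x y assume "x \<in> points Y" "y \<in> points Y"
    moreover from this have "bidual_eval Y (x + y) = bidual_eval Y x + bidual_eval Y y"
      by (auto simp: bidual_eval_def dual_add)
    ultimately show "\<phi> (x + y) = \<phi> x + \<phi> y"
      using dual_add[OF \<Phi>(1)] bidual_eval_in[OF Y] nspace_closed[OF Y] by (simp add: \<phi>_def)
  next
    fix c x assume "x \<in> points Y"
    moreover from this have "bidual_eval Y (c *\<^sub>C x) = c *\<^sub>C bidual_eval Y x"
      by (auto simp: bidual_eval_def dual_scale scaleC_fun_def scaleC_complex_def)
    ultimately show "\<phi> (c *\<^sub>C x) = c * \<phi> x"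
      using dual_scale[OF \<Phi>(1)] bidual_eval_in[OF Y] nspace_closed[OF Y] by (simp add: \<phi>_def)
  qed (simp_all add: \<phi>_def)
  moreover have "nrm (dual Y) \<phi> \<le> 1" by (rule dual_nrm_le[OF Y _ le]) simp
  ultimately have "lq_norm q n (\<lambda>i. cmod (\<phi> (y i))) \<le> weak_norm q Y n y"
    by (intro weak_norm_upper[OF Y q y])
  moreover have "lq_norm q n (\<lambda>i. cmod (\<phi> (y i))) = lq_norm q n (\<lambda>i. cmod (\<Phi> (bidual_eval Y (y i))))"
    using y by (intro lq_norm_cong) (simp add: \<phi>_def)
  ultimately show "lq_norm q n (\<lambda>i. cmod (\<Phi> (bidual_eval Y (y i)))) \<le> weak_norm q Y n y" by simp
qed

section \<open>Local reflexivity for weak norms\<close>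

lemma additive_sum:
  fixes H :: "'a::comm_monoid_add \<Rightarrow> 'b::ab_group_add"
  assumes H: "\<And>x y. H (x + y) = H x + H y"
  shows "H (sum f I) = (\<Sum>i\<in>I. H (f i))"
proof -
  have 0: "H 0 = 0" using H[of 0 0] by simp
  show ?thesis by (induction I rule: infinite_finite_induct) (simp_all add: 0 H)
qed

text \<open>The norm of \<open>Z\<close> is meaningful on \<open>points Z\<close> only. Composing it with a linear projection onto
\<open>points Z\<close> turns it into a seminorm on the ambient type.\<close>

lemma hahn_banach_factor_nspace:
  fixes T :: "'a::complex_vector \<Rightarrow> 'b::complex_vector" and X :: "'a nspace" and Z :: "'b nspace"
  assumes X: "complex_vector.subspace (points X)" and Z: "normed_space Z"
    and T: "linear_between X Z T" and G: "linear_between X whole G"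
    and C: "0 \<le> C" and bound: "\<And>v. v \<in> points X \<Longrightarrow> cmod (G v) \<le> C * nrm Z (T v)"
  obtains \<phi> where "\<phi> \<in> points (dual Z)" "nrm (dual Z) \<phi> \<le> C" "\<And>v. v \<in> points X \<Longrightarrow> \<phi> (T v) = G v"
proof -
  interpret vector_space_pair "scaleC :: complex \<Rightarrow> 'b \<Rightarrow> 'b" "scaleC :: complex \<Rightarrow> 'b \<Rightarrow> 'b" ..
  obtain g :: "'b \<Rightarrow> 'b" where g: "range g \<subseteq> points Z" "Vector_Spaces.linear scaleC scaleC g"
    and g_id: "\<forall>v\<in>points Z. g v = v"
    using linear_exists_left_inverse_on[OF complex_vector.linear_id nspace_subspace[OF Z]] by auto
  interpret g: Vector_Spaces.linear scaleC scaleC g by (rule g)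
  have gZ: "g x \<in> points Z" for x using g(1) by auto
  obtain H where H: "\<And>x y. H (x + y) = H x + H y" "\<And>c x. H (c *\<^sub>C x) = c * H x"
    "\<And>x. cmod (H x) \<le> C * nrm Z (g x)" "\<And>v. v \<in> points X \<Longrightarrow> H (T v) = G v"
  proof (rule hahn_banach_factor[OF X, of T G "\<lambda>x. C * nrm Z (g x)"])
    show "C * nrm Z (g (x + y)) \<le> C * nrm Z (g x) + C * nrm Z (g y)" for x y
      using mult_left_mono[OF nspace_triangle[OF Z gZ[of x] gZ[of y]] C] by (simp add: g.add distrib_left)
    show "C * nrm Z (g (c *\<^sub>C x)) = cmod c * (C * nrm Z (g x))" for c x
      using nspace_scale[OF Z gZ[of x]] by (simp add: g.scale)
    show "cmod (G v) \<le> C * nrm Z (g (T v))" if "v \<in> points X" for v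
      using bound[OF that] g_id linear_betweenD(1)[OF T that] by simp
  qed (use linear_betweenD[OF T] linear_betweenD[OF G] in \<open>auto simp: scaleC_complex_def\<close>)
  define \<phi> where "\<phi> z = (if z \<in> points Z then H z else 0)" for z
  have le: "cmod (\<phi> z) \<le> C * nrm Z z" if "z \<in> points Z" for z
    using H(3)[of z] that g_id by (simp add: \<phi>_def)
  have "\<phi> \<in> points (dual Z)"
    by (rule dualI[OF _ _ le]) (auto simp: \<phi>_def H nspace_closed[OF Z])
  moreover have "nrm (dual Z) \<phi> \<le> C" by (rule dual_nrm_le[OF Z C le])
  moreover have "\<phi> (T v) = G v" if "v \<in> points X" for v
    using that linear_betweenD(1)[OF T that] by (simp add: \<phi>_def H)
  ultimately show ?thesis using that by blast
qed

text \<open>The entries of an element of the ball lie in the closed unit disc, which has a finite net. Rounding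
each entry assigns one of finitely many codes to every element of the ball, and the net consists of
one representative for each code that occurs; so it lies inside the ball itself.\<close>

lemma lq_ball_finite_net:
  fixes n :: nat and \<eta> :: real
  assumes p: "1 \<le> p" and \<eta>: "0 < \<eta>"
  defines "B \<equiv> {a :: nat \<Rightarrow> complex. lq_norm p n (\<lambda>i. cmod (a i)) \<le> 1}"
  obtains A where "finite A" "A \<noteq> {}" "A \<subseteq> B" "\<And>a. a \<in> B \<Longrightarrow> \<exists>a'\<in>A. \<forall>i<n. cmod (a i - a' i) \<le> \<eta>"
proof -
  obtain k where k: "finite k" "cball 0 1 \<subseteq> (\<Union>x\<in>k. ball (x :: complex) (\<eta> / 2))"
    using seq_compact_imp_totally_bounded[of "cball 0 1 :: complex set"] \<eta>
    by (meson compact_cball compact_imp_seq_compact half_gt_zero)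
  have "\<forall>u. \<exists>x. cmod u \<le> 1 \<longrightarrow> x \<in> k \<and> dist x u < \<eta> / 2"
    using k(2) by (force simp: subset_iff)
  then obtain c where c: "\<And>u. cmod u \<le> 1 \<Longrightarrow> c u \<in> k \<and> dist (c u) u < \<eta> / 2" by metis
  have B1: "cmod (a i) \<le> 1" if "a \<in> B" "i < n" for a i
    using lq_norm_ge_coordinate[OF p, of n "\<lambda>i. cmod (a i)" i] that by (auto simp: B_def)
  define code where "code a = restrict (\<lambda>i. c (a i)) {..<n}" for a
  have "code ` B \<subseteq> PiE {..<n} (\<lambda>_. k)" using c B1 by (auto simp: code_def split: if_splits)
  then have fin: "finite (code ` B)" by (rule finite_subset) (intro finite_PiE k; simp)
  define A where "A = inv_into B code ` (code ` B)"
  have "(\<lambda>_. 0) \<in> B" using lq_norm_scale[OF p, of 0 n "\<lambda>_. 0"] by (simp add: B_def)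
  then have "A \<noteq> {}" by (auto simp: A_def)
  moreover have "A \<subseteq> B" by (auto simp: A_def inv_into_into)
  moreover have "\<exists>a'\<in>A. \<forall>i<n. cmod (a i - a' i) \<le> \<eta>" if a: "a \<in> B" for a
  proof (intro bexI allI impI)
    let ?b = "inv_into B code (code a)"
    show "?b \<in> A" using a by (auto simp: A_def)
    have b: "?b \<in> B" using a by (intro inv_into_into) auto
    fix i assume i: "i < n"
    have "code ?b = code a" using a by (simp add: f_inv_into_f)
    then have "c (?b i) = c (a i)" using i by (auto simp: code_def fun_eq_iff restrict_def split: if_splits dest: spec[of _ i])
    then have "dist (a i) (?b i) \<le> dist (c (a i)) (a i) + dist (c (?b i)) (?b i)"
      using dist_triangle3[of "a i" "?b i" "c (a i)"] by simp
    also have "\<dots> \<le> \<eta>" using c[OF B1[OF a i]] c[OF B1[OF b i]] by simp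
    finally show "cmod (a i - ?b i) \<le> \<eta>" by (simp add: dist_norm)
  qed
  moreover have "finite A" using fin by (simp add: A_def)
  ultimately show ?thesis using that by blast
qed

text \<open>By Hoelder duality the weak \<open>p\<^sup>*\<close>-norm of \<open>y\<close> is at most the supremum \<open>S\<close> of \<open>\<parallel>\<Sum> a\<^sub>i y\<^sub>i\<parallel>\<close> over the unit
ball of \<open>\<ell>\<^sub>p\<^sup>n\<close>. Replacing \<open>a\<close> by a nearby element of a finite net costs at most \<open>n \<eta> max \<parallel>y\<^sub>i\<parallel>\<close>, which is
at most \<open>t S\<close> since \<open>\<parallel>y\<^sub>i\<parallel> \<le> S\<close>; so the net alone recovers the fraction \<open>1 - t\<close> of \<open>S\<close>.\<close>

lemma weak_norm_norming_set:
  fixes p :: ereal and n :: nat and t :: real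
  assumes p: "1 \<le> p" and t: "0 < t" "t < 1"
  obtains A :: "(nat \<Rightarrow> complex) set" where "finite A" "A \<noteq> {}"
    "\<And>a. a \<in> A \<Longrightarrow> lq_norm p n (\<lambda>i. cmod (a i)) \<le> 1"
    "\<And>y :: nat \<Rightarrow> 'f::complex_normed_vector.
      (1 - t) * weak_norm (conj_index p) whole n y \<le> Max ((\<lambda>a. norm (\<Sum>i<n. a i *\<^sub>C y i)) ` A)"
proof -
  define B where "B = {a :: nat \<Rightarrow> complex. lq_norm p n (\<lambda>i. cmod (a i)) \<le> 1}"
  define \<eta> where "\<eta> = t / (real n + 1)"
  have \<eta>: "0 < \<eta>" "real n * \<eta> \<le> t" using t by (auto simp: \<eta>_def field_simps)
  obtain A where A: "finite A" "A \<noteq> {}" "A \<subseteq> B"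
    "\<And>a. a \<in> B \<Longrightarrow> \<exists>a'\<in>A. \<forall>i<n. cmod (a i - a' i) \<le> \<eta>"
    using lq_ball_finite_net[OF p \<eta>(1), of n] unfolding B_def by blast
  have "(1 - t) * weak_norm (conj_index p) whole n y \<le> Max ((\<lambda>a. norm (\<Sum>i<n. a i *\<^sub>C y i)) ` A)"
    for y :: "nat \<Rightarrow> 'f"
  proof -
    let ?f = "\<lambda>a. norm (\<Sum>i<n. a i *\<^sub>C y i)"
    define S where "S = (SUP a\<in>B. ?f a)"
    define m where "m = Max (?f ` A)"
    have coord: "cmod (a i) \<le> 1" if "a \<in> B" "i < n" for a i
      using lq_norm_ge_coordinate[OF p, of n "\<lambda>i. cmod (a i)" i] that by (auto simp: B_def)
    have "?f a \<le> (\<Sum>i<n. norm (y i))" if "a \<in> B" for a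
      using coord[OF that] by (intro order_trans[OF norm_sum] sum_mono) (simp add: norm_scaleC mult_left_le_one_le)
    then have f_le_S: "?f a \<le> S" if "a \<in> B" for a
      unfolding S_def using that by (intro cSUP_upper bdd_aboveI2) auto
    have y_le: "norm (y i) \<le> S" if "i < n" for i
    proof -
      have "(\<Sum>k<n. (if k = i then 1 else 0) *\<^sub>C y k) = (\<Sum>k<n. if k = i then y k else 0)"
        by (intro sum.cong) (auto simp: scaleC_one)
      then have "norm (y i) = ?f (\<lambda>k. if k = i then 1 else 0)" using that by (simp add: sum.delta)
      also have "\<dots> \<le> S"
        using lq_norm_axis_le[OF p, of n i]
        by (intro f_le_S) (simp add: B_def if_distrib[of cmod] cong: if_cong)
      finally show ?thesis .
    qed
    have S0: "0 \<le> S" using A(2,3) f_le_S norm_ge_zero order_trans by (metis all_not_in_conv subsetD)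
    have "?f a \<le> m + t * S" if a: "a \<in> B" for a
    proof -
      obtain a' where a': "a' \<in> A" "\<And>i. i < n \<Longrightarrow> cmod (a i - a' i) \<le> \<eta>" using A(4)[OF a] by blast
      have "?f a = norm ((\<Sum>i<n. a' i *\<^sub>C y i) + (\<Sum>i<n. (a i - a' i) *\<^sub>C y i))"
        by (simp add: complex_vector.scale_left_diff_distrib sum_subtractf)
      also have "\<dots> \<le> ?f a' + (\<Sum>i<n. norm ((a i - a' i) *\<^sub>C y i))"
        by (intro order_trans[OF norm_triangle_ineq] add_left_mono norm_sum)
      also have "\<dots> \<le> m + (\<Sum>i<n. \<eta> * S)"
        using a' y_le A(1) \<eta>(1) unfolding m_def
        by (intro add_mono Max_ge sum_mono) (auto simp: norm_scaleC intro!: mult_mono)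
      also have "\<dots> \<le> m + t * S" using mult_right_mono[OF \<eta>(2) S0] by simp
      finally show ?thesis .
    qed
    then have "S \<le> m + t * S"
      unfolding S_def[symmetric] using A(2,3) by (subst S_def) (intro cSUP_least; auto)
    then have "(1 - t) * S \<le> m" by (simp add: algebra_simps)
    have "weak_norm (conj_index p) whole n y \<le> S"
    proof (rule weak_norm_le[OF normed_space_whole])
      fix \<phi> :: "'f \<Rightarrow> complex"
      assume \<phi>: "\<phi> \<in> points (dual whole)" "nrm (dual whole) \<phi> \<le> 1"
      obtain a where a: "lq_norm p n (\<lambda>i. cmod (a i)) \<le> 1"
        "(\<Sum>i<n. a i * \<phi> (y i)) = complex_of_real (lq_norm (conj_index p) n (\<lambda>i. cmod (\<phi> (y i))))"
        using lq_norm_Holder_extremal[OF p, of n "\<lambda>i. \<phi> (y i)"] by auto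
      have "lq_norm (conj_index p) n (\<lambda>i. cmod (\<phi> (y i))) = cmod (\<phi> (\<Sum>i<n. a i *\<^sub>C y i))"
        using a(2) dual_sum[OF normed_space_whole \<phi>(1), of "{..<n}" y a] lq_norm_nonneg
        by (simp add: abs_of_nonneg)
      also have "\<dots> \<le> nrm (dual whole) \<phi> * ?f a"
        using dual_bound[OF normed_space_whole \<phi>(1)] by simp
      also have "\<dots> \<le> 1 * S"
        using \<phi>(2) a(1) S0 by (intro mult_mono f_le_S) (auto simp: B_def)
      finally show "lq_norm (conj_index p) n (\<lambda>i. cmod (\<phi> (y i))) \<le> S" by simp
    qed
    then have "(1 - t) * weak_norm (conj_index p) whole n y \<le> (1 - t) * S"
      using t by (intro mult_left_mono) auto
    with \<open>(1 - t) * S \<le> m\<close> show ?thesis by (simp add: m_def)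
  qed
  with A that[of A] show ?thesis unfolding B_def by blast
qed

text \<open>The dual of a finite \<open>\<ell>\<^sub>\<infinity>\<close>-sum of copies of \<open>F\<close> is the \<open>\<ell>\<^sub>1\<close>-sum of the duals. For the bound on the
\<open>\<ell>\<^sub>1\<close>-norm, vectors almost norming the components are rotated so that all contributions to \<open>H\<close> become
nonnegative.\<close>

lemma functional_on_finite_family:
  fixes A :: "'i set" and H :: "('i \<Rightarrow> 'f::complex_normed_vector) \<Rightarrow> complex"
  assumes A: "finite A" "A \<noteq> {}" and K: "0 \<le> K"
    and H: "\<And>x y. H (x + y) = H x + H y" "\<And>c x. H (c *\<^sub>C x) = c * H x"
    and bound: "\<And>w. cmod (H w) \<le> K * Max ((\<lambda>a. norm (w a)) ` A)"
  obtains \<phi> :: "'i \<Rightarrow> 'f \<Rightarrow> complex" where "\<And>a. \<phi> a \<in> points (dual whole)"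
    "(\<Sum>a\<in>A. nrm (dual whole) (\<phi> a)) \<le> K"
    "\<And>w. (\<And>a. a \<notin> A \<Longrightarrow> w a = 0) \<Longrightarrow> H w = (\<Sum>a\<in>A. \<phi> a (w a))"
proof -
  define single where "single a v = (\<lambda>b :: 'i. if b = a then v else 0)" for a and v :: 'f
  define \<phi> where "\<phi> a v = H (single a v)" for a v
  have \<phi>: "\<phi> a \<in> points (dual whole)" for a
  proof (rule dualI[where C = K])
    fix u v :: 'f
    have "single a (u + v) = single a u + single a v" by (auto simp: single_def)
    then show "\<phi> a (u + v) = \<phi> a u + \<phi> a v" by (simp add: \<phi>_def H)
  next
    fix c and v :: 'f
    have "single a (c *\<^sub>C v) = c *\<^sub>C single a v" by (auto simp: single_def scaleC_fun_def)
    then show "\<phi> a (c *\<^sub>C v) = c * \<phi> a v" by (simp add: \<phi>_def H)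
  next
    fix v :: 'f
    have "Max ((\<lambda>b. norm (single a v b)) ` A) \<le> norm v"
      using A by (intro Max.boundedI) (auto simp: single_def split: if_splits)
    then have "K * Max ((\<lambda>b. norm (single a v b)) ` A) \<le> K * norm v" using K by (rule mult_left_mono)
    with bound[of "single a v"] show "cmod (\<phi> a v) \<le> K * nrm whole v" by (simp add: \<phi>_def)
  qed simp
  have decomp: "H w = (\<Sum>a\<in>A. \<phi> a (w a))" if "\<And>a. a \<notin> A \<Longrightarrow> w a = 0" for w
  proof -
    have "w = (\<Sum>a\<in>A. single a (w a))"
    proof
      fix b
      have "(\<Sum>a\<in>A. single a (w a)) b = (\<Sum>a\<in>A. single a (w a) b)"
        by (rule additive_sum[where H = "\<lambda>w. w b"]) simp
      also have "\<dots> = (\<Sum>a\<in>A. if b = a then w a else 0)" by (simp add: single_def)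
      also have "\<dots> = w b" using A that[of b] by (simp add: sum.delta')
      finally show "w b = (\<Sum>a\<in>A. single a (w a)) b" ..
    qed
    then have "H w = H (\<Sum>a\<in>A. single a (w a))" by simp
    then show ?thesis by (simp add: \<phi>_def additive_sum[of H, OF H(1)])
  qed
  have "(\<Sum>a\<in>A. 1 * nrm (dual whole) (\<phi> a)) \<le> K"
  proof (rule sum_weighted_approx_le)
    show "\<exists>v\<in>{v \<in> points whole. nrm whole v \<le> 1}. nrm (dual whole) (\<phi> a) \<le> cmod (\<phi> a v) + e"
      if "0 < e" for a e
      by (rule dual_nrm_approx[OF normed_space_whole \<phi> that])
    fix v :: "'i \<Rightarrow> 'f" assume v: "\<And>a. a \<in> A \<Longrightarrow> v a \<in> {v \<in> points whole. nrm whole v \<le> 1}"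
    define s where "s a = cnj (sgn (\<phi> a (v a)))" for a
    define w where "w a = (if a \<in> A then s a *\<^sub>C v a else 0)" for a
    have "s a * \<phi> a (v a) = complex_of_real (cmod (\<phi> a (v a)))" for a
      using complex_norm_square[of "\<phi> a (v a)"]
      by (cases "\<phi> a (v a) = 0") (simp_all add: s_def sgn_eq power2_eq_square field_simps)
    then have "H w = (\<Sum>a\<in>A. complex_of_real (cmod (\<phi> a (v a))))"
      by (subst decomp) (auto simp: w_def dual_scale[OF \<phi>] intro!: sum.cong)
    then have "(\<Sum>a\<in>A. cmod (\<phi> a (v a))) = cmod (H w)"
      by (simp add: sum_nonneg flip: of_real_sum)
    also have "\<dots> \<le> K * Max ((\<lambda>a. norm (w a)) ` A)" by (rule bound)
    also have "\<dots> \<le> K * 1"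
    proof (intro mult_left_mono K Max.boundedI)
      fix r assume "r \<in> (\<lambda>a. norm (w a)) ` A"
      then obtain a where a: "a \<in> A" "r = cmod (s a) * norm (v a)" by (auto simp: w_def norm_scaleC)
      moreover have "cmod (s a) \<le> 1" by (simp add: s_def norm_sgn)
      ultimately show "r \<le> 1" using v[of a] by (simp add: mult_le_one)
    qed (use A in auto)
    finally show "(\<Sum>a\<in>A. 1 * cmod (\<phi> a (v a))) \<le> K" by simp
  qed simp
  then show ?thesis using that[of \<phi>] \<phi> decomp by simp
qed

text \<open>A form of the principle of local reflexivity. The inequality for the weak norm on \<open>F\<^sup>n\<close> becomes,
through a finite norming set \<open>A\<close>, domination by a maximum over \<open>a \<in> A\<close> of \<open>\<parallel>\<Sum> a\<^sub>i y\<^sub>i\<parallel>\<close>. Hahn--Banach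
then yields \<open>g\<^sub>i = \<Sum> a\<^sub>i \<phi>\<^sub>a\<close>, a finite sum with \<open>\<Sum> \<parallel>\<phi>\<^sub>a\<parallel> \<le> M / r\<close>. Hence \<open>\<Sum> z\<^sub>i(g\<^sub>i) = \<Sum>\<^sub>a \<Sum>\<^sub>i a\<^sub>i z\<^sub>i(\<phi>\<^sub>a)\<close>,
and the inner sums are estimated by Hoelder's inequality, using that each \<open>\<phi>\<^sub>a\<close> acts on the bidual
as a functional of norm at most \<open>\<parallel>\<phi>\<^sub>a\<parallel>\<close>. Finally \<open>r\<close> tends to \<open>1\<close>.\<close>

theorem weak_norm_local_reflexivity:
  fixes g :: "nat \<Rightarrow> 'f::complex_normed_vector \<Rightarrow> complex" and z :: "nat \<Rightarrow> ('f \<Rightarrow> complex) \<Rightarrow> complex"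
  assumes p: "1 \<le> p" and g: "\<And>i. i < n \<Longrightarrow> g i \<in> points (dual whole)" and M: "0 \<le> M"
    and bound: "\<And>y. cmod (\<Sum>i<n. g i (y i)) \<le> M * weak_norm (conj_index p) whole n y"
    and z: "\<And>i. i < n \<Longrightarrow> z i \<in> points (dual (dual whole))"
  shows "cmod (\<Sum>i<n. z i (g i)) \<le> M * weak_norm (conj_index p) (dual (dual whole)) n z"
proof (rule field_le_mult_one_interval)
  fix r :: real assume r: "0 < r" "r < 1"
  note q = conj_index_ge_1[OF p]
  note dF = normed_space_dual[OF normed_space_whole]
  let ?W = "weak_norm (conj_index p) (dual (dual whole)) n z"
  obtain A :: "(nat \<Rightarrow> complex) set" where A: "finite A" "A \<noteq> {}"
    and A1: "\<And>a. a \<in> A \<Longrightarrow> lq_norm p n (\<lambda>i. cmod (a i)) \<le> 1"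
    and norming: "\<And>y :: nat \<Rightarrow> 'f. r * weak_norm (conj_index p) whole n y \<le> Max ((\<lambda>a. norm (\<Sum>i<n. a i *\<^sub>C y i)) ` A)"
    using weak_norm_norming_set[OF p, of "1 - r" n] r by auto
  define T where "T y = (\<lambda>a. if a \<in> A then \<Sum>i<n. a i *\<^sub>C y i else 0)" for y :: "nat \<Rightarrow> 'f"
  define G where "G y = (\<Sum>i<n. g i (y i))" for y
  define P where "P w = M / r * Max ((\<lambda>a. norm (w a)) ` A)" for w :: "(nat \<Rightarrow> complex) \<Rightarrow> 'f"
  obtain H where H: "\<And>x y. H (x + y) = H x + H y" "\<And>c x. H (c *\<^sub>C x) = c * H x"
    "\<And>w. cmod (H w) \<le> P w" "\<And>y. y \<in> UNIV \<Longrightarrow> H (T y) = G y"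
  proof (rule hahn_banach_factor[of UNIV T G P])
    show "T (u + v) = T u + T v" for u v
      by (auto simp: T_def scaleC_add_right sum.distrib)
    show "T (c *\<^sub>C v) = c *\<^sub>C T v" for c v
      by (auto simp: T_def scaleC_fun_def complex_vector.scale_sum_right scaleC_scaleC mult.commute)
    show "G (u + v) = G u + G v" for u v
      unfolding G_def sum.distrib[symmetric] by (intro sum.cong) (auto simp: dual_add[OF g])
    show "G (c *\<^sub>C v) = c * G v" for c v
      unfolding G_def sum_distrib_left by (intro sum.cong) (auto simp: dual_scale[OF g] scaleC_fun_def)
    show "P (x + y) \<le> P x + P y" for x y
    proof -
      have "Max ((\<lambda>a. norm ((x + y) a)) ` A) \<le> Max ((\<lambda>a. norm (x a)) ` A) + Max ((\<lambda>a. norm (y a)) ` A)"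
        using A by (intro Max.boundedI) (auto intro!: order_trans[OF norm_triangle_ineq] add_mono Max_ge)
      from mult_left_mono[OF this, of "M / r"] M r show ?thesis
        unfolding P_def by (simp add: distrib_left)
    qed
    show "P (c *\<^sub>C x) = cmod c * P x" for c x
    proof -
      have "mono ((*) (cmod c))" by (rule monoI) (simp add: mult_left_mono)
      then have "Max ((*) (cmod c) ` (\<lambda>a. norm (x a)) ` A) = cmod c * Max ((\<lambda>a. norm (x a)) ` A)"
        using A by (intro mono_Max_commute[symmetric]) auto
      then show ?thesis by (simp add: P_def scaleC_fun_def norm_scaleC image_image)
    qed
    show "cmod (G y) \<le> P (T y)" for y
    proof -
      have "(\<lambda>a. norm (T y a)) ` A = (\<lambda>a. norm (\<Sum>i<n. a i *\<^sub>C y i)) ` A"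
        by (auto simp: T_def)
      then have "M / r * (r * weak_norm (conj_index p) whole n y) \<le> P (T y)"
        unfolding P_def using M r norming[of y] by (intro mult_left_mono) auto
      then show ?thesis using bound[of y] r by (simp add: G_def)
    qed
  qed auto
  have K: "0 \<le> M / r" using M r by simp
  obtain \<phi> :: "(nat \<Rightarrow> complex) \<Rightarrow> 'f \<Rightarrow> complex" where \<phi>: "\<And>a. \<phi> a \<in> points (dual whole)"
    and \<phi>_sum: "(\<Sum>a\<in>A. nrm (dual whole) (\<phi> a)) \<le> M / r"
    and H_eq: "\<And>w. (\<And>a. a \<notin> A \<Longrightarrow> w a = 0) \<Longrightarrow> H w = (\<Sum>a\<in>A. \<phi> a (w a))"
    by (rule functional_on_finite_family[OF A K H(1,2,3)[unfolded P_def]]) (rule that; simp)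
  have g_eq: "g i = (\<Sum>a\<in>A. a i *\<^sub>C \<phi> a)" if i: "i < n" for i
  proof
    fix v :: 'f
    define y where "y k = (if k = i then v else 0)" for k
    have "g k (y k) = (if k = i then g i v else 0)" if "k < n" for k
      using that dual_0[OF normed_space_whole g] by (simp add: y_def)
    then have "(\<Sum>k<n. g k (y k)) = (\<Sum>k<n. if k = i then g i v else 0)" by (intro sum.cong) auto
    then have "g i v = G y" using i by (simp add: G_def)
    also have "\<dots> = (\<Sum>a\<in>A. \<phi> a (T y a))" using H(4)[of y] H_eq[of "T y"] by (simp add: T_def)
    also have "\<dots> = (\<Sum>a\<in>A. a i * \<phi> a v)"
    proof (rule sum.cong)
      fix a assume "a \<in> A"
      have "a k *\<^sub>C y k = (if k = i then a i *\<^sub>C v else 0)" for k by (simp add: y_def)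
      with \<open>a \<in> A\<close> i have "T y a = a i *\<^sub>C v" by (simp add: T_def)
      then show "\<phi> a (T y a) = a i * \<phi> a v" by (simp add: dual_scale[OF \<phi>])
    qed simp
    also have "\<dots> = (\<Sum>a\<in>A. a i *\<^sub>C \<phi> a) v"
      using additive_sum[of "\<lambda>w. w v" "\<lambda>a. a i *\<^sub>C \<phi> a" A] by (simp add: scaleC_fun_def scaleC_complex_def)
    finally show "g i v = (\<Sum>a\<in>A. a i *\<^sub>C \<phi> a) v" .
  qed
  have "(\<Sum>i<n. z i (g i)) = (\<Sum>i<n. \<Sum>a\<in>A. a i * z i (\<phi> a))"
  proof (rule sum.cong)
    fix i assume "i \<in> {..<n}"
    then have i: "i < n" by simp
    show "z i (g i) = (\<Sum>a\<in>A. a i * z i (\<phi> a))"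
      unfolding g_eq[OF i] by (rule dual_sum[OF dF z[OF i] \<phi>])
  qed simp
  also have "\<dots> = (\<Sum>a\<in>A. \<Sum>i<n. a i * z i (\<phi> a))" by (rule sum.swap)
  finally have "cmod (\<Sum>i<n. z i (g i)) \<le> (\<Sum>a\<in>A. cmod (\<Sum>i<n. a i * z i (\<phi> a)))"
    using norm_sum by simp
  also have "\<dots> \<le> (\<Sum>a\<in>A. nrm (dual whole) (\<phi> a) * ?W)"
  proof (rule sum_mono)
    fix a assume a: "a \<in> A"
    have "lq_norm (conj_index p) n (\<lambda>i. cmod (z i (\<phi> a)))
        = lq_norm (conj_index p) n (\<lambda>i. cmod (bidual_eval (dual whole) (\<phi> a) (z i)))"
      using z by (intro lq_norm_cong) (simp add: bidual_eval_def)
    also have "\<dots> \<le> nrm (dual (dual (dual whole))) (bidual_eval (dual whole) (\<phi> a)) * ?W"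
      by (rule weak_norm_dual_bound[OF normed_space_dual[OF dF] q z bidual_eval_in[OF dF \<phi>]])
    also have "\<dots> \<le> nrm (dual whole) (\<phi> a) * ?W"
      by (intro mult_right_mono nrm_bidual_eval_le[OF dF \<phi>] weak_norm_nonneg[OF normed_space_dual[OF dF] q z])
    finally have W: "lq_norm (conj_index p) n (\<lambda>i. cmod (z i (\<phi> a))) \<le> nrm (dual whole) (\<phi> a) * ?W" .
    have "cmod (\<Sum>i<n. a i * z i (\<phi> a)) \<le> (\<Sum>i<n. cmod (a i) * cmod (z i (\<phi> a)))"
      by (intro order_trans[OF norm_sum]) (simp add: norm_mult)
    also have "\<dots> \<le> lq_norm p n (\<lambda>i. cmod (a i)) * lq_norm (conj_index p) n (\<lambda>i. cmod (z i (\<phi> a)))"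
      by (rule lq_norm_Holder[OF p]) auto
    also have "\<dots> \<le> 1 * (nrm (dual whole) (\<phi> a) * ?W)"
      by (intro mult_mono A1 a W lq_norm_nonneg) auto
    finally show "cmod (\<Sum>i<n. a i * z i (\<phi> a)) \<le> nrm (dual whole) (\<phi> a) * ?W" by simp
  qed
  also have "\<dots> = (\<Sum>a\<in>A. nrm (dual whole) (\<phi> a)) * ?W" by (simp add: sum_distrib_right)
  also have "\<dots> \<le> M / r * ?W"
    by (intro mult_right_mono \<phi>_sum weak_norm_nonneg[OF normed_space_dual[OF dF] q z])
  finally show "r * cmod (\<Sum>i<n. z i (g i)) \<le> M * ?W" using r by (simp add: field_simps)
qed

section \<open>Holomorphy of the evaluation map\<close>

lemma Cauchy_estimate_deriv:
  assumes g: "g holomorphic_on ball 0 R" and R: "0 < R" and B: "\<And>t. t \<in> ball 0 R \<Longrightarrow> cmod (g t) \<le> B"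
  shows "cmod (deriv g 0) \<le> 2 * B / R"
proof -
  have "cmod ((deriv ^^ 1) g 0) \<le> fact 1 * B / (R / 2) ^ 1"
  proof (rule Cauchy_inequality)
    show "g holomorphic_on ball 0 (R / 2)" by (rule holomorphic_on_subset[OF g]) (use R in auto)
    show "continuous_on (cball 0 (R / 2)) g"
      by (rule continuous_on_subset[OF holomorphic_on_imp_continuous_on[OF g]]) (use R in auto)
  qed (use R B in auto)
  then show ?thesis by (simp add: field_simps)
qed

text \<open>Taylor's formula of order one on the disc of radius \<open>R / 4\<close>, which contains \<open>1\<close>; there the second
derivative is at most \<open>2 B / (R / 4)\<^sup>2\<close> by the Cauchy estimate on discs of radius \<open>R / 4\<close>.\<close>

lemma Cauchy_estimate_remainder:
  assumes g: "g holomorphic_on ball 0 R" and R: "4 \<le> R" and B: "\<And>t. t \<in> ball 0 R \<Longrightarrow> cmod (g t) \<le> B"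
  shows "cmod (g 1 - g 0 - deriv g 0) \<le> 32 * B / R\<^sup>2"
proof -
  let ?S = "cball 0 (R / 4) :: complex set"
  have sub: "cball \<xi> (R / 4) \<subseteq> ball 0 R" if "\<xi> \<in> ?S" for \<xi>
  proof
    fix x assume "x \<in> cball \<xi> (R / 4)"
    then show "x \<in> ball 0 R" using that R norm_triangle_sub[of x \<xi>] by (simp add: dist_norm norm_minus_commute)
  qed
  have "cmod ((deriv ^^ 0) g 1 - (\<Sum>i\<le>1. (deriv ^^ i) g 0 * (1 - 0) ^ i / fact i))
      \<le> (32 * B / R\<^sup>2) * cmod (1 - 0) ^ Suc 1 / fact 1"
  proof (rule complex_Taylor[where S = ?S])
    fix i and x :: complex assume "x \<in> ?S" "i \<le> (1 :: nat)"
    then have "x \<in> ball 0 R" using R by auto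
    moreover have "(deriv ^^ i) g holomorphic_on ball 0 R" by (rule holomorphic_higher_deriv[OF g]) simp
    ultimately have "((deriv ^^ i) g has_field_derivative deriv ((deriv ^^ i) g) x) (at x)"
      by (intro holomorphic_derivI[of _ "ball 0 R"]) auto
    then show "((deriv ^^ i) g has_field_derivative (deriv ^^ Suc i) g x) (at x within ?S)"
      by (simp add: has_field_derivative_at_within)
  next
    fix x assume x: "x \<in> ?S"
    have "cmod ((deriv ^^ 2) g x) \<le> fact 2 * B / (R / 4) ^ 2"
    proof (rule Cauchy_inequality)
      show "g holomorphic_on ball x (R / 4)"
        by (rule holomorphic_on_subset[OF g]) (use sub[OF x] ball_subset_cball in blast)
      show "continuous_on (cball x (R / 4)) g"
        by (rule continuous_on_subset[OF holomorphic_on_imp_continuous_on[OF g] sub[OF x]])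
      show "cmod (g y) \<le> B" if "cmod (x - y) = R / 4" for y
        using sub[OF x] that by (intro B) (auto simp: dist_norm)
    qed (use R in auto)
    then show "cmod ((deriv ^^ Suc 1) g x) \<le> 32 * B / R\<^sup>2"
      by (simp add: numeral_2_eq_2 power2_eq_square)
  qed (use R in auto)
  then show ?thesis by (simp add: algebra_simps)
qed

lemma Hinf_nrm: "nrm (Hinf U) h = Sup (insert 0 ((\<lambda>x. cmod (h x)) ` U))"
  by (simp add: Hinf_def)

lemma Hinf_le:
  assumes "h \<in> points (Hinf U)" "x \<in> U"
  shows "cmod (h x) \<le> nrm (Hinf U) h"
  unfolding Hinf_nrm
proof (rule cSup_upper)
  obtain B where "\<forall>y\<in>h ` U. cmod y \<le> B"
    using assms(1) by (auto simp: Hinf_def bounded_iff)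
  then show "bdd_above (insert 0 ((\<lambda>x. cmod (h x)) ` U))" by (auto intro!: bdd_aboveI[where M = B])
qed (use assms in auto)

lemma Hinf_nrm_le:
  assumes "0 \<le> C" "\<And>x. x \<in> U \<Longrightarrow> cmod (h x) \<le> C"
  shows "nrm (Hinf U) h \<le> C"
  unfolding Hinf_nrm using assms by (intro cSup_least) auto

lemma Hinf_nonneg:
  assumes "h \<in> points (Hinf U)"
  shows "0 \<le> nrm (Hinf U) h"
proof (cases "U = {}")
  case True
  then show ?thesis by (simp add: Hinf_nrm)
next
  case False
  then obtain x where "x \<in> U" by blast
  from order_trans[OF norm_ge_zero Hinf_le[OF assms this]] show ?thesis .
qed

lemma Hinf_nrm_approx:
  assumes U: "U \<noteq> {}" and h: "h \<in> points (Hinf U)" and e: "0 < e"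
  shows "\<exists>x\<in>U. nrm (Hinf U) h \<le> cmod (h x) + e"
proof (rule ccontr)
  assume contr: "\<not> ?thesis"
  then have le: "cmod (h x) \<le> nrm (Hinf U) h - e" if "x \<in> U" for x using that by force
  moreover obtain x where "x \<in> U" using U by blast
  with le have "0 \<le> nrm (Hinf U) h - e" using order_trans[OF norm_ge_zero] by blast
  ultimately have "nrm (Hinf U) h \<le> nrm (Hinf U) h - e" by (rule Hinf_nrm_le[rotated])
  with e show False by simp
qed

text \<open>For scalar functions this is Frechet differentiability with a complex linear derivative, so the rules
for sums and compositions of \<open>has_derivative\<close> apply.\<close>

lemma holomorphic_into_whole_iff:
  "holomorphic_into U whole h \<longleftrightarrow>
    (\<forall>a\<in>U. \<exists>L. linear_between whole whole L \<and> (h has_derivative L) (at a within U))"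
    (is "?lhs \<longleftrightarrow> (\<forall>a\<in>U. \<exists>L. ?D a L)")
proof -
  have *: "(linear_between whole whole L \<and> (\<exists>K. \<forall>v. norm (L v) \<le> K * norm v) \<and>
      ((\<lambda>x. norm (h x - h a - L (x - a)) / norm (x - a)) \<longlongrightarrow> 0) (at a within U)) \<longleftrightarrow> ?D a L" for a L
  proof (cases "linear_between whole whole L")
    case L: True
    have scaleR: "L (r *\<^sub>R v) = r *\<^sub>R L v" for r v
      using linear_betweenD(3)[OF L] by (simp add: scaleR_scaleC)
    have "bounded_linear L \<longleftrightarrow> (\<exists>K. \<forall>v. norm (L v) \<le> K * norm v)"
    proof
      assume "bounded_linear L"
      then interpret bounded_linear L .
      show "\<exists>K. \<forall>v. norm (L v) \<le> K * norm v" using bounded by (auto simp: mult.commute)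
    next
      assume "\<exists>K. \<forall>v. norm (L v) \<le> K * norm v"
      then obtain K where "\<And>v. norm (L v) \<le> norm v * K" by (auto simp: mult.commute)
      then show "bounded_linear L"
        using linear_betweenD(2)[OF L] scaleR by (auto intro!: bounded_linear_intro[where K = K])
    qed
    moreover have "((\<lambda>x. (1 / norm (x - a)) *\<^sub>R (h x - (h a + L (x - a)))) \<longlongrightarrow> 0) (at a within U) \<longleftrightarrow>
      ((\<lambda>x. norm (h x - h a - L (x - a)) / norm (x - a)) \<longlongrightarrow> 0) (at a within U)"
      by (subst tendsto_norm_zero_iff[symmetric]) (simp add: diff_diff_add)
    ultimately show ?thesis using L by (simp add: has_derivative_within)
  qed simp
  show ?thesis unfolding holomorphic_into_def by (simp add: *)
qed

lemma normed_space_Hinf: "normed_space (Hinf U)"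
proof (rule normed_spaceI)
  have add: "f + g \<in> points (Hinf U)" if f: "f \<in> points (Hinf U)" and g: "g \<in> points (Hinf U)" for f g
  proof -
    have "holomorphic_into U whole (f + g)"
      unfolding holomorphic_into_whole_iff
    proof
      fix a assume "a \<in> U"
      then obtain L M where "linear_between whole whole L" "(f has_derivative L) (at a within U)"
        "linear_between whole whole M" "(g has_derivative M) (at a within U)"
        using f g unfolding Hinf_def holomorphic_into_whole_iff by auto metis
      then show "\<exists>L. linear_between whole whole L \<and> (f + g has_derivative L) (at a within U)"
        by (intro exI[of _ "\<lambda>x. L x + M x"])
          (auto simp: linear_between_def plus_fun_def scaleC_complex_def algebra_simps intro!: has_derivative_add)
    qed
    moreover have "bounded ((f + g) ` U)"
      using bounded_plus_comp[of f U g] f g by (simp add: Hinf_def plus_fun_def)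
    ultimately show ?thesis using f g by (simp add: Hinf_def)
  qed
  have scale: "c *\<^sub>C f \<in> points (Hinf U)" if f: "f \<in> points (Hinf U)" for c f
  proof -
    have eq: "c *\<^sub>C f = (\<lambda>x. c * f x)" by (simp add: scaleC_fun_def scaleC_complex_def)
    have "holomorphic_into U whole (c *\<^sub>C f)"
      unfolding holomorphic_into_whole_iff
    proof
      fix a assume "a \<in> U"
      then obtain L where "linear_between whole whole L" "(f has_derivative L) (at a within U)"
        using f unfolding Hinf_def holomorphic_into_whole_iff by auto
      then show "\<exists>L. linear_between whole whole L \<and> (c *\<^sub>C f has_derivative L) (at a within U)"
        by (intro exI[of _ "\<lambda>x. c * L x"])
          (auto simp: eq linear_between_def scaleC_complex_def algebra_simps intro!: has_derivative_mult_right)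
    qed
    moreover have "bounded ((\<lambda>x. c * f x) ` U)"
    proof -
      obtain B where "\<forall>x\<in>U. cmod (f x) \<le> B" using f by (auto simp: Hinf_def bounded_iff)
      then have "\<forall>x\<in>U. cmod (c * f x) \<le> cmod c * B" by (simp add: norm_mult mult_left_mono)
      then show ?thesis by (auto simp: bounded_iff)
    qed
    ultimately show ?thesis using f eq by (simp add: Hinf_def)
  qed
  have "(0 :: 'a \<Rightarrow> complex) \<in> points (Hinf U)"
  proof -
    have "((0 :: 'a \<Rightarrow> complex) has_derivative (\<lambda>_. 0)) (at a within U)" for a
      by (simp add: zero_fun_def)
    then have "holomorphic_into U whole (0 :: 'a \<Rightarrow> complex)"
      unfolding holomorphic_into_whole_iff by (intro ballI exI[of _ "\<lambda>_. 0"]) (auto simp: linear_between_def)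
    moreover have "bounded ((0 :: 'a \<Rightarrow> complex) ` U)" by (rule boundedI[where B = 0]) auto
    ultimately show ?thesis by (simp add: Hinf_def)
  qed
  with add scale show "complex_vector.subspace (points (Hinf U))"
    by (intro complex_vector.subspaceI) auto
  fix f assume f: "f \<in> points (Hinf U)"
  show "0 \<le> nrm (Hinf U) f" by (rule Hinf_nonneg[OF f])
  show "nrm (Hinf U) (c *\<^sub>C f) \<le> cmod c * nrm (Hinf U) f" for c
    using Hinf_le[OF f] Hinf_nonneg[OF f]
    by (intro Hinf_nrm_le) (auto simp: scaleC_fun_def scaleC_complex_def norm_mult mult_left_mono)
  show "nrm (Hinf U) (f + g) \<le> nrm (Hinf U) f + nrm (Hinf U) g" if "g \<in> points (Hinf U)" for g
    using Hinf_le[OF f] Hinf_nonneg[OF f] Hinf_le[OF that] Hinf_nonneg[OF that]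
    by (intro Hinf_nrm_le) (auto intro!: order_trans[OF norm_triangle_ineq] add_mono)
  show "f = 0" if "nrm (Hinf U) f = 0"
  proof
    fix x show "f x = 0 x" using Hinf_le[OF f, of x] that f by (cases "x \<in> U") (auto simp: Hinf_def)
  qed
qed

lemma eval_at_in: "eval_at U x \<in> points (dual (Hinf U))"
  and nrm_eval_at_le: "nrm (dual (Hinf U)) (eval_at U x) \<le> 1" if x: "x \<in> U"
proof -
  have le: "cmod (eval_at U x h) \<le> 1 * nrm (Hinf U) h" if "h \<in> points (Hinf U)" for h
    using Hinf_le[OF that x] that by (simp add: eval_at_def)
  show "eval_at U x \<in> points (dual (Hinf U))"
  proof (rule dualI[OF _ _ le])
    show "eval_at U x (c *\<^sub>C h) = c * eval_at U x h" if "h \<in> points (Hinf U)" for c h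
      using nspace_closed(4)[OF normed_space_Hinf that, of c] that unfolding eval_at_def
      by (simp add: scaleC_fun_def[of c h] scaleC_complex_def)
  qed (auto simp: eval_at_def nspace_closed[OF normed_space_Hinf])
  show "nrm (dual (Hinf U)) (eval_at U x) \<le> 1"
    by (rule dual_nrm_le[OF normed_space_Hinf _ le]) simp
qed

lemma nrm_Ginf [simp]: "nrm (Ginf U) = nrm (dual (Hinf U))"
  by (simp add: Ginf_def)

lemma Ginf_dual: "\<gamma> \<in> points (Ginf U) \<Longrightarrow> \<gamma> \<in> points (dual (Hinf U))"
  by (simp add: Ginf_def)

lemma Ginf_approx: "\<gamma> \<in> points (Ginf U) \<Longrightarrow> 0 < e \<Longrightarrow> \<exists>\<beta>\<in>Delta U. nrm (dual (Hinf U)) (\<gamma> - \<beta>) < e"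
  by (simp add: Ginf_def)

lemma subspace_Delta: "complex_vector.subspace (Delta U)"
  unfolding Delta_def by (rule complex_vector.subspace_span)

lemma Delta_Ginf: "Delta U \<subseteq> points (Ginf U)"
proof -
  note dH = normed_space_dual[OF normed_space_Hinf, of U]
  have "Delta U \<subseteq> points (dual (Hinf U))"
    unfolding Delta_def using eval_at_in nspace_subspace[OF dH] by (intro complex_vector.span_minimal) auto
  moreover have "\<exists>\<beta>\<in>Delta U. nrm (dual (Hinf U)) (\<gamma> - \<beta>) < e" if "\<gamma> \<in> Delta U" "0 < e" for \<gamma> e
    using that nspace_nrm_0[OF dH] by (intro bexI[of _ \<gamma>]) auto
  ultimately show ?thesis by (auto simp: Ginf_def)
qed

lemma eval_at_Ginf: "x \<in> U \<Longrightarrow> eval_at U x \<in> points (Ginf U)"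
  using Delta_Ginf complex_vector.span_base[of "eval_at U x" "eval_at U ` U"] by (auto simp: Delta_def)

lemma normed_space_Ginf: "normed_space (Ginf U)"
proof -
  note dH = normed_space_dual[OF normed_space_Hinf, of U]
  note dHc = nspace_closed[OF dH]
  note D = complex_vector.subspace_0[OF subspace_Delta] complex_vector.subspace_add[OF subspace_Delta]
    complex_vector.subspace_scale[OF subspace_Delta]
  have D_dual: "\<beta> \<in> points (dual (Hinf U))" if "\<beta> \<in> Delta U" for \<beta>
    using that Delta_Ginf Ginf_dual by blast
  have "complex_vector.subspace (points (Ginf U))"
  proof (rule complex_vector.subspaceI)
    show "0 \<in> points (Ginf U)" using D(1) Delta_Ginf by blast
  next
    fix \<gamma> \<gamma>' assume \<gamma>: "\<gamma> \<in> points (Ginf U)" and \<gamma>': "\<gamma>' \<in> points (Ginf U)"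
    have "\<exists>\<beta>\<in>Delta U. nrm (dual (Hinf U)) (\<gamma> + \<gamma>' - \<beta>) < e" if "0 < e" for e
    proof -
      obtain \<beta> \<beta>' where \<beta>: "\<beta> \<in> Delta U" "nrm (dual (Hinf U)) (\<gamma> - \<beta>) < e / 2"
        "\<beta>' \<in> Delta U" "nrm (dual (Hinf U)) (\<gamma>' - \<beta>') < e / 2"
        using Ginf_approx[OF \<gamma>, of "e / 2"] Ginf_approx[OF \<gamma>', of "e / 2"] \<open>0 < e\<close> by auto
      have "nrm (dual (Hinf U)) ((\<gamma> - \<beta>) + (\<gamma>' - \<beta>')) < e"
        using nspace_triangle[OF dH, of "\<gamma> - \<beta>" "\<gamma>' - \<beta>'"] \<beta> D_dual \<gamma> \<gamma>' Ginf_dual dHc(3) by fastforce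
      then show ?thesis using \<beta> D(2) by (intro bexI[of _ "\<beta> + \<beta>'"]) (auto simp: algebra_simps)
    qed
    then show "\<gamma> + \<gamma>' \<in> points (Ginf U)" using \<gamma> \<gamma>' dHc(2) by (simp add: Ginf_def)
  next
    fix c \<gamma> assume \<gamma>: "\<gamma> \<in> points (Ginf U)"
    have "\<exists>\<beta>\<in>Delta U. nrm (dual (Hinf U)) (c *\<^sub>C \<gamma> - \<beta>) < e" if "0 < e" for e
    proof -
      have "0 < e / (cmod c + 1)" using \<open>0 < e\<close> by (simp add: add_nonneg_pos)
      from Ginf_approx[OF \<gamma> this] obtain \<beta> where \<beta>: "\<beta> \<in> Delta U" "nrm (dual (Hinf U)) (\<gamma> - \<beta>) < e / (cmod c + 1)"
        by blast
      have in_d: "\<gamma> - \<beta> \<in> points (dual (Hinf U))" using \<beta> D_dual \<gamma> Ginf_dual dHc(3) by blast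
      have "nrm (dual (Hinf U)) (c *\<^sub>C (\<gamma> - \<beta>)) \<le> (cmod c + 1) * nrm (dual (Hinf U)) (\<gamma> - \<beta>)"
        using nspace_scale[OF dH in_d] nspace_nonneg[OF dH in_d] by (simp add: mult_right_mono)
      also have "\<dots> < e" using \<beta>(2) by (simp add: pos_less_divide_eq add_nonneg_pos mult.commute)
      finally show ?thesis
        using \<beta> D(3) by (intro bexI[of _ "c *\<^sub>C \<beta>"]) (auto simp: complex_vector.scale_right_diff_distrib)
    qed
    then show "c *\<^sub>C \<gamma> \<in> points (Ginf U)" using \<gamma> dHc(4) by (simp add: Ginf_def)
  qed
  then show ?thesis
  proof (rule normed_spaceI)
    fix \<gamma> assume "\<gamma> \<in> points (Ginf U)"
    then have \<gamma>: "\<gamma> \<in> points (dual (Hinf U))" by (rule Ginf_dual)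
    show "0 \<le> nrm (Ginf U) \<gamma>" by (simp add: nspace_nonneg[OF dH \<gamma>])
    show "\<gamma> = 0" if "nrm (Ginf U) \<gamma> = 0" using that by (simp add: nspace_eq_0[OF dH \<gamma>])
    show "nrm (Ginf U) (\<gamma> + \<gamma>') \<le> nrm (Ginf U) \<gamma> + nrm (Ginf U) \<gamma>'" if "\<gamma>' \<in> points (Ginf U)" for \<gamma>'
      using nspace_triangle[OF dH \<gamma> Ginf_dual[OF that]] by simp
    show "nrm (Ginf U) (c *\<^sub>C \<gamma>) \<le> cmod c * nrm (Ginf U) \<gamma>" for c
      using nspace_scale[OF dH \<gamma>] by simp
  qed
qed

lemma Ginf_closed:
  assumes \<gamma>: "\<gamma> \<in> points (dual (Hinf U))"
    and approx: "\<And>e. 0 < e \<Longrightarrow> \<exists>\<beta>\<in>points (Ginf U). nrm (dual (Hinf U)) (\<gamma> - \<beta>) < e"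
  shows "\<gamma> \<in> points (Ginf U)"
proof -
  note dH = normed_space_dual[OF normed_space_Hinf, of U]
  have "\<exists>\<beta>\<in>Delta U. nrm (dual (Hinf U)) (\<gamma> - \<beta>) < e" if "0 < e" for e
  proof -
    obtain \<alpha> where \<alpha>: "\<alpha> \<in> points (Ginf U)" "nrm (dual (Hinf U)) (\<gamma> - \<alpha>) < e / 2"
      using approx[of "e / 2"] \<open>0 < e\<close> by auto
    obtain \<beta> where \<beta>: "\<beta> \<in> Delta U" "nrm (dual (Hinf U)) (\<alpha> - \<beta>) < e / 2"
      using Ginf_approx[OF \<alpha>(1), of "e / 2"] \<open>0 < e\<close> by auto
    have "nrm (dual (Hinf U)) ((\<gamma> - \<alpha>) + (\<alpha> - \<beta>)) < e"
      using nspace_triangle[OF dH, of "\<gamma> - \<alpha>" "\<alpha> - \<beta>"] \<alpha> \<beta> \<gamma> Delta_Ginf Ginf_dual nspace_closed(3)[OF dH]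
      by fastforce
    with \<beta> show ?thesis by (intro bexI[of _ \<beta>]) (auto simp: algebra_simps)
  qed
  with \<gamma> show ?thesis by (simp add: Ginf_def)
qed

text \<open>The derivative of \<open>x \<mapsto> \<delta>(x)\<close> at \<open>a\<close> in direction \<open>v\<close>. It is taken along a complex line, so that no
Frechet derivative has to be chosen for each \<open>h\<close>.\<close>

definition eval_deriv :: "'e::complex_normed_vector set \<Rightarrow> 'e \<Rightarrow> 'e \<Rightarrow> ('e \<Rightarrow> complex) \<Rightarrow> complex" where
  "eval_deriv U a v = (\<lambda>h. if h \<in> points (Hinf U) then deriv (\<lambda>t. h (a + t *\<^sub>C v)) 0 else 0)"

lemma has_derivative_line: "((\<lambda>t. a + t *\<^sub>C v) has_derivative (\<lambda>t. t *\<^sub>C (v :: 'e::complex_normed_vector))) F"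
proof -
  have "bounded_linear (\<lambda>t. t *\<^sub>C v)"
    by (rule bounded_linear_intro[where K = "norm v"])
      (auto simp: scaleC_add_left scaleR_scaleC scaleC_scaleC norm_scaleC scaleC_complex_def)
  then have "((\<lambda>t. t *\<^sub>C v) has_derivative (\<lambda>t. t *\<^sub>C v)) F" by (rule bounded_linear_imp_has_derivative)
  from has_derivative_add[OF has_derivative_const this] show ?thesis by simp
qed

context
  fixes U :: "'e::complex_normed_vector set"
  assumes U: "open U"
begin

lemma Hinf_has_derivative:
  assumes h: "h \<in> points (Hinf U)" and a: "a \<in> U"
  obtains L where "linear_between whole whole L" "(h has_derivative L) (at a)"
  using h a at_within_open[OF a U] unfolding Hinf_def holomorphic_into_whole_iff by fastforce

lemma Hinf_line_derivative:
  assumes L: "linear_between whole whole L" "(h has_derivative L) (at (a + t *\<^sub>C v))"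
  shows "((\<lambda>t. h (a + t *\<^sub>C v)) has_field_derivative L v) (at t)"
proof -
  have "((\<lambda>t. h (a + t *\<^sub>C v)) has_derivative (\<lambda>s. L (s *\<^sub>C v))) (at t)"
    by (rule has_derivative_compose[OF has_derivative_line L(2)])
  moreover have "(\<lambda>s. L (s *\<^sub>C v)) = (*) (L v)"
    using linear_betweenD(3)[OF L(1)] by (auto simp: scaleC_complex_def mult.commute)
  ultimately show ?thesis by (simp add: has_field_derivative_def)
qed

lemma eval_deriv_eq:
  assumes h: "h \<in> points (Hinf U)" and L: "linear_between whole whole L" "(h has_derivative L) (at a)"
  shows "eval_deriv U a v h = L v"
  using Hinf_line_derivative[OF L(1), of h a 0 v] L(2) h by (auto simp: eval_deriv_def intro: DERIV_imp_deriv)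

lemma
  assumes a: "a \<in> U"
  shows eval_deriv_add: "eval_deriv U a (v + w) = eval_deriv U a v + eval_deriv U a w"
    and eval_deriv_scale: "eval_deriv U a (c *\<^sub>C v) = c *\<^sub>C eval_deriv U a v"
proof -
  have "eval_deriv U a (v + w) h = eval_deriv U a v h + eval_deriv U a w h \<and>
    eval_deriv U a (c *\<^sub>C v) h = c * eval_deriv U a v h" for h
  proof (cases "h \<in> points (Hinf U)")
    case True
    from Hinf_has_derivative[OF this a] obtain L where L: "linear_between whole whole L" "(h has_derivative L) (at a)" .
    then show ?thesis using linear_betweenD[OF L(1)] by (simp add: eval_deriv_eq[OF True L] scaleC_complex_def)
  qed (simp add: eval_deriv_def)
  then show "eval_deriv U a (v + w) = eval_deriv U a v + eval_deriv U a w"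
    "eval_deriv U a (c *\<^sub>C v) = c *\<^sub>C eval_deriv U a v"
    by (auto simp: scaleC_fun_def scaleC_complex_def)
qed

context
  fixes a :: 'e and r :: real
  assumes r: "0 < r" and ball: "ball a r \<subseteq> U"
begin

lemma line_in_U:
  assumes "cmod t * norm v < r"
  shows "a + t *\<^sub>C v \<in> U"
  using assms ball by (auto simp: subset_iff dist_norm norm_scaleC)

text \<open>For \<open>v \<noteq> 0\<close> the domain is the disc of radius \<open>r / \<parallel>v\<parallel>\<close>, the part of the complex line through \<open>a\<close> in
direction \<open>v\<close> that lies in the ball. The estimates below apply the one-variable Cauchy estimates there.\<close>

lemma Hinf_line_holomorphic:
  assumes h: "h \<in> points (Hinf U)"
  shows "(\<lambda>t. h (a + t *\<^sub>C v)) holomorphic_on {t. cmod t * norm v < r}"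
proof (rule holomorphic_onI)
  fix t assume "t \<in> {t. cmod t * norm v < r}"
  then have "a + t *\<^sub>C v \<in> U" by (simp add: line_in_U)
  from Hinf_has_derivative[OF h this] obtain L where "linear_between whole whole L"
    "(h has_derivative L) (at (a + t *\<^sub>C v))" .
  from Hinf_line_derivative[OF this]
  show "(\<lambda>t. h (a + t *\<^sub>C v)) field_differentiable at t within {t. cmod t * norm v < r}"
    using field_differentiable_def field_differentiable_at_within by blast
qed

lemma eval_deriv_in: "eval_deriv U a v \<in> points (dual (Hinf U))"
  and nrm_eval_deriv_le: "nrm (dual (Hinf U)) (eval_deriv U a v) \<le> 2 / r * norm v"
proof -
  have a: "a \<in> U" using ball r by auto
  have le: "cmod (eval_deriv U a v h) \<le> (2 / r * norm v) * nrm (Hinf U) h" if h: "h \<in> points (Hinf U)" for h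
  proof (cases "v = 0")
    case True
    then show ?thesis using h by (simp add: eval_deriv_def)
  next
    case False
    have eq: "{t. cmod t * norm v < r} = ball 0 (r / norm v)" using False by (auto simp: field_simps)
    have "cmod (deriv (\<lambda>t. h (a + t *\<^sub>C v)) 0) \<le> 2 * nrm (Hinf U) h / (r / norm v)"
    proof (rule Cauchy_estimate_deriv)
      show "(\<lambda>t. h (a + t *\<^sub>C v)) holomorphic_on ball 0 (r / norm v)"
        using Hinf_line_holomorphic[OF h, of v] eq by simp
      show "cmod (h (a + t *\<^sub>C v)) \<le> nrm (Hinf U) h" if "t \<in> ball 0 (r / norm v)" for t
        using that unfolding eq[symmetric] by (intro Hinf_le[OF h] line_in_U) simp
    qed (use r False in auto)
    then show ?thesis using h by (simp add: eval_deriv_def mult_ac)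
  qed
  show "eval_deriv U a v \<in> points (dual (Hinf U))"
  proof (rule dualI[OF _ _ le])
    fix f g assume f: "f \<in> points (Hinf U)" and g: "g \<in> points (Hinf U)"
    obtain L M where "linear_between whole whole L" "(f has_derivative L) (at a)"
      "linear_between whole whole M" "(g has_derivative M) (at a)"
      using Hinf_has_derivative[OF f a] Hinf_has_derivative[OF g a] by metis
    note LM = this
    have "linear_between whole whole (\<lambda>x. L x + M x)" "((f + g) has_derivative (\<lambda>x. L x + M x)) (at a)"
      using LM by (auto simp: linear_between_def plus_fun_def scaleC_complex_def algebra_simps intro!: has_derivative_add)
    from eval_deriv_eq[OF nspace_closed(2)[OF normed_space_Hinf f g] this]
    show "eval_deriv U a v (f + g) = eval_deriv U a v f + eval_deriv U a v g"
      by (simp add: eval_deriv_eq[OF f LM(1,2)] eval_deriv_eq[OF g LM(3,4)])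
  next
    fix c f assume f: "f \<in> points (Hinf U)"
    obtain L where L: "linear_between whole whole L" "(f has_derivative L) (at a)"
      using Hinf_has_derivative[OF f a] by metis
    have "linear_between whole whole (\<lambda>x. c * L x)" "((c *\<^sub>C f) has_derivative (\<lambda>x. c * L x)) (at a)"
      using L by (auto simp: linear_between_def scaleC_fun_def scaleC_complex_def algebra_simps intro!: has_derivative_mult_right)
    from eval_deriv_eq[OF nspace_closed(4)[OF normed_space_Hinf f] this]
    show "eval_deriv U a v (c *\<^sub>C f) = c * eval_deriv U a v f"
      by (simp add: eval_deriv_eq[OF f L])
  qed (simp_all add: eval_deriv_def)
  show "nrm (dual (Hinf U)) (eval_deriv U a v) \<le> 2 / r * norm v"
    using r by (intro dual_nrm_le[OF normed_space_Hinf _ le]) simp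
qed

lemma nrm_eval_remainder_le:
  assumes v: "norm v \<le> r / 4"
  shows "nrm (dual (Hinf U)) (eval_at U (a + v) - eval_at U a - eval_deriv U a v) \<le> 32 / r\<^sup>2 * (norm v)\<^sup>2"
proof (rule dual_nrm_le[OF normed_space_Hinf])
  fix h assume h: "h \<in> points (Hinf U)"
  show "cmod ((eval_at U (a + v) - eval_at U a - eval_deriv U a v) h) \<le> 32 / r\<^sup>2 * (norm v)\<^sup>2 * nrm (Hinf U) h"
  proof (cases "v = 0")
    case True
    then show ?thesis using h by (simp add: eval_deriv_def)
  next
    case False
    let ?g = "\<lambda>t. h (a + t *\<^sub>C v)"
    have eq: "{t. cmod t * norm v < r} = ball 0 (r / norm v)" using False by (auto simp: field_simps)
    have "cmod (?g 1 - ?g 0 - deriv ?g 0) \<le> 32 * nrm (Hinf U) h / (r / norm v)\<^sup>2"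
    proof (rule Cauchy_estimate_remainder)
      show "?g holomorphic_on ball 0 (r / norm v)"
        using Hinf_line_holomorphic[OF h, of v] eq by simp
      show "cmod (?g t) \<le> nrm (Hinf U) h" if "t \<in> ball 0 (r / norm v)" for t
        using that unfolding eq[symmetric] by (intro Hinf_le[OF h] line_in_U) simp
      show "4 \<le> r / norm v" using v False by (simp add: field_simps)
    qed
    then show ?thesis using h by (simp add: eval_deriv_def eval_at_def scaleC_one power_divide mult_ac)
  qed
qed simp

text \<open>\<open>m (\<delta>(a + v/m) - \<delta>(a))\<close> differs from the derivative by \<open>m\<close> times a remainder of order \<open>\<parallel>v/m\<parallel>\<^sup>2\<close>, hence
converges to it in norm.\<close>

lemma eval_deriv_Ginf: "eval_deriv U a v \<in> points (Ginf U)"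
proof (rule Ginf_closed[OF eval_deriv_in])
  fix e :: real assume e: "0 < e"
  note dH = normed_space_dual[OF normed_space_Hinf, of U]
  have a: "a \<in> U" using ball r by auto
  let ?K = "32 / r\<^sup>2 * (norm v)\<^sup>2"
  obtain m :: nat where m: "max (4 * norm v / r) (?K / e) < real m" using reals_Archimedean2 by blast
  then have m1: "4 * norm v / r < real m" and m2: "?K / e < real m" by simp_all
  have "0 \<le> 4 * norm v / r" using r by simp
  then have m0: "0 < real m" using m1 by (rule le_less_trans)
  let ?c = "complex_of_real (1 / real m)"
  let ?R = "eval_at U (a + ?c *\<^sub>C v) - eval_at U a - eval_deriv U a (?c *\<^sub>C v)"
  let ?\<beta> = "of_nat m *\<^sub>C (eval_at U (a + ?c *\<^sub>C v) - eval_at U a)"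
  have small: "norm (?c *\<^sub>C v) \<le> r / 4"
    using m1 m0 r by (simp add: norm_scaleC norm_divide field_simps)
  then have av: "a + ?c *\<^sub>C v \<in> U" using r by (intro line_in_U) (simp add: norm_scaleC)
  have \<beta>: "?\<beta> \<in> points (Ginf U)"
    using eval_at_Ginf[OF av] eval_at_Ginf[OF a] nspace_closed[OF normed_space_Ginf] by blast
  have R: "?R \<in> points (dual (Hinf U))"
    using eval_at_in[OF av] eval_at_in[OF a] eval_deriv_in nspace_closed(3)[OF dH] by blast
  have "eval_deriv U a v - ?\<beta> = (- of_nat m) *\<^sub>C ?R"
    using m0 by (simp add: eval_deriv_scale[OF a] scaleC_scaleC scaleC_one complex_vector.scale_right_diff_distrib
        complex_vector.scale_minus_left)
  then have "nrm (dual (Hinf U)) (eval_deriv U a v - ?\<beta>) = real m * nrm (dual (Hinf U)) ?R"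
    by (simp only: nspace_scale[OF dH R] norm_minus_cancel norm_of_nat)
  also have "\<dots> \<le> real m * (32 / r\<^sup>2 * (norm (?c *\<^sub>C v))\<^sup>2)"
    by (intro mult_left_mono nrm_eval_remainder_le small) simp
  also have "\<dots> = ?K / real m"
    using m0 by (simp add: norm_scaleC norm_divide power2_eq_square field_simps)
  also have "\<dots> < e" using m2 m0 e by (simp only: pos_divide_less_eq mult.commute[of e])
  finally show "\<exists>\<beta>\<in>points (Ginf U). nrm (dual (Hinf U)) (eval_deriv U a v - \<beta>) < e"
    using \<beta> by blast
qed

end

end

section \<open>The Chevet--Saphar norm\<close>

lemma tensor_add_left:
  "x \<in> points X \<Longrightarrow> x' \<in> points X \<Longrightarrow> y \<in> points Y \<Longrightarrow> tensor X Y (x + x') y = tensor X Y x y + tensor X Y x' y"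
  and tensor_add_right:
  "x \<in> points X \<Longrightarrow> y \<in> points Y \<Longrightarrow> y' \<in> points Y \<Longrightarrow> tensor X Y x (y + y') = tensor X Y x y + tensor X Y x y'"
  and tensor_scale_left:
  "x \<in> points X \<Longrightarrow> y \<in> points Y \<Longrightarrow> tensor X Y (c *\<^sub>C x) y = c *\<^sub>C tensor X Y x y"
  and tensor_scale_right:
  "x \<in> points X \<Longrightarrow> y \<in> points Y \<Longrightarrow> tensor X Y x (c *\<^sub>C y) = c *\<^sub>C tensor X Y x y"
  by (auto simp: tensor_def bilinear_form_def linear_between_def scaleC_fun_def scaleC_complex_def fun_eq_iff)

lemma chevet_saphar_simps:
  "points (chevet_saphar_tensor p X Y) = complex_vector.span {tensor X Y x y | x y. x \<in> points X \<and> y \<in> points Y}"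
  "nrm (chevet_saphar_tensor p X Y) = chevet_saphar_norm p X Y"
  by (simp_all add: chevet_saphar_tensor_def)

lemma subspace_chevet_saphar: "complex_vector.subspace (points (chevet_saphar_tensor p X Y))"
  unfolding chevet_saphar_simps by (rule complex_vector.subspace_span)

lemma tensor_in: "x \<in> points X \<Longrightarrow> y \<in> points Y \<Longrightarrow> tensor X Y x y \<in> points (chevet_saphar_tensor p X Y)"
  unfolding chevet_saphar_simps by (rule complex_vector.span_base) blast

text \<open>Scalars are absorbed into the left factor.\<close>

lemma tensor_representation:
  fixes X :: "'a::complex_vector nspace" and Y :: "'b::complex_vector nspace"
  assumes X: "complex_vector.subspace (points X)" and u: "u \<in> points (chevet_saphar_tensor p X Y)"
  obtains n :: nat and x y where "\<And>i. i < n \<Longrightarrow> x i \<in> points X \<and> y i \<in> points Y"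
    "u = (\<Sum>i<n. tensor X Y (x i) (y i))"
proof -
  let ?P = "\<lambda>u. \<exists>(n :: nat) (x :: nat \<Rightarrow> 'a) (y :: nat \<Rightarrow> 'b). (\<forall>i<n. x i \<in> points X \<and> y i \<in> points Y) \<and> u = (\<Sum>i<n. tensor X Y (x i) (y i))"
  have "?P u"
    using u unfolding chevet_saphar_simps
  proof (induction rule: complex_vector.span_induct_alt)
    case base
    show ?case by (intro exI[of _ 0]) auto
  next
    case (step c t u)
    then obtain a b where t: "t = tensor X Y a b" "a \<in> points X" "b \<in> points Y" by blast
    from step obtain n :: nat and x :: "nat \<Rightarrow> 'a" and y :: "nat \<Rightarrow> 'b" where u: "\<forall>i<n. x i \<in> points X \<and> y i \<in> points Y"
      "u = (\<Sum>i<n. tensor X Y (x i) (y i))" by blast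
    have "(\<forall>i<Suc n. (x(n := c *\<^sub>C a)) i \<in> points X \<and> (y(n := b)) i \<in> points Y) \<and>
      c *\<^sub>C t + u = (\<Sum>i<Suc n. tensor X Y ((x(n := c *\<^sub>C a)) i) ((y(n := b)) i))"
      using t u by (auto simp: less_Suc_eq tensor_scale_left complex_vector.subspace_scale[OF X])
    then show ?case by blast
  qed
  then show ?thesis using that by blast
qed

lemma chevet_saphar_norm_le:
  assumes p: "1 \<le> p" and Y: "normed_space Y"
    and xy: "\<And>i. i < n \<Longrightarrow> x i \<in> points X \<and> y i \<in> points Y" and u: "u = (\<Sum>i<n. tensor X Y (x i) (y i))"
  shows "chevet_saphar_norm p X Y u \<le> strong_norm p X n x * weak_norm (conj_index p) Y n y"
  unfolding chevet_saphar_norm_def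
proof (rule cInf_lower)
  show "bdd_below {strong_norm p X n x * weak_norm (conj_index p) Y n y | n x y.
    (\<forall>i<n. x i \<in> points X \<and> y i \<in> points Y) \<and> u = (\<Sum>i<n. tensor X Y (x i) (y i))}"
    by (intro bdd_belowI[where m = 0])
      (auto simp: strong_norm_def intro!: mult_nonneg_nonneg lq_norm_nonneg weak_norm_nonneg[OF Y conj_index_ge_1[OF p]])
qed (use xy u in blast)

lemma chevet_saphar_norm_ge:
  assumes X: "complex_vector.subspace (points X)" and u: "u \<in> points (chevet_saphar_tensor p X Y)"
    and le: "\<And>n x y. (\<And>i. i < n \<Longrightarrow> x i \<in> points X \<and> y i \<in> points Y) \<Longrightarrow> u = (\<Sum>i<n. tensor X Y (x i) (y i)) \<Longrightarrow>
      c \<le> strong_norm p X n x * weak_norm (conj_index p) Y n y"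
  shows "c \<le> chevet_saphar_norm p X Y u"
  unfolding chevet_saphar_norm_def
proof (rule cInf_greatest)
  show "{strong_norm p X n x * weak_norm (conj_index p) Y n y | n x y.
    (\<forall>i<n. x i \<in> points X \<and> y i \<in> points Y) \<and> u = (\<Sum>i<n. tensor X Y (x i) (y i))} \<noteq> {}"
    using tensor_representation[OF X u] by (smt (verit) empty_Collect_eq)
qed (use le in blast)

lemma chevet_saphar_norm_tensor_le:
  assumes p: "1 \<le> p" and X: "normed_space X" and Y: "normed_space Y" and x: "x \<in> points X" and y: "y \<in> points Y"
  shows "chevet_saphar_norm p X Y (tensor X Y x y) \<le> nrm X x * nrm Y y"
proof -
  have "chevet_saphar_norm p X Y (tensor X Y x y)
      \<le> strong_norm p X (Suc 0) (\<lambda>_. x) * weak_norm (conj_index p) Y (Suc 0) (\<lambda>_. y)"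
    using x y by (intro chevet_saphar_norm_le[OF p Y]) auto
  also have "\<dots> \<le> nrm X x * nrm Y y"
    using lq_norm_single[OF p, of "\<lambda>_. nrm X x"] nspace_nonneg[OF X x]
      weak_norm_single_le[OF Y conj_index_ge_1[OF p], of "\<lambda>_. y"] y
    by (simp add: strong_norm_def mult_left_mono)
  finally show ?thesis .
qed

section \<open>Functionals on the completed tensor product\<close>

text \<open>The map \<open>\<Lambda>\<^sup>-\<^sup>1\<close>: the vector-valued function on \<open>U\<close> with \<open>f x y = \<phi> (\<delta>(x) \<otimes> y)\<close>, extended by zero.\<close>

definition kernel_map ::
    "'e::complex_normed_vector set \<Rightarrow> ((((('e \<Rightarrow> complex) \<Rightarrow> complex) \<Rightarrow> 'f::complex_normed_vector \<Rightarrow> complex) \<Rightarrow> complex) \<Rightarrow> 'z)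
      \<Rightarrow> ('z \<Rightarrow> complex) \<Rightarrow> 'e \<Rightarrow> 'f \<Rightarrow> complex" where
  "kernel_map U j \<phi> x = (if x \<in> U then \<lambda>y. \<phi> (j (tensor (Ginf U) whole (eval_at U x) y)) else 0)"

lemma kernel_map_linear:
  "kernel_map U j (\<phi> + \<psi>) = kernel_map U j \<phi> + kernel_map U j \<psi>"
  "kernel_map U j (c *\<^sub>C \<phi>) = c *\<^sub>C kernel_map U j \<phi>"
  by (auto simp: kernel_map_def fun_eq_iff scaleC_fun_def scaleC_complex_def)

context
  fixes U :: "'e::complex_normed_vector set" and p :: ereal and Z :: "'z::complex_vector nspace"
    and j :: "(((('e \<Rightarrow> complex) \<Rightarrow> complex) \<Rightarrow> 'f::complex_normed_vector \<Rightarrow> complex) \<Rightarrow> complex) \<Rightarrow> 'z"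
  assumes U: "open U" and p: "1 \<le> p"
    and Zj: "is_completion (chevet_saphar_tensor p (Ginf U) (whole :: 'f nspace)) Z j"
begin

abbreviation (input) "tens \<equiv> tensor (Ginf U) (whole :: 'f nspace)"
abbreviation (input) "GF \<equiv> chevet_saphar_tensor p (Ginf U) (whole :: 'f nspace)"

lemma completion_normed: "normed_space Z"
  and completion_linear: "linear_between GF Z j"
  and completion_nrm: "u \<in> points GF \<Longrightarrow> nrm Z (j u) = chevet_saphar_norm p (Ginf U) whole u"
  and completion_dense: "z \<in> points Z \<Longrightarrow> 0 < e \<Longrightarrow> \<exists>u\<in>points GF. nrm Z (z - j u) < e"
  using Zj by (simp_all add: is_completion_def chevet_saphar_simps)

lemma completion_dual_comp:
  assumes \<phi>: "\<phi> \<in> points (dual Z)"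
  shows "linear_between GF whole (\<lambda>u. \<phi> (j u))"
  using completion_linear \<phi> unfolding linear_between_def
  by (auto simp: dual_add dual_scale scaleC_complex_def image_subset_iff)

text \<open>On \<open>U\<close> the map \<open>kernel_map U j \<phi>\<close> is the composition of \<open>\<delta>\<close> with the bounded linear operator
\<open>\<gamma> \<mapsto> \<phi> (\<gamma> \<otimes> \<cdot>)\<close> from \<open>\<G>\<^sup>\<infinity>(U)\<close> to \<open>F\<^sup>*\<close> studied here.\<close>

lemma tensor_slice:
  assumes \<phi>: "\<phi> \<in> points (dual Z)"
  shows tensor_slice_in: "\<gamma> \<in> points (Ginf U) \<Longrightarrow> (\<lambda>y. \<phi> (j (tens \<gamma> y))) \<in> points (dual whole)"
    and tensor_slice_bound: "\<gamma> \<in> points (Ginf U) \<Longrightarrow> cmod (\<phi> (j (tens \<gamma> y))) \<le> nrm (dual Z) \<phi> * nrm (Ginf U) \<gamma> * norm y"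
    and tensor_slice_nrm_le: "\<gamma> \<in> points (Ginf U) \<Longrightarrow> nrm (dual whole) (\<lambda>y. \<phi> (j (tens \<gamma> y))) \<le> nrm (dual Z) \<phi> * nrm (Ginf U) \<gamma>"
    and tensor_slice_linear: "linear_between (Ginf U) (dual whole) (\<lambda>\<gamma> y. \<phi> (j (tens \<gamma> y)))"
proof -
  note lin = completion_dual_comp[OF \<phi>]
  have t: "tens \<gamma> y \<in> points GF" if "\<gamma> \<in> points (Ginf U)" for \<gamma> y
    using that by (intro tensor_in) auto
  have bound: "cmod (\<phi> (j (tens \<gamma> y))) \<le> nrm (dual Z) \<phi> * nrm (Ginf U) \<gamma> * nrm whole y"
    if "\<gamma> \<in> points (Ginf U)" for \<gamma> y
  proof -
    have "cmod (\<phi> (j (tens \<gamma> y))) \<le> nrm (dual Z) \<phi> * nrm Z (j (tens \<gamma> y))"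
      by (rule dual_bound[OF completion_normed \<phi> linear_betweenD(1)[OF completion_linear t[OF that]]])
    also have "\<dots> \<le> nrm (dual Z) \<phi> * (nrm (Ginf U) \<gamma> * nrm whole y)"
      unfolding completion_nrm[OF t[OF that]]
      by (intro mult_left_mono chevet_saphar_norm_tensor_le p normed_space_Ginf normed_space_whole that
          dual_nrm_nonneg[OF completion_normed \<phi>]) simp
    finally show ?thesis by simp
  qed
  show in_dual: "(\<lambda>y. \<phi> (j (tens \<gamma> y))) \<in> points (dual whole)" if "\<gamma> \<in> points (Ginf U)" for \<gamma>
  proof (rule dualI[OF _ _ bound[OF that]])
    show "\<phi> (j (tens \<gamma> (x + y))) = \<phi> (j (tens \<gamma> x)) + \<phi> (j (tens \<gamma> y))" for x y
      using linear_betweenD(2)[OF lin t[OF that] t[OF that]] that by (simp add: tensor_add_right)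
    show "\<phi> (j (tens \<gamma> (c *\<^sub>C y))) = c * \<phi> (j (tens \<gamma> y))" for c y
      using linear_betweenD(3)[OF lin t[OF that]] that by (simp add: tensor_scale_right scaleC_complex_def)
  qed simp
  show "cmod (\<phi> (j (tens \<gamma> y))) \<le> nrm (dual Z) \<phi> * nrm (Ginf U) \<gamma> * norm y" if "\<gamma> \<in> points (Ginf U)"
    using bound[OF that] by simp
  show "nrm (dual whole) (\<lambda>y. \<phi> (j (tens \<gamma> y))) \<le> nrm (dual Z) \<phi> * nrm (Ginf U) \<gamma>" if "\<gamma> \<in> points (Ginf U)"
    by (rule dual_nrm_le[OF normed_space_whole _ bound[OF that]])
      (intro mult_nonneg_nonneg dual_nrm_nonneg[OF completion_normed \<phi>] nspace_nonneg[OF normed_space_Ginf that])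
  have add: "\<phi> (j (tens (\<gamma> + \<gamma>') y)) = \<phi> (j (tens \<gamma> y)) + \<phi> (j (tens \<gamma>' y))"
    if "\<gamma> \<in> points (Ginf U)" "\<gamma>' \<in> points (Ginf U)" for \<gamma> \<gamma>' y
    using linear_betweenD(2)[OF lin t t] that by (simp add: tensor_add_left)
  have scale: "\<phi> (j (tens (c *\<^sub>C \<gamma>) y)) = c * \<phi> (j (tens \<gamma> y))" if "\<gamma> \<in> points (Ginf U)" for \<gamma> c y
    using linear_betweenD(3)[OF lin t] that by (simp add: tensor_scale_left scaleC_complex_def)
  show "linear_between (Ginf U) (dual whole) (\<lambda>\<gamma> y. \<phi> (j (tens \<gamma> y)))"
    unfolding linear_between_def
  proof (intro conjI ballI allI)
    show "(\<lambda>\<gamma> y. \<phi> (j (tens \<gamma> y))) ` points (Ginf U) \<subseteq> points (dual whole)" using in_dual by blast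
    show "(\<lambda>y. \<phi> (j (tens (c *\<^sub>C \<gamma>) y))) = c *\<^sub>C (\<lambda>y. \<phi> (j (tens \<gamma> y)))" if "\<gamma> \<in> points (Ginf U)" for c \<gamma>
      unfolding scale[OF that] by (simp add: scaleC_fun_def scaleC_complex_def)
  qed (auto simp: add)
qed

text \<open>The derivative at \<open>a\<close> is the image of the derivative of \<open>\<delta>\<close> under the operator \<open>\<gamma> \<mapsto> \<phi> (\<gamma> \<otimes> \<cdot>)\<close>, and the
quadratic estimate for the remainder of \<open>\<delta>\<close> is inherited up to the factor \<open>\<parallel>\<phi>\<parallel>\<close>.\<close>

lemma kernel_map_holomorphic:
  assumes \<phi>: "\<phi> \<in> points (dual Z)"
  shows "holomorphic_into U (dual whole) (kernel_map U j \<phi>)"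
  unfolding holomorphic_into_def
proof (intro conjI ballI)
  let ?f = "kernel_map U j \<phi>" and ?N = "nrm (dual Z) \<phi>"
  define s where "s \<gamma> = (\<lambda>y. \<phi> (j (tens \<gamma> y)))" for \<gamma>
  note lin = tensor_slice_linear[OF \<phi>, folded s_def]
  note G = nspace_closed[OF normed_space_Ginf] and Gsub = nspace_subspace[OF normed_space_Ginf]
  have f: "?f x = s (eval_at U x)" if "x \<in> U" for x
    using that by (simp add: kernel_map_def s_def)
  have N: "0 \<le> ?N" by (rule dual_nrm_nonneg[OF completion_normed \<phi>])
  show "?f ` U \<subseteq> points (dual whole)"
    using f eval_at_Ginf linear_betweenD(1)[OF lin] by auto
  fix a assume a: "a \<in> U"
  obtain r where r: "0 < r" "ball a r \<subseteq> U" using U a by (auto simp: open_contains_ball)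
  note dG = eval_deriv_Ginf[OF U r]
  define L where "L v = s (eval_deriv U a v)" for v
  have "linear_between whole (dual whole) L"
    using linear_betweenD[OF lin] dG
    by (auto simp: linear_between_def L_def eval_deriv_add[OF U a] eval_deriv_scale[OF U a])
  moreover have "\<forall>v. nrm (dual whole) (L v) \<le> (?N * (2 / r)) * norm v"
  proof
    fix v
    have "nrm (dual whole) (L v) \<le> ?N * nrm (Ginf U) (eval_deriv U a v)"
      unfolding L_def s_def by (rule tensor_slice_nrm_le[OF \<phi> dG])
    also have "\<dots> \<le> ?N * (2 / r * norm v)"
      using nrm_eval_deriv_le[OF U r, of v] N by (intro mult_left_mono) auto
    finally show "nrm (dual whole) (L v) \<le> (?N * (2 / r)) * norm v" by simp
  qed
  moreover have "((\<lambda>x. nrm (dual whole) (?f x - ?f a - L (x - a)) / norm (x - a)) \<longlongrightarrow> 0) (at a within U)"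
  proof (rule Lim_null_comparison)
    have "\<forall>\<^sub>F x in at a within U. x \<in> U \<and> x \<in> ball a (r / 4) \<and> x \<noteq> a"
      using r eventually_at_ball'[of "r / 4" a U] by (auto elim: eventually_mono)
    then show "\<forall>\<^sub>F x in at a within U. norm (nrm (dual whole) (?f x - ?f a - L (x - a)) / norm (x - a))
        \<le> ?N * (32 / r\<^sup>2) * norm (x - a)"
    proof (rule eventually_mono)
      fix x assume "x \<in> U \<and> x \<in> ball a (r / 4) \<and> x \<noteq> a"
      then have x: "x \<in> U" "norm (x - a) \<le> r / 4" "x \<noteq> a" by (auto simp: dist_norm norm_minus_commute)
      let ?\<gamma> = "eval_at U x - eval_at U a - eval_deriv U a (x - a)"
      note Gs = eval_at_Ginf[OF x(1)] eval_at_Ginf[OF a] dG[of "x - a"]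
      have \<gamma>: "?\<gamma> \<in> points (Ginf U)" using Gs G(3) by blast
      have "?f x - ?f a - L (x - a) = s ?\<gamma>"
        using linear_between_diff[OF lin Gsub G(3)[OF Gs(1,2)] Gs(3)] linear_between_diff[OF lin Gsub Gs(1,2)]
          f x a by (simp add: L_def)
      moreover have "nrm (dual whole) (s ?\<gamma>) \<le> ?N * nrm (Ginf U) ?\<gamma>"
        unfolding s_def by (rule tensor_slice_nrm_le[OF \<phi> \<gamma>])
      moreover have "\<dots> \<le> ?N * (32 / r\<^sup>2 * (norm (x - a))\<^sup>2)"
        using nrm_eval_remainder_le[OF U r x(2)] N by (intro mult_left_mono) auto
      moreover have "0 \<le> nrm (dual whole) (s ?\<gamma>)"
        by (rule dual_nrm_nonneg[OF normed_space_whole linear_betweenD(1)[OF lin \<gamma>]])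
      ultimately show "norm (nrm (dual whole) (?f x - ?f a - L (x - a)) / norm (x - a))
          \<le> ?N * (32 / r\<^sup>2) * norm (x - a)"
        using x(3) by (simp add: divide_le_eq power2_eq_square mult_ac)
    qed
    have "((\<lambda>x. ?N * (32 / r\<^sup>2) * norm (x - a)) \<longlongrightarrow> ?N * (32 / r\<^sup>2) * norm (a - a)) (at a within U)"
      by (intro tendsto_intros)
    then show "((\<lambda>x. ?N * (32 / r\<^sup>2) * norm (x - a)) \<longlongrightarrow> 0) (at a within U)" by simp
  qed
  ultimately show "\<exists>L. linear_between whole (dual whole) L \<and> (\<exists>K. \<forall>h. nrm (dual whole) (L h) \<le> K * norm h) \<and>
      ((\<lambda>x. nrm (dual whole) (?f x - ?f a - L (x - a)) / norm (x - a)) \<longlongrightarrow> 0) (at a within U)"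
    by blast
qed

text \<open>With scalars \<open>c\<^sub>i\<close> of modulus \<open>\<le> |l\<^sub>i|\<close> that make all terms nonnegative, the left-hand side of the
summing inequality is \<open>\<Sum> z\<^sub>i(c\<^sub>i f(x\<^sub>i))\<close>. For \<open>y\<^sub>i \<in> F\<close> in place of \<open>z\<^sub>i\<close> this is the value of \<open>\<phi>\<close> at
\<open>\<Sum> c\<^sub>i \<delta>(x\<^sub>i) \<otimes> y\<^sub>i\<close>, which the definition of \<open>g\<^sub>p\<close> bounds; local reflexivity does the rest.\<close>

lemma kernel_map_cohen_bound:
  assumes \<phi>: "\<phi> \<in> points (dual Z)"
  shows "cohen_bound p U (dual whole) (kernel_map U j \<phi>) (nrm (dual Z) \<phi>)"
  unfolding cohen_bound_def
proof (intro conjI allI impI)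
  let ?f = "kernel_map U j \<phi>" and ?N = "nrm (dual Z) \<phi>"
  show N: "0 \<le> ?N" by (rule dual_nrm_nonneg[OF completion_normed \<phi>])
  fix n and l :: "nat \<Rightarrow> complex" and x :: "nat \<Rightarrow> 'e" and z :: "nat \<Rightarrow> ('f \<Rightarrow> complex) \<Rightarrow> complex"
  assume "\<forall>i<n. x i \<in> U \<and> z i \<in> points (dual (dual (whole :: 'f nspace)))"
  then have x: "x i \<in> U" and z: "z i \<in> points (dual (dual (whole :: 'f nspace)))" if "i < n" for i
    using that by auto
  note dF = normed_space_dual[OF normed_space_whole]
  define c where "c i = complex_of_real (cmod (l i)) * cnj (sgn (z i (?f (x i))))" for i
  have c_le: "cmod (c i) \<le> cmod (l i)" for i by (simp add: c_def norm_mult norm_sgn)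
  have c_eq: "c i * z i (?f (x i)) = complex_of_real (cmod (l i) * cmod (z i (?f (x i))))" for i
    using complex_norm_square[of "z i (?f (x i))"]
    by (cases "z i (?f (x i)) = 0") (simp_all add: c_def sgn_eq power2_eq_square field_simps)
  have f_in: "?f (x i) \<in> points (dual whole)" if "i < n" for i
    using kernel_map_holomorphic[OF \<phi>] x[OF that] by (auto simp: holomorphic_into_def)
  let ?S = "strong_norm p whole n l"
  have S: "0 \<le> ?S" by (simp add: strong_norm_def lq_norm_nonneg)
  have "cmod (\<Sum>i<n. z i (c i *\<^sub>C ?f (x i))) \<le> (?N * ?S) * weak_norm (conj_index p) (dual (dual whole)) n z"
  proof (rule weak_norm_local_reflexivity[OF p])
    show "c i *\<^sub>C ?f (x i) \<in> points (dual whole)" if "i < n" for i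
      using nspace_closed(4)[OF dF f_in[OF that]] .
    show "cmod (\<Sum>i<n. (c i *\<^sub>C ?f (x i)) (y i)) \<le> ?N * ?S * weak_norm (conj_index p) whole n y" for y
    proof -
      let ?u = "\<Sum>i<n. tens (c i *\<^sub>C eval_at U (x i)) (y i)"
      have G: "c i *\<^sub>C eval_at U (x i) \<in> points (Ginf U)" if "i < n" for i
        using nspace_closed(4)[OF normed_space_Ginf eval_at_Ginf[OF x[OF that]]] .
      have t: "tens (c i *\<^sub>C eval_at U (x i)) (y i) \<in> points GF" if "i < n" for i
        using G[OF that] by (intro tensor_in) auto
      have u: "?u \<in> points GF" using t by (intro complex_vector.subspace_sum[OF subspace_chevet_saphar]) auto
      have "\<phi> (j ?u) = (\<Sum>i<n. \<phi> (j (tens (c i *\<^sub>C eval_at U (x i)) (y i))))"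
        using linear_between_sum[OF completion_dual_comp[OF \<phi>] subspace_chevet_saphar, of "{..<n}" _ "\<lambda>_. 1"] t
        by (simp add: scaleC_one)
      also have "\<dots> = (\<Sum>i<n. (c i *\<^sub>C ?f (x i)) (y i))"
      proof (rule sum.cong)
        fix i assume "i \<in> {..<n}"
        then have i: "i < n" by simp
        show "\<phi> (j (tens (c i *\<^sub>C eval_at U (x i)) (y i))) = (c i *\<^sub>C ?f (x i)) (y i)"
          using linear_betweenD(3)[OF tensor_slice_linear[OF \<phi>] eval_at_Ginf[OF x[OF i]], of "c i"] x[OF i]
          by (auto simp: kernel_map_def fun_eq_iff scaleC_fun_def)
      qed simp
      finally have "cmod (\<Sum>i<n. (c i *\<^sub>C ?f (x i)) (y i)) = cmod (\<phi> (j ?u))" by simp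
      also have "\<dots> \<le> ?N * nrm Z (j ?u)"
        by (rule dual_bound[OF completion_normed \<phi> linear_betweenD(1)[OF completion_linear u]])
      also have "\<dots> \<le> ?N * (strong_norm p (Ginf U) n (\<lambda>i. c i *\<^sub>C eval_at U (x i)) * weak_norm (conj_index p) whole n y)"
        unfolding completion_nrm[OF u] using G by (intro mult_left_mono N chevet_saphar_norm_le p normed_space_whole) auto
      also have "\<dots> \<le> ?N * (?S * weak_norm (conj_index p) whole n y)"
      proof (intro mult_left_mono mult_right_mono N)
        show "0 \<le> weak_norm (conj_index p) whole n y"
          by (rule weak_norm_nonneg[OF normed_space_whole conj_index_ge_1[OF p]]) simp
        show "strong_norm p (Ginf U) n (\<lambda>i. c i *\<^sub>C eval_at U (x i)) \<le> ?S"
          unfolding strong_norm_def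
        proof (rule lq_norm_mono[OF p])
          fix i assume i: "i < n"
          have "nrm (Ginf U) (c i *\<^sub>C eval_at U (x i)) = cmod (c i) * nrm (Ginf U) (eval_at U (x i))"
            by (rule nspace_scale[OF normed_space_Ginf eval_at_Ginf[OF x[OF i]]])
          also have "\<dots> \<le> cmod (l i) * 1"
            using c_le nrm_eval_at_le[OF x[OF i]] nspace_nonneg[OF normed_space_Ginf eval_at_Ginf[OF x[OF i]]]
            by (intro mult_mono) auto
          finally show "0 \<le> nrm (Ginf U) (c i *\<^sub>C eval_at U (x i)) \<and>
              nrm (Ginf U) (c i *\<^sub>C eval_at U (x i)) \<le> nrm whole (l i)"
            using nspace_nonneg[OF normed_space_Ginf G[OF i]] by simp
        qed
      qed
      finally show ?thesis by (simp add: mult.assoc)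
    qed
  qed (use N S z in auto)
  moreover have "(\<Sum>i<n. z i (c i *\<^sub>C ?f (x i))) = complex_of_real (\<Sum>i<n. cmod (l i) * cmod (z i (?f (x i))))"
    unfolding of_real_sum
  proof (rule sum.cong)
    fix i assume "i \<in> {..<n}"
    then have i: "i < n" by simp
    show "z i (c i *\<^sub>C ?f (x i)) = complex_of_real (cmod (l i) * cmod (z i (?f (x i))))"
      unfolding dual_scale[OF z[OF i] f_in[OF i]] by (rule c_eq)
  qed simp
  moreover have "0 \<le> (\<Sum>i<n. cmod (l i) * cmod (z i (?f (x i))))" by (intro sum_nonneg) auto
  ultimately show "(\<Sum>i<n. cmod (l i) * cmod (z i (?f (x i))))
      \<le> ?N * ?S * weak_norm (conj_index p) (dual (dual whole)) n z"
    by (simp only: norm_of_real abs_of_nonneg)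
qed

text \<open>The functional is first defined on all of \<open>\<G>\<^sup>\<infinity>(U) \<otimes> F\<close> as evaluation of tensors at the bilinear form
\<open>A \<gamma> y = \<gamma> (f(\<cdot>)(y))\<close>. Its bound by \<open>C g\<^sub>p\<close> is proved directly for representations of a tensor with
arbitrary \<open>\<gamma>\<^sub>i \<in> \<G>\<^sup>\<infinity>(U)\<close>, the ones that enter the definition of \<open>g\<^sub>p\<close>; then Hahn--Banach applies.\<close>

lemma kernel_map_surj:
  assumes f: "f \<in> points (cohen_space p U (dual (whole :: 'f nspace)))"
    and C: "cohen_bound p U (dual whole) f C"
  obtains \<phi> where "\<phi> \<in> points (dual Z)" "nrm (dual Z) \<phi> \<le> C" "kernel_map U j \<phi> = f"
proof -
  note dF = normed_space_dual[OF normed_space_whole]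
  have hol: "holomorphic_into U (dual whole) f" and f0: "\<And>x. x \<notin> U \<Longrightarrow> f x = 0"
    using f by (auto simp: cohen_space_def)
  have f_in: "f x \<in> points (dual whole)" if "x \<in> U" for x
    using hol that by (auto simp: holomorphic_into_def)
  have C0: "0 \<le> C" using C by (simp add: cohen_bound_def)
  \<comment> \<open>The summing inequality for the elements of \<open>F\<^sup>*\<^sup>*\<close> that come from \<open>F\<close>.\<close>
  have cohen: "(\<Sum>i<n. cmod (l i) * cmod (f (x i) (y i)))
      \<le> C * strong_norm p whole n l * weak_norm (conj_index p) whole n y"
    if x: "\<And>i. i < n \<Longrightarrow> x i \<in> U" for n l x y
  proof -
    have "(\<Sum>i<n. cmod (l i) * cmod (f (x i) (y i)))
        = (\<Sum>i<n. cmod (l i) * cmod (bidual_eval whole (y i) (f (x i))))"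
      using x f_in by (intro sum.cong) (auto simp: bidual_eval_def)
    also have "\<dots> \<le> C * strong_norm p whole n l * weak_norm (conj_index p) (dual (dual whole)) n (\<lambda>i. bidual_eval whole (y i))"
      using C[unfolded cohen_bound_def, THEN conjunct2, rule_format,
          of n x "\<lambda>i. bidual_eval whole (y i)" l] x by (simp add: bidual_eval_in[OF normed_space_whole])
    also have "\<dots> \<le> C * strong_norm p whole n l * weak_norm (conj_index p) whole n y"
      by (intro mult_left_mono weak_norm_bidual_eval_le normed_space_whole conj_index_ge_1 p
          mult_nonneg_nonneg C0) (auto simp: strong_norm_def lq_norm_nonneg)
    finally show ?thesis .
  qed
  define h where "h y = (\<lambda>x. f x y)" for y
  have h: "h y \<in> points (Hinf U)" for y
  proof -
    have "holomorphic_into U whole (h y)"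
      unfolding holomorphic_into_def
    proof (intro conjI ballI)
      fix a assume a: "a \<in> U"
      obtain L K where L: "linear_between whole (dual whole) L"
        and K: "\<And>v. nrm (dual whole) (L v) \<le> K * norm v"
        and lim: "((\<lambda>x. nrm (dual whole) (f x - f a - L (x - a)) / norm (x - a)) \<longlongrightarrow> 0) (at a within U)"
        using hol a unfolding holomorphic_into_def by blast
      have Lin: "L v \<in> points (dual whole)" for v using linear_betweenD(1)[OF L] by simp
      have "linear_between whole whole (\<lambda>v. L v y)"
        using linear_betweenD[OF L] by (simp add: linear_between_def scaleC_fun_def)
      moreover have "\<forall>v. nrm whole (L v y) \<le> (K * norm y) * norm v"
      proof
        fix v
        have "cmod (L v y) \<le> nrm (dual whole) (L v) * norm y"
          using dual_bound[OF normed_space_whole Lin] by simp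
        also have "\<dots> \<le> K * norm v * norm y" by (intro mult_right_mono K) simp
        finally show "nrm whole (L v y) \<le> (K * norm y) * norm v" by (simp add: mult_ac)
      qed
      moreover have "((\<lambda>x. nrm whole (h y x - h y a - L (x - a) y) / norm (x - a)) \<longlongrightarrow> 0) (at a within U)"
      proof (rule Lim_null_comparison)
        show "((\<lambda>x. nrm (dual whole) (f x - f a - L (x - a)) / norm (x - a) * norm y) \<longlongrightarrow> 0) (at a within U)"
          using tendsto_mult_right[OF lim, of "norm y"] by simp
        have "\<forall>\<^sub>F x in at a within U. x \<in> U" by (simp add: eventually_at_filter)
        then show "\<forall>\<^sub>F x in at a within U. norm (nrm whole (h y x - h y a - L (x - a) y) / norm (x - a))
            \<le> nrm (dual whole) (f x - f a - L (x - a)) / norm (x - a) * norm y"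
        proof (rule eventually_mono)
          fix x assume x: "x \<in> U"
          have "f x - f a - L (x - a) \<in> points (dual whole)"
            using f_in x a Lin nspace_closed(3)[OF dF] by blast
          from dual_bound[OF normed_space_whole this, of y]
          show "norm (nrm whole (h y x - h y a - L (x - a) y) / norm (x - a))
              \<le> nrm (dual whole) (f x - f a - L (x - a)) / norm (x - a) * norm y"
            by (simp add: h_def divide_right_mono)
        qed
      qed
      ultimately show "\<exists>L. linear_between whole whole L \<and> (\<exists>K. \<forall>v. nrm whole (L v) \<le> K * norm v) \<and>
          ((\<lambda>x. nrm whole (h y x - h y a - L (x - a)) / norm (x - a)) \<longlongrightarrow> 0) (at a within U)"
        by blast
    qed simp
    moreover have "bounded (h y ` U)"
    proof (rule boundedI)
      fix w assume "w \<in> h y ` U"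
      then obtain x where x: "x \<in> U" "w = f x y" by (auto simp: h_def)
      have "cmod (f x y) \<le> C * strong_norm p whole (Suc 0) (\<lambda>_. 1 :: complex) * weak_norm (conj_index p) whole (Suc 0) (\<lambda>_. y)"
        using cohen[of "Suc 0" "\<lambda>_. x" "\<lambda>_. 1" "\<lambda>_. y"] x by simp
      then show "norm w \<le> C * strong_norm p whole (Suc 0) (\<lambda>_. 1 :: complex) * weak_norm (conj_index p) whole (Suc 0) (\<lambda>_. y)"
        using x by simp
    qed
    ultimately show ?thesis by (simp add: Hinf_def h_def f0)
  qed
  have h_add: "h (y + y') = h y + h y'" and h_scale: "h (c *\<^sub>C y) = c *\<^sub>C h y" for y y' c
    using f_in f0 by (auto simp: h_def fun_eq_iff dual_add dual_scale scaleC_fun_def scaleC_complex_def)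
      (metis dual_add dual_scale UNIV_I whole_simps(1) add_0 mult_zero_right zero_fun_apply)+
  define A where "A \<gamma> y = \<gamma> (h y)" for \<gamma> :: "('e \<Rightarrow> complex) \<Rightarrow> complex" and y
  have "A \<gamma> (y + y') = A \<gamma> y + A \<gamma> y'" "A \<gamma> (c *\<^sub>C y) = c * A \<gamma> y" if "\<gamma> \<in> points (Ginf U)" for \<gamma> y y' c
    using Ginf_dual[OF that] h by (simp_all add: A_def h_add h_scale dual_add dual_scale)
  then have A: "bilinear_form (Ginf U) whole A"
    unfolding bilinear_form_def linear_between_def
    by (auto simp: scaleC_complex_def) (auto simp: A_def scaleC_fun_def scaleC_complex_def)
  have tA: "tens \<gamma> y A = \<gamma> (h y)" for \<gamma> y using A by (simp add: tensor_def A_def)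
  \<comment> \<open>\<open>|\<gamma> i (h (y i))| \<le> \<parallel>\<gamma> i\<parallel> \<parallel>h (y i)\<parallel>\<close>, and each supremum \<open>\<parallel>h (y i)\<parallel>\<close> is approached at its own point.\<close>
  have main: "cmod (\<Sum>i<n. \<gamma> i (h (y i))) \<le> C * (strong_norm p (Ginf U) n \<gamma> * weak_norm (conj_index p) whole n y)"
    if \<gamma>: "\<And>i. i < n \<Longrightarrow> \<gamma> i \<in> points (Ginf U)" for n \<gamma> y
  proof -
    let ?N = "nrm (Ginf U)"
    have N: "0 \<le> ?N (\<gamma> i)" if "i < n" for i by (rule nspace_nonneg[OF normed_space_Ginf \<gamma>[OF that]])
    have "cmod (\<Sum>i<n. \<gamma> i (h (y i))) \<le> (\<Sum>i<n. ?N (\<gamma> i) * nrm (Hinf U) (h (y i)))"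
      using dual_bound[OF normed_space_Hinf Ginf_dual[OF \<gamma>] h]
      by (intro order_trans[OF norm_sum] sum_mono) auto
    also have "\<dots> \<le> C * strong_norm p (Ginf U) n \<gamma> * weak_norm (conj_index p) whole n y"
    proof (cases "U = {}")
      case True
      then have "nrm (Hinf U) (h y) = 0" for y by (simp add: Hinf_nrm)
      then show ?thesis
        using C0 weak_norm_nonneg[OF normed_space_whole conj_index_ge_1[OF p], of n y]
        by (simp add: strong_norm_def lq_norm_nonneg)
    next
      case False
      show ?thesis
      proof (rule sum_weighted_approx_le)
        show "\<exists>x\<in>U. nrm (Hinf U) (h (y i)) \<le> cmod (h (y i) x) + e" if "0 < e" for i e
          by (rule Hinf_nrm_approx[OF False h that])
        fix x assume x: "\<And>i. i \<in> {..<n} \<Longrightarrow> x i \<in> U"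
        have "(\<Sum>i<n. ?N (\<gamma> i) * cmod (h (y i) (x i)))
            = (\<Sum>i<n. cmod (complex_of_real (?N (\<gamma> i))) * cmod (f (x i) (y i)))"
          using N by (intro sum.cong) (auto simp: h_def)
        also have "\<dots> \<le> C * strong_norm p whole n (\<lambda>i. complex_of_real (?N (\<gamma> i))) * weak_norm (conj_index p) whole n y"
          using x by (intro cohen) auto
        also have "strong_norm p whole n (\<lambda>i. complex_of_real (?N (\<gamma> i))) = strong_norm p (Ginf U) n \<gamma>"
          unfolding strong_norm_def using N by (intro lq_norm_cong) auto
        finally show "(\<Sum>i<n. ?N (\<gamma> i) * cmod (h (y i) (x i))) \<le> C * strong_norm p (Ginf U) n \<gamma> * weak_norm (conj_index p) whole n y" .
      qed (use N in auto)
    qed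
    finally show ?thesis by (simp add: mult.assoc)
  qed
  have lin: "linear_between GF whole (\<lambda>u. u A)"
    by (simp add: linear_between_def scaleC_fun_def)
  have bound: "cmod (u A) \<le> C * nrm Z (j u)" if u: "u \<in> points GF" for u
  \<comment> \<open>For \<open>C > 0\<close> the bound is divided by \<open>C\<close>, to compare with the infimum that defines \<open>g\<^sub>p\<close>.\<close>
  proof (cases "C = 0")
    case True
    obtain n :: nat and \<gamma> y where r: "\<And>i. i < n \<Longrightarrow> \<gamma> i \<in> points (Ginf U) \<and> y i \<in> points (whole :: 'f nspace)"
      "u = (\<Sum>i<n. tens (\<gamma> i) (y i))"
      using tensor_representation[OF nspace_subspace[OF normed_space_Ginf] u] by blast
    have "u A = (\<Sum>i<n. \<gamma> i (h (y i)))"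
      unfolding r(2) by (subst additive_sum[of "\<lambda>u. u A"]) (simp_all add: tA)
    then show ?thesis using main[of n \<gamma> y] r(1) True by simp
  next
    case False
    with C0 have C_pos: "0 < C" by simp
    have "cmod (u A) / C \<le> chevet_saphar_norm p (Ginf U) whole u"
    proof (rule chevet_saphar_norm_ge[OF nspace_subspace[OF normed_space_Ginf] u])
      fix n \<gamma> and y :: "nat \<Rightarrow> 'f"
      assume \<gamma>: "\<And>i. i < n \<Longrightarrow> \<gamma> i \<in> points (Ginf U) \<and> y i \<in> points whole"
        and u: "u = (\<Sum>i<n. tens (\<gamma> i) (y i))"
      have "u A = (\<Sum>i<n. \<gamma> i (h (y i)))"
        unfolding u by (subst additive_sum[of "\<lambda>u. u A"]) (simp_all add: tA)
      then show "cmod (u A) / C \<le> strong_norm p (Ginf U) n \<gamma> * weak_norm (conj_index p) whole n y"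
        using main[of n \<gamma> y] \<gamma> C_pos by (simp add: divide_le_eq mult.commute)
    qed
    then show ?thesis using C_pos completion_nrm[OF u] by (simp add: divide_le_eq mult.commute)
  qed
  obtain \<phi> where \<phi>: "\<phi> \<in> points (dual Z)" "nrm (dual Z) \<phi> \<le> C" "\<And>u. u \<in> points GF \<Longrightarrow> \<phi> (j u) = u A"
    using hahn_banach_factor_nspace[OF subspace_chevet_saphar completion_normed completion_linear lin C0 bound] by blast
  have "kernel_map U j \<phi> x y = f x y" for x y
  proof (cases "x \<in> U")
    case True
    then have "kernel_map U j \<phi> x y = eval_at U x (h y)"
      using \<phi>(3)[OF tensor_in[OF eval_at_Ginf[OF True], of y]] by (simp add: kernel_map_def tA)
    then show ?thesis using h by (simp add: eval_at_def h_def)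
  qed (simp add: kernel_map_def f0)
  then have "kernel_map U j \<phi> = f" by (simp add: fun_eq_iff)
  with \<phi> that show ?thesis by blast
qed

text \<open>The difference \<open>\<rho>\<close> of two such functionals vanishes on \<open>\<Delta>(U) \<otimes> F\<close>, then on \<open>\<G>\<^sup>\<infinity>(U) \<otimes> F\<close> by
\<open>|\<rho>(\<gamma> \<otimes> y)| \<le> \<parallel>\<rho>\<parallel> \<parallel>\<gamma>\<parallel> \<parallel>y\<parallel>\<close>, and on \<open>Z\<close> by density.\<close>

lemma kernel_map_inj:
  assumes \<phi>: "\<phi> \<in> points (dual Z)" and \<psi>: "\<psi> \<in> points (dual Z)" and eq: "kernel_map U j \<phi> = kernel_map U j \<psi>"
  shows "\<phi> = \<psi>"
proof -
  define \<rho> where "\<rho> = \<phi> - \<psi>"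
  have \<rho>: "\<rho> \<in> points (dual Z)"
    unfolding \<rho>_def by (rule nspace_closed(3)[OF normed_space_dual[OF completion_normed] \<phi> \<psi>])
  note lin = completion_dual_comp[OF \<rho>] and G_sub = nspace_subspace[OF normed_space_Ginf]
  let ?N = "nrm (dual Z) \<rho>"
  have N: "0 \<le> ?N" by (rule dual_nrm_nonneg[OF completion_normed \<rho>])
  let ?s = "\<lambda>\<gamma> y. \<rho> (j (tens \<gamma> y))"
  have s_lin: "linear_between (Ginf U) (dual whole) ?s" by (rule tensor_slice_linear[OF \<rho>])
  have "?s (eval_at U x) y = 0" if "x \<in> U" for x y
    using fun_cong[OF fun_cong[OF eq, of x], of y] that by (simp add: kernel_map_def \<rho>_def)
  moreover have "complex_vector.subspace {\<gamma> \<in> points (Ginf U). ?s \<gamma> = 0}"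
    using linear_betweenD[OF s_lin] linear_between_0[OF s_lin G_sub] nspace_closed[OF normed_space_Ginf]
    by (intro complex_vector.subspaceI) auto
  ultimately have "Delta U \<subseteq> {\<gamma> \<in> points (Ginf U). ?s \<gamma> = 0}"
    unfolding Delta_def using eval_at_Ginf by (intro complex_vector.span_minimal) (auto simp: fun_eq_iff)
  then have s_Delta: "?s \<beta> = 0" if "\<beta> \<in> Delta U" for \<beta> using that by blast
  have s0: "?s \<gamma> y = 0" if \<gamma>: "\<gamma> \<in> points (Ginf U)" for \<gamma> y
  proof -
    have "cmod (?s \<gamma> y) \<le> 0 + e" if e: "0 < e" for e
    proof -
      have "0 < e / (?N * norm y + 1)" using e N by (simp add: add_nonneg_pos)
      from Ginf_approx[OF \<gamma> this] obtain \<beta> where \<beta>: "\<beta> \<in> Delta U"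
        "nrm (Ginf U) (\<gamma> - \<beta>) < e / (?N * norm y + 1)" by auto
      have \<beta>G: "\<beta> \<in> points (Ginf U)" using \<beta>(1) Delta_Ginf by blast
      have "?s (\<gamma> - \<beta>) = ?s \<gamma>"
        using linear_between_diff[OF s_lin G_sub \<gamma> \<beta>G] s_Delta[OF \<beta>(1)] by simp
      then have "cmod (?s \<gamma> y) = cmod (?s (\<gamma> - \<beta>) y)" by (simp add: fun_eq_iff)
      also have "\<dots> \<le> ?N * nrm (Ginf U) (\<gamma> - \<beta>) * norm y"
        by (rule tensor_slice_bound[OF \<rho> nspace_closed(3)[OF normed_space_Ginf \<gamma> \<beta>G]])
      also have "\<dots> = (?N * norm y) * nrm (Ginf U) (\<gamma> - \<beta>)" by simp
      also have "\<dots> \<le> (?N * norm y + 1) * (e / (?N * norm y + 1))"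
        using \<beta>(2) N nspace_nonneg[OF normed_space_Ginf nspace_closed(3)[OF normed_space_Ginf \<gamma> \<beta>G]]
        by (intro mult_mono) auto
      also have "\<dots> = e" using N by (simp add: add_nonneg_eq_0_iff add_nonneg_pos less_imp_neq[symmetric])
      finally show ?thesis by simp
    qed
    then have "cmod (?s \<gamma> y) \<le> 0" by (rule field_le_epsilon)
    then show ?thesis by simp
  qed
  have j0: "\<rho> (j u) = 0" if u: "u \<in> points GF" for u
  proof -
    obtain n :: nat and \<gamma> y where r: "\<And>i. i < n \<Longrightarrow> \<gamma> i \<in> points (Ginf U) \<and> y i \<in> points (whole :: 'f nspace)"
      "u = (\<Sum>i<n. tens (\<gamma> i) (y i))"
      using tensor_representation[OF G_sub u] by blast
    have "\<rho> (j u) = (\<Sum>i<n. \<rho> (j (tens (\<gamma> i) (y i))))"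
      using linear_between_sum[OF lin subspace_chevet_saphar, of "{..<n}" "\<lambda>i. tens (\<gamma> i) (y i)" "\<lambda>_. 1"] r
      by (simp add: scaleC_one tensor_in)
    then show ?thesis using r(1) s0 by simp
  qed
  have "\<rho> z = 0" for z
  proof (cases "z \<in> points Z")
    case True
    have "cmod (\<rho> z) \<le> 0 + e" if e: "0 < e" for e
    proof -
      have "0 < e / (?N + 1)" using e N by (simp add: add_nonneg_pos)
      from completion_dense[OF True this] obtain u where u: "u \<in> points GF" "nrm Z (z - j u) < e / (?N + 1)" by blast
      have ju: "j u \<in> points Z" by (rule linear_betweenD(1)[OF completion_linear u(1)])
      note zj = nspace_closed(3)[OF completion_normed True ju]
      have "cmod (\<rho> z) = cmod (\<rho> (z - j u))" using dual_diff[OF completion_normed \<rho> True ju] j0[OF u(1)] by simp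
      also have "\<dots> \<le> ?N * nrm Z (z - j u)" by (rule dual_bound[OF completion_normed \<rho> zj])
      also have "\<dots> \<le> (?N + 1) * (e / (?N + 1))"
        using u(2) N nspace_nonneg[OF completion_normed zj] by (intro mult_mono) auto
      also have "\<dots> = e" using N by simp
      finally show ?thesis by simp
    qed
    then have "cmod (\<rho> z) \<le> 0" by (rule field_le_epsilon)
    then show ?thesis by simp
  qed (rule dual_outside[OF \<rho>])
  then show ?thesis by (simp add: \<rho>_def fun_eq_iff)
qed

lemma kernel_map_delta_tensor:
  assumes \<phi>: "\<phi> \<in> points (dual Z)" and x: "\<And>i. i < n \<Longrightarrow> x i \<in> U"
  shows "\<phi> (j (delta_tensor U n l x y)) = (\<Sum>i<n. l i * kernel_map U j \<phi> (x i) (y i))"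
proof -
  have "\<phi> (j (delta_tensor U n l x y)) = (\<Sum>i<n. l i *\<^sub>C \<phi> (j (tens (eval_at U (x i)) (y i))))"
    unfolding delta_tensor_def using x
    by (intro linear_between_sum[OF completion_dual_comp[OF \<phi>] subspace_chevet_saphar] tensor_in eval_at_Ginf) auto
  then show ?thesis using x by (simp add: kernel_map_def scaleC_complex_def)
qed

lemma Lambda_kernel_map:
  assumes \<phi>: "\<phi> \<in> points (dual Z)"
  shows "Lambda U Z j (kernel_map U j \<phi>) = \<phi>"
  unfolding Lambda_def
proof (rule the_equality)
  show "\<phi> \<in> points (dual Z) \<and> (\<forall>n l x y. (\<forall>i<n. x i \<in> U) \<longrightarrow>
      \<phi> (j (delta_tensor U n l x y)) = (\<Sum>i<n. l i * kernel_map U j \<phi> (x i) (y i)))"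
    using \<phi> kernel_map_delta_tensor[OF \<phi>] by blast
  fix \<psi> assume \<psi>: "\<psi> \<in> points (dual Z) \<and> (\<forall>n l x y. (\<forall>i<n. x i \<in> U) \<longrightarrow>
      \<psi> (j (delta_tensor U n l x y)) = (\<Sum>i<n. l i * kernel_map U j \<phi> (x i) (y i)))"
  have "kernel_map U j \<psi> x y = kernel_map U j \<phi> x y" for x y
  proof (cases "x \<in> U")
    case True
    then have "\<psi> (j (delta_tensor U (Suc 0) (\<lambda>_. 1) (\<lambda>_. x) (\<lambda>_. y))) = kernel_map U j \<phi> x y"
      using \<psi> by simp
    then show ?thesis using True by (simp add: delta_tensor_def scaleC_one kernel_map_def)
  qed (simp add: kernel_map_def)
  then show "\<psi> = \<phi>" using \<psi> by (intro kernel_map_inj \<phi>) (auto simp: fun_eq_iff)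
qed

text \<open>The inequality \<open>\<parallel>\<phi>\<parallel> \<le> C\<close> for every summing constant \<open>C\<close> holds because surjectivity produces a preimage
of norm at most \<open>C\<close>, and injectivity identifies it with \<open>\<phi>\<close>.\<close>

lemma nrm_kernel_map:
  assumes \<phi>: "\<phi> \<in> points (dual Z)"
  shows kernel_map_in: "kernel_map U j \<phi> \<in> points (cohen_space p U (dual whole))"
    and "nrm (cohen_space p U (dual whole)) (kernel_map U j \<phi>) = nrm (dual Z) \<phi>"
proof -
  note bound = kernel_map_cohen_bound[OF \<phi>]
  show D: "kernel_map U j \<phi> \<in> points (cohen_space p U (dual whole))"
    using kernel_map_holomorphic[OF \<phi>] bound by (auto simp: cohen_space_def kernel_map_def)
  have "nrm (dual Z) \<phi> \<le> C" if "cohen_bound p U (dual whole) (kernel_map U j \<phi>) C" for C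
  proof -
    from kernel_map_surj[OF D that] obtain \<psi> where
      "\<psi> \<in> points (dual Z)" "nrm (dual Z) \<psi> \<le> C" "kernel_map U j \<psi> = kernel_map U j \<phi>" .
    then show ?thesis using kernel_map_inj[OF _ \<phi>] by blast
  qed
  then have "Inf {C. cohen_bound p U (dual whole) (kernel_map U j \<phi>) C} = nrm (dual Z) \<phi>"
    using bound by (intro cInf_eq_minimum) auto
  then show "nrm (cohen_space p U (dual whole)) (kernel_map U j \<phi>) = nrm (dual Z) \<phi>"
    by (simp add: cohen_space_def)
qed

lemma kernel_map_image: "kernel_map U j ` points (dual Z) = points (cohen_space p U (dual whole))"
proof
  show "points (cohen_space p U (dual whole)) \<subseteq> kernel_map U j ` points (dual Z)"
  proof
    fix f assume f: "f \<in> points (cohen_space p U (dual (whole :: 'f nspace)))"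
    then obtain C where "cohen_bound p U (dual whole) f C" by (auto simp: cohen_space_def)
    from kernel_map_surj[OF f this] show "f \<in> kernel_map U j ` points (dual Z)" by blast
  qed
qed (use kernel_map_in in blast)

end

theorem theorem4p1:
  fixes U :: "'e::complex_banach set" and p :: ereal
    and Z :: "'z::complex_vector nspace"
    and j :: "(((('e \<Rightarrow> complex) \<Rightarrow> complex) \<Rightarrow> 'f::complex_banach \<Rightarrow> complex) \<Rightarrow> complex) \<Rightarrow> 'z"
  assumes "open U" and "1 \<le> p"
    and "is_completion (chevet_saphar_tensor p (Ginf U) (whole :: 'f nspace)) Z j"
  defines "D \<equiv> cohen_space p U (dual (whole :: 'f nspace))"
  shows "isometric_isomorphism D (dual Z) (Lambda U Z j) \<and>
    (\<forall>f\<in>points D. \<forall>n l x y. (\<forall>i<n. x i \<in> U) \<longrightarrow>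
       Lambda U Z j f (j (delta_tensor U n l x y)) = (\<Sum>i<n. l i * f (x i) (y i))) \<and>
    (\<forall>\<phi>\<in>points (dual Z). \<forall>x\<in>U. \<forall>y.
       inv_into (points D) (Lambda U Z j) \<phi> x y = \<phi> (j (tensor (Ginf U) whole (eval_at U x) y)))"
proof -
  note ctxt = assms(1-3)
  let ?K = "kernel_map U j"
  have image: "?K ` points (dual Z) = points D"
    unfolding D_def by (rule kernel_map_image[OF ctxt])
  have iso: "isometric_isomorphism D (dual Z) (Lambda U Z j)"
  proof (rule isometric_isomorphism_inverse)
    show "normed_space (dual Z)" by (rule normed_space_dual[OF completion_normed[OF ctxt]])
    show "linear_between (dual Z) D ?K"
      using image by (auto simp: linear_between_def kernel_map_linear)
    show "nrm D (?K \<phi>) = nrm (dual Z) \<phi>" if "\<phi> \<in> points (dual Z)" for \<phi>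
      unfolding D_def by (rule nrm_kernel_map(2)[OF ctxt that])
  qed (rule image, rule Lambda_kernel_map[OF ctxt])
  moreover have "Lambda U Z j f (j (delta_tensor U n l x y)) = (\<Sum>i<n. l i * f (x i) (y i))"
    if f: "f \<in> points D" and x: "\<forall>i<n. x i \<in> U" for f n l x y
  proof -
    obtain \<phi> where \<phi>: "\<phi> \<in> points (dual Z)" "f = ?K \<phi>" using f image by blast
    then show ?thesis
      using kernel_map_delta_tensor[OF ctxt \<phi>(1)] x by (simp add: Lambda_kernel_map[OF ctxt])
  qed
  moreover have "inv_into (points D) (Lambda U Z j) \<phi> x y = \<phi> (j (tensor (Ginf U) whole (eval_at U x) y))"
    if \<phi>: "\<phi> \<in> points (dual Z)" and x: "x \<in> U" for \<phi> x y
  proof -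
    have "inj_on (Lambda U Z j) (points D)"
      using iso by (simp add: isometric_isomorphism_def bij_betw_def)
    then have "inv_into (points D) (Lambda U Z j) \<phi> = ?K \<phi>"
      using image \<phi> by (intro inv_into_f_eq Lambda_kernel_map[OF ctxt]) auto
    then show ?thesis using x by (simp add: kernel_map_def)
  qed
  ultimately show ?thesis by blast
qed

end
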